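(* Let $(\mathcal F,\partial,\int)$ be a strongly ordinary shifted integro-differential algebra over an ordered field $K$, with initialization point $0$, and let $(T,\mathcal B)$ be a regular well-posed Stieltjes boundary problem over $\mathcal F$. Then for any given forcing function $f\in\mathcal P\mathcal F$ the boundary problem $$Tu=f,\qquad\beta(u)=0\quad(\beta\in\mathcal B)$$ admits exactly one solution $u\in\mathcal P\mathcal F$. If $G\in\mathcal F_\Phi[\partial,\int]$ is the Green's operator of $(T,\mathcal B)$ with Green's function $g(x,\xi)=G_{x\xi}\in\mathcal P_2\mathcal F$, the solution can be computed either via $u=Gf$ or via $$u(x)=I_\alpha^\beta\,g(x,\xi)\,f(\xi)\qquad\text{on }[\alpha,\beta],$$ where $\alpha,\beta\in K$ are chosen with $\alpha\le a_1<\dots<a_k\le\beta$, and $a_1<\dots<a_k$ are the elements $a\in K$ whose evaluations $\mathsf e_a$ occur in the boundary conditions $\mathcal B$.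
   Context: All algebras are commutative and unital, except the operator ring below. **Heaviside operator.** $H\colon K\to K$ is $H(a)=0$ for $a\le 0$ and $H(a)=1$ for $a>0$; $\bar H(a)=1-H(a)$; $a\sqcup b=\max(a,b)$. **Integro-differential algebra.** $(\mathcal F,\partial,\int)$ is a differential $K$-algebra with a $K$-linear map $\int$ such that $\partial\int=1$ and $f\int g=\int fg+\int(f'\int g)$. It is ordinary if $\ker\partial=K$; then $\mathsf e:=1-\int\partial$ is a $K$-algebra homomorphism $\mathcal F\to K$. It is strongly ordinary if it is ordinary and $\dim_K\ker T<\infty$ for every nonzero $T\in\mathcal F[\partial]$. It is shifted if there is a group homomorphism $S\colon(K,+)\to\operatorname{Aut}_K(\mathcal F)$, $c\mapsto S_c$, with $S_c\int-\int S_c=\mathsf e_c\int$ and $S_c\partial=\partial S_c$, where $\mathsf e_c:=\mathsf e\circ S_c$. Write $f(c):=\mathsf e_c(f)$, $\int_c:=(1-\mathsf e_c)\int$, $\int_c^d:=\mathsf e_d\int_c$. The initialization point of $\int$ is $0$ since $\mathsf e=\mathsf e_0$. **Piecewise extension and distribution module.** $\mathcal P\mathcal F$ is the free $\mathcal F$-module on $1,H_a$ $(a\in K)$, an algebra via $H_aH_b=H_{a\sqcup b}$, with $\int fH_a=(\int_af)H_a+\bar H(a)\int_0^af$ extending $\int$ on $\mathcal F$, and with characters $\mathsf e_c$ extending those of $\mathcal F$ by $\mathsf e_c(H_a)=\bar H(a-c)$. The distribution module $\mathcal D\mathcal F\supset\mathcal P\mathcal F$ is the differential $\mathcal F$-module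 generated by $1$ (with $1'=0$) and differential indeterminates $H_a$ subject to the relations $f\delta_a=\mathsf e_a(f)\delta_a$ $(f\in\mathcal F)$ and their derivatives, where $\delta_a:=H_a'$; its derivation is denoted $D$. Its evaluations are the $K$-linear maps $\mathsf E_c\colon\mathcal D\mathcal F\to K$ equal to $\mathsf e_c$ on $\mathcal P\mathcal F$ with $\mathsf E_c(f\delta_a^{(k)})=0$. The differential equation $Tu=f$ is understood in $\mathcal D\mathcal F$, with $\partial$ acting as $D$. **Operator ring.** With $\Phi=\{\mathsf e_a\mid a\in K\}$, $\mathcal F_\Phi[\partial,\int]$ is the $K$-algebra generated by $\mathcal F$, $\partial$, $\int$ and $\Phi$ modulo the relations $\partial f=f\partial+f'$, $\partial\int=1$, $\partial\mathsf e_a=0$, $\mathsf e_af=f(a)\mathsf e_a$, $\mathsf e_b\mathsf e_a=\mathsf e_a$, $\mathsf e_0\int=0$, $\int f\int=(\int f)\int-\int(\int f)$, $\int f\partial=f-\int f'-f(0)\mathsf e_0$, $\int f\mathsf e_a=(\int f)\mathsf e_a$. It acts on $\mathcal F$, and every element is a $K$-linear combination of $u\partial^i$, $u\int v$, $u\,\mathsf e_a\partial^i$, $u\,\mathsf e_a\int v$. **Boundary problems.** A Stieltjes condition is a $K$-linear combination of local terms $\mathsf e_a\partial^i$ and global terms $\mathsf e_a\int v$; on $u\in\mathcal P\mathcal F$ these act as $\mathsf E_aD^iu$ and $\mathsf e_a\int(vu)$. A Stieltjes boundary problem is a pair $(T,\mathcal B)$ with $T\in\mathcal F[\partial]$ monic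 of order $n$ and $\mathcal B\subset\mathcal F^*$ spanned by $n$ linearly independent Stieltjes conditions. It is regular if $\mathcal F=\ker T\oplus\mathcal B^\perp$ (kernel of $T$ on $\mathcal F$; $\mathcal B^\perp=\{f\in\mathcal F\mid\beta(f)=0\ \forall\beta\in\mathcal B\}$); equivalently, it has exactly one solution $u\in\mathcal F$ for every $f\in\mathcal F$. Its Green's operator $G\in\mathcal F_\Phi[\partial,\int]$ is characterized by $TG=1$, $\operatorname{Im}G=\mathcal B^\perp$. It is well-posed if all local terms $\mathsf e_a\partial^k$ occurring in its boundary conditions have $k<n$; in this case $G$ is a $K$-linear combination of operators $u\int v$ and $u\,\mathsf e_a\int v$, which act on $\mathcal P\mathcal F$ via multiplication, $\int$ and $\mathsf e_a$ on $\mathcal P\mathcal F$. **Bivariate piecewise functions.** $\mathcal F_2:=\mathcal F\otimes_K\mathcal F$, $f(x):=f\otimes1$, $f(\xi):=1\otimes f$. $\mathcal P_2\mathcal F$ is the $\mathcal F_2$-algebra generated by $H_a(x),H_a(\xi)$ $(a\in K)$ and $\hat H=H(x-\xi)$ subject to $H_a(x)H_b(x)=H_{a\sqcup b}(x)$, $H_a(\xi)H_b(\xi)=H_{a\sqcup b}(\xi)$, $\hat H^2=\hat H$ and $H_a(x)\hat H=H_a(\xi)\hat H+H_a(x)(1-H_a(\xi))$; it is free over $\mathcal F_2$ with basis $1,H_a(x),H_a(\xi),H_a(x)H_b(\xi),\hat H,H_a(x)\hat H$. For $f\in\mathcal P\mathcal F$, $f(x)$ and $f(\xi)$ denote its images under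 $H_a\mapsto H_a(x)$, respectively $H_a\mapsto H_a(\xi)$. $\mathcal P_x\mathcal F\subset\mathcal P_2\mathcal F$ is the $\mathcal F_2$-subalgebra generated by the $H_a(x)$. The map $I^\xi\colon\mathcal P_2\mathcal F\to\mathcal P_2\mathcal F$ is the $K$-linear map commuting with multiplication by all $f(x)$ $(f\in\mathcal F)$ and $H_a(x)$ such that for $g\in\mathcal F$, $\Gamma:=\int g$: $I^\xi g(\xi)=\Gamma(\xi)$, $I^\xi g(\xi)H_a(\xi)=(\int_ag)(\xi)H_a(\xi)+\bar H(a)\int_0^ag$, $I^\xi g(\xi)\hat H=(\Gamma(\xi)-\Gamma(x))\hat H+\Gamma(x)H_0(x)$. For $c\in K$, $\mathsf E^\xi_c\colon\mathcal P_2\mathcal F\to\mathcal P_x\mathcal F$ is the algebra homomorphism fixing all $f(x)$ and $H_a(x)$ with $g(\xi)\mapsto g(c)$, $H_a(\xi)\mapsto\bar H(a-c)$, $\hat H\mapsto H_c(x)$. Put $I_\alpha^\beta:=(\mathsf E^\xi_\beta-\mathsf E^\xi_\alpha)I^\xi$. **Green's function.** For a well-posed problem, $g(x,\xi)=G_{x\xi}\in\mathcal P_2\mathcal F$ is obtained $K$-linearly by $u\int v\mapsto u(x)v(\xi)(\hat H+H_0(\xi)-1)$ and $u\,\mathsf e_a\int v\mapsto u(x)v(\xi)(H_0(\xi)-H_a(\xi))$. **Equality on $[\alpha,\beta]$** in $\mathcal P_x\mathcal F$ means congruence modulo the ideal generated by $1-H_\alpha(x)$ and $H_\beta(x)$.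
   Formalization: Assumes a Green's operator exists in F_Φ[∂,∫] and, for the formulas via G, that it is unique and the order is positive; 0 is counted among the evaluation points when global terms of B do not cancel at 0 (otherwise false: T=∂, B=<e_1∫>, f=1 on [1,2]). *)

theory Defs
  imports "HOL-Computational_Algebra.Polynomial" "HOL-Library.Poly_Mapping"
begin

text \<open>
  Free modules and monoid algebras are finitely supported functions
  \<^typ>\<open>'a \<Rightarrow>\<^sub>0 'b\<close>.  A quotient whose relations depend on the given algebra (the distribution
  module, the operator ring, the bivariate piecewise functions) cannot be a HOL type; it is
  represented by the free object together with the congruence generated by the relations.
\<close>

definition pm_sum :: "('a \<Rightarrow> 'b \<Rightarrow> 'c) \<Rightarrow> ('a \<Rightarrow>\<^sub>0 'b::zero) \<Rightarrow> 'c::comm_monoid_add" where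
  "pm_sum \<phi> p = (\<Sum>k\<in>Poly_Mapping.keys p. \<phi> k (Poly_Mapping.lookup p k))"


section \<open>Integro-differential algebras\<close>

record ('k, 'f) ida =
  scl :: "'k \<Rightarrow> 'f \<Rightarrow> 'f"
  der :: "'f \<Rightarrow> 'f"
  itg :: "'f \<Rightarrow> 'f"
  shf :: "'k \<Rightarrow> 'f \<Rightarrow> 'f"

abbreviation klin :: "('k::field, 'f::comm_ring_1) ida \<Rightarrow> ('f \<Rightarrow> 'f) \<Rightarrow> bool" where
  "klin A \<equiv> Vector_Spaces.linear (scl A) (scl A)"

definition const :: "('k::linordered_field, 'f::comm_ring_1) ida \<Rightarrow> 'k \<Rightarrow> 'f" where
  "const A c = scl A c 1"

definition integro_differential_algebra ::
    "('k::linordered_field, 'f::comm_ring_1) ida \<Rightarrow> bool" where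
  "integro_differential_algebra A \<longleftrightarrow>
     vector_space (scl A) \<and> (\<forall>c f g. scl A c (f * g) = scl A c f * g) \<and>
     klin A (der A) \<and> (\<forall>f g. der A (f * g) = der A f * g + f * der A g) \<and>
     klin A (itg A) \<and> (\<forall>f. der A (itg A f) = f) \<and>
     (\<forall>f g. f * itg A g = itg A (f * g) + itg A (der A f * itg A g))"

definition ordinary :: "('k::linordered_field, 'f::comm_ring_1) ida \<Rightarrow> bool" where
  "ordinary A \<longleftrightarrow> {f. der A f = 0} = range (const A)"

text \<open>The skew polynomial \<open>\<Sum>i. t\<^sub>i \<partial>\<^sup>i\<close> is given by its coefficients; the multiplication of
  \<^typ>\<open>'f poly\<close> plays no role.\<close>

definition diffop :: "('k::linordered_field, 'f::comm_ring_1) ida \<Rightarrow> 'f poly \<Rightarrow> 'f \<Rightarrow> 'f" where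
  "diffop A T f = (\<Sum>i\<le>degree T. coeff T i * (der A ^^ i) f)"

definition strongly_ordinary :: "('k::linordered_field, 'f::comm_ring_1) ida \<Rightarrow> bool" where
  "strongly_ordinary A \<longleftrightarrow> ordinary A \<and>
     (\<forall>T. T \<noteq> 0 \<longrightarrow> (\<exists>X. finite X \<and> {f. diffop A T f = 0} \<subseteq> module.span (scl A) X))"

definition ev0 :: "('k::linordered_field, 'f::comm_ring_1) ida \<Rightarrow> 'f \<Rightarrow> 'k" where
  "ev0 A f = (THE c. const A c = f - itg A (der A f))"

definition ev :: "('k::linordered_field, 'f::comm_ring_1) ida \<Rightarrow> 'k \<Rightarrow> 'f \<Rightarrow> 'k" where
  "ev A c f = ev0 A (shf A c f)"

definition shifted :: "('k::linordered_field, 'f::comm_ring_1) ida \<Rightarrow> bool" where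
  "shifted A \<longleftrightarrow>
     (\<forall>c. bij (shf A c) \<and> klin A (shf A c) \<and> shf A c 1 = 1 \<and>
          (\<forall>f g. shf A c (f * g) = shf A c f * shf A c g)) \<and>
     (\<forall>c d. shf A (c + d) = shf A c \<circ> shf A d) \<and>
     (\<forall>c f. shf A c (itg A f) - itg A (shf A c f) = const A (ev A c (itg A f))) \<and>
     (\<forall>c f. shf A c (der A f) = der A (shf A c f))"

definition itg_from :: "('k::linordered_field, 'f::comm_ring_1) ida \<Rightarrow> 'k \<Rightarrow> 'f \<Rightarrow> 'f" where
  "itg_from A c f = itg A f - const A (ev A c (itg A f))"

definition itg_between ::
    "('k::linordered_field, 'f::comm_ring_1) ida \<Rightarrow> 'k \<Rightarrow> 'k \<Rightarrow> 'f \<Rightarrow> 'k" where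
  "itg_between A c d f = ev A d (itg_from A c f)"


section \<open>Piecewise extension\<close>

definition Hbar :: "'k::linordered_field \<Rightarrow> 'k" where
  "Hbar a = 1 - (if a > 0 then 1 else 0)"

text \<open>The multiplicative monoid \<open>{1} \<union> {H\<^sub>a}\<close> with \<open>H\<^sub>a H\<^sub>b = H\<^bsub>max a b\<^esub>\<close>, written additively as
  required for monoid algebras over \<^typ>\<open>'a \<Rightarrow>\<^sub>0 'b\<close>.\<close>

datatype 'k heavi = HOne | Hv 'k

instantiation heavi :: (linorder) comm_monoid_add
begin

definition zero_heavi :: "'a heavi" where
  "zero_heavi = HOne"

fun plus_heavi :: "'a heavi \<Rightarrow> 'a heavi \<Rightarrow> 'a heavi" where
  "plus_heavi HOne h = h"
| "plus_heavi h HOne = h"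
| "plus_heavi (Hv a) (Hv b) = Hv (max a b)"

instance
proof
  fix a b c :: "'a heavi"
  show "a + b + c = a + (b + c)"
    by (cases a; cases b; cases c) (simp_all add: max.assoc)
  show "a + b = b + a"
    by (cases a; cases b) (simp_all add: max.commute)
  show "0 + a = a"
    by (simp add: zero_heavi_def)
qed

end

type_synonym ('k, 'f) pw = "'k heavi \<Rightarrow>\<^sub>0 'f"

definition pw_const :: "('k::linordered_field, 'f::comm_ring_1) ida \<Rightarrow> 'k \<Rightarrow> ('k, 'f) pw" where
  "pw_const A c = Poly_Mapping.single HOne (const A c)"

fun pw_itg_term ::
    "('k::linordered_field, 'f::comm_ring_1) ida \<Rightarrow> 'k heavi \<Rightarrow> 'f \<Rightarrow> ('k, 'f) pw" where
  "pw_itg_term A HOne f = Poly_Mapping.single HOne (itg A f)"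
| "pw_itg_term A (Hv a) f =
     Poly_Mapping.single (Hv a) (itg_from A a f) + pw_const A (Hbar a * itg_between A 0 a f)"

definition pw_itg ::
    "('k::linordered_field, 'f::comm_ring_1) ida \<Rightarrow> ('k, 'f) pw \<Rightarrow> ('k, 'f) pw" where
  "pw_itg A = pm_sum (pw_itg_term A)"

definition ev_heavi :: "'k::linordered_field \<Rightarrow> 'k heavi \<Rightarrow> 'k" where
  "ev_heavi c h = (case h of HOne \<Rightarrow> 1 | Hv a \<Rightarrow> Hbar (a - c))"

definition pw_ev :: "('k::linordered_field, 'f::comm_ring_1) ida \<Rightarrow> 'k \<Rightarrow> ('k, 'f) pw \<Rightarrow> 'k" where
  "pw_ev A c = pm_sum (\<lambda>h f. ev A c f * ev_heavi c h)"


section \<open>Distribution module\<close>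

text \<open>\<open>DH a k\<close> stands for the \<open>k\<close>-th derivative of \<open>H\<^sub>a\<close>, so \<open>\<delta>\<^sub>a\<close> is \<open>DH a 1\<close>.\<close>

datatype 'k dgen = DOne | DH 'k nat

type_synonym ('k, 'f) dist = "'k dgen \<Rightarrow>\<^sub>0 'f"

definition dist_scl :: "'f::comm_ring_1 \<Rightarrow> ('k, 'f) dist \<Rightarrow> ('k, 'f) dist" where
  "dist_scl f = Poly_Mapping.map ((*) f)"

fun dist_der_term ::
    "('k::linordered_field, 'f::comm_ring_1) ida \<Rightarrow> 'k dgen \<Rightarrow> 'f \<Rightarrow> ('k, 'f) dist" where
  "dist_der_term A DOne f = Poly_Mapping.single DOne (der A f)"
| "dist_der_term A (DH a k) f =
     Poly_Mapping.single (DH a k) (der A f) + Poly_Mapping.single (DH a (Suc k)) f"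

definition dist_der ::
    "('k::linordered_field, 'f::comm_ring_1) ida \<Rightarrow> ('k, 'f) dist \<Rightarrow> ('k, 'f) dist" where
  "dist_der A = pm_sum (dist_der_term A)"

definition dist_relations ::
    "('k::linordered_field, 'f::comm_ring_1) ida \<Rightarrow> ('k, 'f) dist set" where
  "dist_relations A =
     {(dist_der A ^^ j) (Poly_Mapping.single (DH a 1) f
        - Poly_Mapping.single (DH a 1) (const A (ev A a f))) | j a f. True}"

definition dist_eq ::
    "('k::linordered_field, 'f::comm_ring_1) ida \<Rightarrow> ('k, 'f) dist \<Rightarrow> ('k, 'f) dist \<Rightarrow> bool" where
  "dist_eq A p q \<longleftrightarrow> p - q \<in> module.span dist_scl (dist_relations A)"

fun dgen_of_heavi :: "'k heavi \<Rightarrow> 'k dgen" where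
  "dgen_of_heavi HOne = DOne"
| "dgen_of_heavi (Hv a) = DH a 0"

definition dist_of_pw :: "('k, 'f::comm_ring_1) pw \<Rightarrow> ('k, 'f) dist" where
  "dist_of_pw = pm_sum (\<lambda>h f. Poly_Mapping.single (dgen_of_heavi h) f)"

fun dist_ev_term :: "('k::linordered_field, 'f::comm_ring_1) ida \<Rightarrow> 'k \<Rightarrow> 'k dgen \<Rightarrow> 'f \<Rightarrow> 'k" where
  "dist_ev_term A c DOne f = ev A c f"
| "dist_ev_term A c (DH a 0) f = ev A c f * Hbar (a - c)"
| "dist_ev_term A c (DH a (Suc k)) f = 0"

definition dist_ev ::
    "('k::linordered_field, 'f::comm_ring_1) ida \<Rightarrow> 'k \<Rightarrow> ('k, 'f) dist \<Rightarrow> 'k" where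
  "dist_ev A c = pm_sum (dist_ev_term A c)"

definition dist_diffop ::
    "('k::linordered_field, 'f::comm_ring_1) ida \<Rightarrow> 'f poly \<Rightarrow> ('k, 'f) dist \<Rightarrow> ('k, 'f) dist" where
  "dist_diffop A T p = (\<Sum>i\<le>degree T. dist_scl (coeff T i) ((dist_der A ^^ i) p))"


section \<open>The operator ring\<close>

datatype ('k, 'f) opletter = LFun 'f | LDer | LInt | LEv 'k

datatype 'a word = Word "'a list"

instantiation word :: (type) monoid_add
begin

definition zero_word :: "'a word" where
  "zero_word = Word []"

fun plus_word :: "'a word \<Rightarrow> 'a word \<Rightarrow> 'a word" where
  "plus_word (Word xs) (Word ys) = Word (xs @ ys)"

instance
proof
  fix a b c :: "'a word"
  show "a + b + c = a + (b + c)"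
    by (cases a; cases b; cases c) simp
  show "0 + a = a" "a + 0 = a"
    by (cases a; simp add: zero_word_def)+
qed

end

text \<open>The free noncommutative algebra over \<open>K\<close>.\<close>

type_synonym ('k, 'f) oper = "('k, 'f) opletter word \<Rightarrow>\<^sub>0 'k"

definition op_letter :: "('k, 'f) opletter \<Rightarrow> ('k::comm_ring_1, 'f) oper" where
  "op_letter l = Poly_Mapping.single (Word [l]) 1"

abbreviation op_fun :: "'f \<Rightarrow> ('k::comm_ring_1, 'f) oper" where "op_fun f \<equiv> op_letter (LFun f)"
abbreviation op_der :: "('k::comm_ring_1, 'f) oper" where "op_der \<equiv> op_letter LDer"
abbreviation op_int :: "('k::comm_ring_1, 'f) oper" where "op_int \<equiv> op_letter LInt"
abbreviation op_ev :: "'k \<Rightarrow> ('k::comm_ring_1, 'f) oper" where "op_ev a \<equiv> op_letter (LEv a)"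

definition op_scalar :: "'k \<Rightarrow> ('k::comm_ring_1, 'f) oper" where
  "op_scalar c = Poly_Mapping.single 0 c"

text \<open>The first three families make \<open>op_fun\<close> a homomorphism of unital \<open>K\<close>-algebras.\<close>

definition op_relations ::
    "('k::linordered_field, 'f::comm_ring_1) ida \<Rightarrow> ('k, 'f) oper set" where
  "op_relations A =
     {op_fun (f + g) - (op_fun f + op_fun g) | f g. True} \<union>
     {op_fun (f * g) - op_fun f * op_fun g | f g. True} \<union>
     {op_fun (const A c) - op_scalar c | c. True} \<union>
     {op_der * op_fun f - (op_fun f * op_der + op_fun (der A f)) | f. True} \<union>
     {op_der * op_int - 1} \<union>
     {op_der * op_ev a | a. True} \<union>
     {op_ev a * op_fun f - op_scalar (ev A a f) * op_ev a | a f. True} \<union>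
     {op_ev b * op_ev a - op_ev a | a b. True} \<union>
     {op_ev 0 * op_int} \<union>
     {op_int * op_fun f * op_int - (op_fun (itg A f) * op_int - op_int * op_fun (itg A f)) | f. True} \<union>
     {op_int * op_fun f * op_der
        - (op_fun f - op_int * op_fun (der A f) - op_scalar (ev A 0 f) * op_ev 0) | f. True} \<union>
     {op_int * op_fun f * op_ev a - op_fun (itg A f) * op_ev a | f a. True}"

inductive_set op_ideal ::
    "('k::linordered_field, 'f::comm_ring_1) ida \<Rightarrow> ('k, 'f) oper set"
  for A :: "('k::linordered_field, 'f::comm_ring_1) ida" where
  rel: "p \<in> op_relations A \<Longrightarrow> p \<in> op_ideal A"
| zero: "0 \<in> op_ideal A"
| add: "p \<in> op_ideal A \<Longrightarrow> q \<in> op_ideal A \<Longrightarrow> p + q \<in> op_ideal A"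
| left: "p \<in> op_ideal A \<Longrightarrow> r * p \<in> op_ideal A"
| right: "p \<in> op_ideal A \<Longrightarrow> p * r \<in> op_ideal A"

definition op_eq ::
    "('k::linordered_field, 'f::comm_ring_1) ida \<Rightarrow> ('k, 'f) oper \<Rightarrow> ('k, 'f) oper \<Rightarrow> bool" where
  "op_eq A p q \<longleftrightarrow> p - q \<in> op_ideal A"

fun letter_act ::
    "('k::linordered_field, 'f::comm_ring_1) ida \<Rightarrow> ('k, 'f) opletter \<Rightarrow> 'f \<Rightarrow> 'f" where
  "letter_act A (LFun g) f = g * f"
| "letter_act A LDer f = der A f"
| "letter_act A LInt f = itg A f"
| "letter_act A (LEv a) f = const A (ev A a f)"

fun word_act ::
    "('k::linordered_field, 'f::comm_ring_1) ida \<Rightarrow> ('k, 'f) opletter word \<Rightarrow> 'f \<Rightarrow> 'f" where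
  "word_act A (Word ls) f = foldr (letter_act A) ls f"

definition op_act ::
    "('k::linordered_field, 'f::comm_ring_1) ida \<Rightarrow> ('k, 'f) oper \<Rightarrow> 'f \<Rightarrow> 'f" where
  "op_act A P f = pm_sum (\<lambda>w c. scl A c (word_act A w f)) P"

definition op_of_diffop :: "'f poly \<Rightarrow> ('k::comm_ring_1, 'f::comm_ring_1) oper" where
  "op_of_diffop T = (\<Sum>i\<le>degree T. op_fun (coeff T i) * op_der ^ i)"


section \<open>Stieltjes boundary problems\<close>

text \<open>The pair \<open>(l, g)\<close> stands for
  \<open>(\<Sum>(a, i). l(a, i) e\<^sub>a \<partial>\<^sup>i) + (\<Sum>a. e\<^sub>a \<integral> g(a))\<close>; a linear combination of global terms with the
  same evaluation is again of the form \<open>e\<^sub>a \<integral> v\<close>.\<close>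

type_synonym ('k, 'f) stieltjes = "(('k \<times> nat) \<Rightarrow>\<^sub>0 'k) \<times> ('k \<Rightarrow>\<^sub>0 'f)"

definition cond ::
    "('k::linordered_field, 'f::comm_ring_1) ida \<Rightarrow> ('k, 'f) stieltjes \<Rightarrow> 'f \<Rightarrow> 'k" where
  "cond A b f =
     pm_sum (\<lambda>(a, i) c. c * ev A a ((der A ^^ i) f)) (fst b) +
     pm_sum (\<lambda>a v. ev A a (itg A (v * f))) (snd b)"

definition cond_pw ::
    "('k::linordered_field, 'f::comm_ring_1) ida \<Rightarrow> ('k, 'f) stieltjes \<Rightarrow> ('k, 'f) pw \<Rightarrow> 'k" where
  "cond_pw A b u =
     pm_sum (\<lambda>(a, i) c. c * dist_ev A a ((dist_der A ^^ i) (dist_of_pw u))) (fst b) +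
     pm_sum (\<lambda>a v. pw_ev A a (pw_itg A (Poly_Mapping.single HOne v * u))) (snd b)"

text \<open>The boundary space is the span of the list \<open>bs\<close>.  The conditions are kept as formal sums
  because their action on piecewise functions is not determined by the functional on \<open>F\<close> if
  different \<open>a\<close> have the same \<open>e\<^sub>a\<close>.\<close>

definition stieltjes_problem ::
    "('k::linordered_field, 'f::comm_ring_1) ida \<Rightarrow> 'f poly \<Rightarrow> ('k, 'f) stieltjes list \<Rightarrow> bool" where
  "stieltjes_problem A T bs \<longleftrightarrow>
     lead_coeff T = 1 \<and> length bs = degree T \<and>
     (\<forall>c. (\<forall>f. (\<Sum>i<length bs. c i * cond A (bs ! i) f) = 0) \<longrightarrow> (\<forall>i<length bs. c i = 0))"

definition orth ::
    "('k::linordered_field, 'f::comm_ring_1) ida \<Rightarrow> ('k, 'f) stieltjes list \<Rightarrow> 'f set" where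
  "orth A bs = {f. \<forall>b\<in>set bs. cond A b f = 0}"

definition regular ::
    "('k::linordered_field, 'f::comm_ring_1) ida \<Rightarrow> 'f poly \<Rightarrow> ('k, 'f) stieltjes list \<Rightarrow> bool" where
  "regular A T bs \<longleftrightarrow>
     {f. diffop A T f = 0} \<inter> orth A bs = {0} \<and>
     (\<forall>f. \<exists>z w. diffop A T z = 0 \<and> w \<in> orth A bs \<and> f = z + w)"

definition well_posed :: "'f::comm_ring_1 poly \<Rightarrow> ('k::linordered_field, 'f) stieltjes list \<Rightarrow> bool" where
  "well_posed T bs \<longleftrightarrow> (\<forall>b\<in>set bs. \<forall>(a, k)\<in>Poly_Mapping.keys (fst b). k < degree T)"

text \<open>Since \<open>\<integral> = (1 - e\<^sub>0) \<integral>\<close>, a global part \<open>\<Sum>a. e\<^sub>a \<integral> v\<^sub>a\<close> equals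
  \<open>\<Sum>a. (e\<^sub>a - e\<^sub>0) \<integral> v\<^sub>a\<close> and so involves the evaluation at the initialization point as well,
  unless the coefficient \<open>\<Sum>a. v\<^sub>a\<close> of \<open>e\<^sub>0\<close> vanishes.\<close>

definition eval_points :: "('k::linordered_field, 'f::comm_ring_1) stieltjes list \<Rightarrow> 'k set" where
  "eval_points bs = (\<Union>b\<in>set bs.
     fst ` Poly_Mapping.keys (fst b) \<union> Poly_Mapping.keys (snd b) \<union>
     (if pm_sum (\<lambda>a v. v) (snd b) = 0 then {} else {0}))"

definition solves ::
    "('k::linordered_field, 'f::comm_ring_1) ida \<Rightarrow> 'f poly \<Rightarrow> ('k, 'f) stieltjes list \<Rightarrow>
      ('k, 'f) pw \<Rightarrow> ('k, 'f) pw \<Rightarrow> bool" where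
  "solves A T bs f u \<longleftrightarrow>
     dist_eq A (dist_diffop A T (dist_of_pw u)) (dist_of_pw f) \<and> (\<forall>b\<in>set bs. cond_pw A b u = 0)"


section \<open>Green's operators\<close>

definition greens_equations ::
    "('k::linordered_field, 'f::comm_ring_1) ida \<Rightarrow> 'f poly \<Rightarrow> ('k, 'f) stieltjes list \<Rightarrow>
      ('k, 'f) oper \<Rightarrow> bool" where
  "greens_equations A T bs G \<longleftrightarrow>
     op_eq A (op_of_diffop T * G) 1 \<and> range (op_act A G) = orth A bs"

text \<open>The Green's operator is the element of the operator ring characterized by these
  equations.  Neither existence nor uniqueness is automatic: for \<open>F = \<real>[x, exp(-x)]\<close> and
  \<open>T = \<partial> + 1\<close> with \<open>u(0) = 0\<close> the solution operator \<open>exp(-x) \<integral> exp(x)\<close> is not in the ring, and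
  the ring need not act faithfully on \<open>F\<close>, for instance if \<open>e\<^sub>a = e\<^sub>0\<close> on \<open>F\<close> for some \<open>a \<noteq> 0\<close>.\<close>

definition greens_operator ::
    "('k::linordered_field, 'f::comm_ring_1) ida \<Rightarrow> 'f poly \<Rightarrow> ('k, 'f) stieltjes list \<Rightarrow>
      ('k, 'f) oper \<Rightarrow> bool" where
  "greens_operator A T bs G \<longleftrightarrow>
     greens_equations A T bs G \<and> (\<forall>G'. greens_equations A T bs G' \<longrightarrow> op_eq A G' G)"

text \<open>A list of triples stands for a sum of operators: \<open>(u, None, v)\<close> for \<open>u \<integral> v\<close> and
  \<open>(u, Some a, v)\<close> for \<open>u e\<^sub>a \<integral> v\<close>.  Scalar factors are absorbed in \<open>u\<close>.\<close>

type_synonym ('k, 'f) integral_op = "('f \<times> 'k option \<times> 'f) list"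

definition op_of_integral_op ::
    "('k, 'f) integral_op \<Rightarrow> ('k::comm_ring_1, 'f::comm_ring_1) oper" where
  "op_of_integral_op gs = (\<Sum>(u, s, v)\<leftarrow>gs.
     op_fun u * (case s of None \<Rightarrow> 1 | Some a \<Rightarrow> op_ev a) * op_int * op_fun v)"

definition integral_op_pw ::
    "('k::linordered_field, 'f::comm_ring_1) ida \<Rightarrow> ('k, 'f) integral_op \<Rightarrow>
      ('k, 'f) pw \<Rightarrow> ('k, 'f) pw" where
  "integral_op_pw A gs f = (\<Sum>(u, s, v)\<leftarrow>gs.
     Poly_Mapping.single HOne u *
     (let w = pw_itg A (Poly_Mapping.single HOne v * f)
      in case s of None \<Rightarrow> w | Some a \<Rightarrow> pw_const A (pw_ev A a w)))"


section \<open>Bivariate piecewise functions\<close>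

text \<open>\<open>Mono f g h k b\<close> is the monomial \<open>f(x) g(\<xi>) h(x) k(\<xi>)\<close> with \<open>h\<close>, \<open>k\<close> being \<open>1\<close> or some
  \<open>H\<^sub>a\<close>, multiplied by \<open>H(x - \<xi>)\<close> if \<open>b\<close> holds.  Multiplication of monomials is again
  written additively.\<close>

datatype ('k, 'f) mono2 = Mono 'f 'f "'k heavi" "'k heavi" bool

instantiation mono2 :: (linorder, comm_ring_1) comm_monoid_add
begin

definition zero_mono2 :: "('a, 'b) mono2" where
  "zero_mono2 = Mono 1 1 0 0 False"

fun plus_mono2 :: "('a, 'b) mono2 \<Rightarrow> ('a, 'b) mono2 \<Rightarrow> ('a, 'b) mono2" where
  "plus_mono2 (Mono f g h k b) (Mono f' g' h' k' b') =
     Mono (f * f') (g * g') (h + h') (k + k') (b \<or> b')"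

instance
proof
  fix a b c :: "('a, 'b) mono2"
  show "a + b + c = a + (b + c)"
    by (cases a; cases b; cases c) (simp add: algebra_simps)
  show "a + b = b + a"
    by (cases a; cases b) (auto simp: algebra_simps)
  show "0 + a = a"
    by (cases a) (simp add: zero_mono2_def)
qed

end

type_synonym ('k, 'f) pw2 = "('k, 'f) mono2 \<Rightarrow>\<^sub>0 'k"

definition fun_x :: "'f::comm_ring_1 \<Rightarrow> ('k::linordered_field, 'f) pw2" where
  "fun_x f = Poly_Mapping.single (Mono f 1 0 0 False) 1"

definition fun_xi :: "'f::comm_ring_1 \<Rightarrow> ('k::linordered_field, 'f) pw2" where
  "fun_xi g = Poly_Mapping.single (Mono 1 g 0 0 False) 1"

definition heavi_x :: "'k heavi \<Rightarrow> ('k::linordered_field, 'f::comm_ring_1) pw2" where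
  "heavi_x h = Poly_Mapping.single (Mono 1 1 h 0 False) 1"

definition heavi_xi :: "'k heavi \<Rightarrow> ('k::linordered_field, 'f::comm_ring_1) pw2" where
  "heavi_xi k = Poly_Mapping.single (Mono 1 1 0 k False) 1"

abbreviation Hx :: "'k \<Rightarrow> ('k::linordered_field, 'f::comm_ring_1) pw2" where
  "Hx a \<equiv> heavi_x (Hv a)"

abbreviation Hxi :: "'k \<Rightarrow> ('k::linordered_field, 'f::comm_ring_1) pw2" where
  "Hxi a \<equiv> heavi_xi (Hv a)"

definition Hhat :: "('k::linordered_field, 'f::comm_ring_1) pw2" where
  "Hhat = Poly_Mapping.single (Mono 1 1 0 0 True) 1"

definition pw2_const :: "'k \<Rightarrow> ('k::linordered_field, 'f::comm_ring_1) pw2" where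
  "pw2_const c = Poly_Mapping.single 0 c"

text \<open>The linearity relations turn the algebra of the monomials \<open>f(x) g(\<xi>)\<close> into the tensor
  product of \<open>F\<close> with itself over \<open>K\<close>; the other defining relations of the tensor product and
  of the Heaviside functions already hold for monomials.\<close>

definition pw2_relations ::
    "('k::linordered_field, 'f::comm_ring_1) ida \<Rightarrow> ('k, 'f) pw2 set" where
  "pw2_relations A =
     {fun_x (f + g) - (fun_x f + fun_x g) | f g. True} \<union>
     {fun_x (scl A c f) - pw2_const c * fun_x f | c f. True} \<union>
     {fun_xi (f + g) - (fun_xi f + fun_xi g) | f g. True} \<union>
     {fun_xi (scl A c f) - pw2_const c * fun_xi f | c f. True} \<union>
     {Hx a * Hhat - (Hxi a * Hhat + Hx a * (1 - Hxi a)) | a. True}"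

definition pw2_eq ::
    "('k::linordered_field, 'f::comm_ring_1) ida \<Rightarrow> ('k, 'f) pw2 \<Rightarrow> ('k, 'f) pw2 \<Rightarrow> bool" where
  "pw2_eq A p q \<longleftrightarrow> p - q \<in> module.span (*) (pw2_relations A)"

definition pw_x :: "('k::linordered_field, 'f::comm_ring_1) pw \<Rightarrow> ('k, 'f) pw2" where
  "pw_x = pm_sum (\<lambda>h f. fun_x f * heavi_x h)"

definition pw_xi :: "('k::linordered_field, 'f::comm_ring_1) pw \<Rightarrow> ('k, 'f) pw2" where
  "pw_xi = pm_sum (\<lambda>h f. fun_xi f * heavi_xi h)"

definition pwx_algebra :: "('k::linordered_field, 'f::comm_ring_1) pw2 set" where
  "pwx_algebra = {p. \<forall>m\<in>Poly_Mapping.keys p. \<exists>f g h. m = Mono f g h 0 False}"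

fun xi_itg_basis ::
    "('k::linordered_field, 'f::comm_ring_1) ida \<Rightarrow> 'f \<Rightarrow> 'k heavi \<Rightarrow> ('k, 'f) pw2" where
  "xi_itg_basis A g HOne = fun_xi (itg A g)"
| "xi_itg_basis A g (Hv a) =
     fun_xi (itg_from A a g) * Hxi a + pw2_const (Hbar a * itg_between A 0 a g)"

definition xi_itg_hat ::
    "('k::linordered_field, 'f::comm_ring_1) ida \<Rightarrow> 'f \<Rightarrow> ('k, 'f) pw2" where
  "xi_itg_hat A g =
     (fun_xi (itg A g) - fun_x (itg A g)) * Hhat + fun_x (itg A g) * Hx 0"

text \<open>The last equation rewrites \<open>H\<^sub>a(\<xi>) H(x - \<xi>)\<close>, which is not in the basis, as
  \<open>H\<^sub>a(x) H(x - \<xi>) - H\<^sub>a(x) + H\<^sub>a(x) H\<^sub>a(\<xi>)\<close>.\<close>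

fun xi_itg_mono ::
    "('k::linordered_field, 'f::comm_ring_1) ida \<Rightarrow> ('k, 'f) mono2 \<Rightarrow> ('k, 'f) pw2" where
  "xi_itg_mono A (Mono f g h k False) = fun_x f * heavi_x h * xi_itg_basis A g k"
| "xi_itg_mono A (Mono f g h HOne True) = fun_x f * heavi_x h * xi_itg_hat A g"
| "xi_itg_mono A (Mono f g h (Hv a) True) =
     fun_x f * heavi_x h * Hx a *
       (xi_itg_hat A g - xi_itg_basis A g HOne + xi_itg_basis A g (Hv a))"

definition xi_itg ::
    "('k::linordered_field, 'f::comm_ring_1) ida \<Rightarrow> ('k, 'f) pw2 \<Rightarrow> ('k, 'f) pw2" where
  "xi_itg A = pm_sum (\<lambda>m c. pw2_const c * xi_itg_mono A m)"

fun xi_ev_mono ::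
    "('k::linordered_field, 'f::comm_ring_1) ida \<Rightarrow> 'k \<Rightarrow> ('k, 'f) mono2 \<Rightarrow> ('k, 'f) pw2" where
  "xi_ev_mono A c (Mono f g h k b) =
     fun_x f * pw2_const (ev A c g) * heavi_x h * pw2_const (ev_heavi c k) * (if b then Hx c else 1)"

definition xi_ev ::
    "('k::linordered_field, 'f::comm_ring_1) ida \<Rightarrow> 'k \<Rightarrow> ('k, 'f) pw2 \<Rightarrow> ('k, 'f) pw2" where
  "xi_ev A c = pm_sum (\<lambda>m r. pw2_const r * xi_ev_mono A c m)"

definition xi_itg_between ::
    "('k::linordered_field, 'f::comm_ring_1) ida \<Rightarrow> 'k \<Rightarrow> 'k \<Rightarrow> ('k, 'f) pw2 \<Rightarrow> ('k, 'f) pw2" where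
  "xi_itg_between A \<alpha> \<beta> p = xi_ev A \<beta> (xi_itg A p) - xi_ev A \<alpha> (xi_itg A p)"

definition greens_function ::
    "('k, 'f) integral_op \<Rightarrow> ('k::linordered_field, 'f::comm_ring_1) pw2" where
  "greens_function gs = (\<Sum>(u, s, v)\<leftarrow>gs.
     fun_x u * fun_xi v *
     (case s of None \<Rightarrow> Hhat + Hxi 0 - 1 | Some a \<Rightarrow> Hxi 0 - Hxi a))"

definition equal_on ::
    "('k::linordered_field, 'f::comm_ring_1) ida \<Rightarrow> 'k \<Rightarrow> 'k \<Rightarrow>
      ('k, 'f) pw2 \<Rightarrow> ('k, 'f) pw2 \<Rightarrow> bool" where
  "equal_on A \<alpha> \<beta> p q \<longleftrightarrow>
     (\<exists>r\<in>pwx_algebra. \<exists>s\<in>pwx_algebra. pw2_eq A (p - q) (r * (1 - Hx \<alpha>) + s * Hx \<beta>))"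

end

theory Submission
  imports Defs "HOL-Library.Function_Algebras" "HOL-Library.Product_Plus"
begin

text \<open>
  Let \<open>n\<close> be the order of \<open>T\<close>.  For \<open>n = 0\<close> the problem reads \<open>u = f\<close>, and no sum of
  operators \<open>u \<integral> v\<close> and \<open>u e\<^sub>a \<integral> v\<close> represents \<open>G = 1\<close>.  Let \<open>n > 0\<close>.

  A piecewise function \<open>u = u\<^sub>1 + \<Sum>a. u\<^sub>a H\<^sub>a\<close> satisfies \<open>Tu = f\<close> among distributions if and only if
  \<open>T\<close> maps every coefficient of \<open>u\<close> to the same coefficient of \<open>f\<close> and \<open>u\<^sub>a\<close> vanishes at \<open>a\<close>
  together with its derivatives of order below \<open>n\<close>; otherwise \<open>T(u\<^sub>a H\<^sub>a)\<close> contains derivatives of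
  \<open>\<delta>\<^sub>a\<close>, which are detected by test functions (\<open>diffop_dist_eq_iff\<close>).  So the problem consists of
  an initial value problem at every jump and of the given boundary problem for \<open>u\<^sub>1\<close>.

  Initial value problems for \<open>T\<close> are uniquely solvable because \<open>T\<close> has a right inverse \<open>G\<close> in the
  operator ring and a kernel of dimension \<open>n\<close>.  The ring acts on functions of \<open>x\<close> that jump at
  a generic point \<open>\<xi>\<close>, that is, on \<open>F \<otimes> F\<close>, \<open>(F \<otimes> F) H\<^sub>\<xi>\<close> and the derivatives of \<open>\<delta>\<^sub>\<xi>\<close>
  (\<open>gen_module\<close>).  Let \<open>\<Phi>\<close> be the coefficient of \<open>H\<^sub>\<xi>\<close> in \<open>G \<delta>\<^sub>\<xi>\<close>.  From \<open>T G \<delta>\<^sub>\<xi> = \<delta>\<^sub>\<xi>\<close> one gets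
  \<open>T\<^sub>x \<Phi> = 0\<close> and the values of \<open>\<partial>\<^sub>x\<^sup>k \<Phi>\<close> on the diagonal, namely \<open>1\<close> for \<open>k = n - 1\<close> and \<open>0\<close> for \<open>k < n - 1\<close>
  (\<open>jets_of_impulse_response\<close>).  The kernel of \<open>T\<close> has a basis \<open>z\<^sub>0, \<dots>, z\<^bsub>n-1\<^esub>\<close> dual to the
  boundary conditions, so \<open>\<Phi> = \<Sum>j. z\<^sub>j \<otimes> v\<^sub>j\<close> (\<open>ex_impulse_response\<close>).  Variation of constants with
  these \<open>v\<^sub>j\<close> solves all initial value problems, and counting dimensions gives uniqueness
  (\<open>zero_of_initial_values\<close>).

  Applying \<open>\<Sum>j. z\<^sub>j \<integral> v\<^sub>j\<close> to \<open>f\<close> and correcting the boundary values by multiples of the \<open>z\<^sub>i\<close>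
  gives the solution.  As the local conditions have order below \<open>n\<close>, the Baxter rule turns
  \<open>\<beta>\<^sub>i(\<Sum>j. z\<^sub>j \<integral> v\<^sub>j f)\<close> into a sum of terms \<open>e\<^sub>a \<integral> q f\<close>.  The whole procedure is therefore an
  integral operator (\<open>greens_list\<close>), which satisfies the equations of the Green's operator both
  in the operator ring and on piecewise functions.

  Another sum of operators \<open>u \<integral> v\<close> and \<open>u e\<^sub>a \<integral> v\<close> that represents \<open>G\<close> may have different terms.
  The generic module shows that the tensor \<open>\<Sum> u \<otimes> v\<close> over the terms of each kind is determined by
  \<open>G\<close>, and so is every expression that depends only on these tensors (\<open>balanced_sums_cong\<close>).

  On \<open>[\<alpha>, \<beta>]\<close> the integral \<open>I\<^sub>\<alpha>\<^sup>\<beta> g f\<close> equals \<open>G f\<close> plus an element \<open>\<Sum> d(v) u\<close> of \<open>F\<close>, where the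
  functional \<open>d\<close> is the same for \<open>\<integral>\<close> and for all \<open>e\<^sub>a \<integral>\<close> with \<open>a\<close> in \<open>[\<alpha>, \<beta>]\<close>
  (\<open>vanishing_greens_function\<close>).  If \<open>0\<close> lies in \<open>[\<alpha>, \<beta>]\<close>, then \<open>d = 0\<close>.  If not, the coefficients of
  the global terms of each condition add up to \<open>0\<close>, and \<open>\<Sum> u \<otimes> v = 0\<close> over all terms because the \<open>z\<^sub>j\<close>
  are dual to the conditions (\<open>total_defect_greens_list\<close>).
\<close>


section \<open>Finitely supported sums\<close>

abbreviation lookup :: "('a \<Rightarrow>\<^sub>0 'b::zero) \<Rightarrow> 'a \<Rightarrow> 'b" where "lookup \<equiv> Poly_Mapping.lookup"
abbreviation single :: "'a \<Rightarrow> 'b \<Rightarrow> ('a \<Rightarrow>\<^sub>0 'b::zero)" where "single \<equiv> Poly_Mapping.single"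
abbreviation keys :: "('a \<Rightarrow>\<^sub>0 'b::zero) \<Rightarrow> 'a set" where "keys \<equiv> Poly_Mapping.keys"

lemma pm_sum_superset:
  assumes "finite S" "keys p \<subseteq> S" "\<And>k. \<phi> k 0 = 0"
  shows "pm_sum \<phi> p = (\<Sum>k\<in>S. \<phi> k (lookup p k))"
  unfolding pm_sum_def using assms
  by (intro sum.mono_neutral_left) (auto simp: in_keys_iff)

lemma pm_sum_additive:
  fixes \<phi> :: "'a \<Rightarrow> 'b::ab_group_add \<Rightarrow> 'c::ab_group_add"
  assumes "\<And>k. additive (\<phi> k)"
  shows "additive (pm_sum \<phi>)"
proof
  fix p q :: "'a \<Rightarrow>\<^sub>0 'b"
  let ?S = "keys p \<union> keys q"
  have z: "\<phi> k 0 = 0" for k by (rule additive.zero[OF assms])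
  have *: "pm_sum \<phi> r = (\<Sum>k\<in>?S. \<phi> k (lookup r k))" if "r \<in> {p, q, p + q}" for r
    by (rule pm_sum_superset) (use that z Poly_Mapping.keys_add[of p q] in auto)
  show "pm_sum \<phi> (p + q) = pm_sum \<phi> p + pm_sum \<phi> q"
    by (simp add: * lookup_add additive.add[OF assms] sum.distrib)
qed

lemma pm_sum_single:
  assumes "\<phi> k 0 = 0"
  shows "pm_sum \<phi> (single k v) = \<phi> k v"
  using assms by (cases "v = 0") (auto simp: pm_sum_def)

lemma pm_induct [case_names zero add]:
  assumes "P 0" "\<And>k v p. P p \<Longrightarrow> P (single k v + p)"
  shows "P p"
proof (induction p rule: update_induct)
  case const
  show ?case by (rule assms(1))
next
  case (update f a b)
  have "Poly_Mapping.update a b f = single a b + f"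
    using update(1) by (intro poly_mapping_eqI)
      (auto simp: lookup_update lookup_add lookup_single in_keys_iff when_def)
  then show ?case using assms(2) update by simp
qed

lemma pm_additive_eqI:
  fixes f g :: "('a \<Rightarrow>\<^sub>0 'b::ab_group_add) \<Rightarrow> 'c::ab_group_add"
  assumes f: "additive f" and g: "additive g"
    and "\<And>k v. f (single k v) = g (single k v)"
  shows "f p = g p"
  by (induction p rule: pm_induct)
    (simp_all add: assms additive.zero[OF f] additive.zero[OF g] additive.add[OF f] additive.add[OF g])

lemma additive_compose: "additive f \<Longrightarrow> additive g \<Longrightarrow> additive (\<lambda>x. f (g x))"
  by (simp add: additive_def)

lemma additive_single: "additive (single k :: 'a::ab_group_add \<Rightarrow> _)"
  by (simp add: additive_def single_add)

section \<open>Calculus in an integro-differential algebra\<close>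

locale shifted_ida =
  fixes A :: "('k::linordered_field, 'f::comm_ring_1) ida"
  assumes ida: "integro_differential_algebra A"
    and ord: "ordinary A"
    and shift: "shifted A"
begin

abbreviation D where "D \<equiv> der A"
abbreviation J where "J \<equiv> itg A"
abbreviation \<kappa> where "\<kappa> \<equiv> const A"
abbreviation e where "e \<equiv> ev A"

lemma vs: "vector_space (scl A)"
  using ida unfolding integro_differential_algebra_def by blast

sublocale V: vector_space "scl A"
  by (rule vs)

lemma scl_eq: "scl A c f = \<kappa> c * f"
proof -
  have "scl A c (1 * f) = scl A c 1 * f"
    using ida unfolding integro_differential_algebra_def by blast
  then show ?thesis by (simp add: const_def)
qed

lemma const_add: "\<kappa> (a + b) = \<kappa> a + \<kappa> b"
  by (simp add: const_def V.scale_left_distrib)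

lemma const_mult: "\<kappa> (a * b) = \<kappa> a * \<kappa> b"
proof -
  have "\<kappa> (a * b) = scl A a (scl A b 1)" by (simp add: const_def)
  then show ?thesis by (simp add: scl_eq)
qed

lemma const_1 [simp]: "\<kappa> 1 = 1"
  by (simp add: const_def)

lemma const_additive: "additive \<kappa>"
  by (simp add: additive_def const_add)

lemma const_0 [simp]: "\<kappa> 0 = 0"
  by (simp add: const_def)

lemma const_minus: "\<kappa> (- a) = - \<kappa> a"
  by (simp add: additive.minus[OF const_additive])

lemma const_diff: "\<kappa> (a - b) = \<kappa> a - \<kappa> b"
  by (simp add: additive.diff[OF const_additive])

lemma const_sum: "\<kappa> (\<Sum>i\<in>I. f i) = (\<Sum>i\<in>I. \<kappa> (f i))"
  by (rule additive.sum[OF const_additive])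

lemma const_inj: "\<kappa> a = \<kappa> b \<longleftrightarrow> a = b"
  by (simp add: const_def V.scale_cancel_right)

lemma const_inverse: "c \<noteq> 0 \<Longrightarrow> \<kappa> (inverse c) * \<kappa> c = 1"
  by (simp flip: const_mult)

lemma klin_iff:
  "klin A f \<longleftrightarrow> additive f \<and> (\<forall>c x. f (\<kappa> c * x) = \<kappa> c * f x)"
  by (auto simp: Vector_Spaces.linear_def vs module_hom_def module_hom_axioms_def additive_def scl_eq
      V.module_axioms)

lemma D_additive: "additive D" and J_additive: "additive J"
  using ida unfolding integro_differential_algebra_def klin_iff by blast+

lemma D_cmult: "D (\<kappa> c * f) = \<kappa> c * D f" and J_cmult: "J (\<kappa> c * f) = \<kappa> c * J f"
  using ida unfolding integro_differential_algebra_def klin_iff by blast+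

lemmas D_simps = additive.add[OF D_additive] additive.zero[OF D_additive]
  additive.minus[OF D_additive] additive.diff[OF D_additive] additive.sum[OF D_additive]
lemmas J_simps = additive.add[OF J_additive] additive.zero[OF J_additive]
  additive.minus[OF J_additive] additive.diff[OF J_additive] additive.sum[OF J_additive]

lemma leibniz: "D (f * g) = D f * g + f * D g"
  using ida unfolding integro_differential_algebra_def by blast

lemma DJ [simp]: "D (J f) = f"
  using ida unfolding integro_differential_algebra_def by blast

lemma baxter: "f * J g = J (f * g) + J (D f * J g)"
  using ida unfolding integro_differential_algebra_def by blast

lemma D_const [simp]: "D (\<kappa> c) = 0"
  using ord by (auto simp: ordinary_def)

lemma D_1 [simp]: "D 1 = 0"
  using D_const[of 1] by simp

lemma D_eq_0: "D f = 0 \<Longrightarrow> \<exists>c. f = \<kappa> c"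
  using ord by (auto simp: ordinary_def)

lemma const_ev0: "\<kappa> (ev0 A f) = f - J (D f)"
proof -
  obtain c where c: "f - J (D f) = \<kappa> c"
    using D_eq_0[of "f - J (D f)"] by (auto simp: D_simps)
  show ?thesis unfolding ev0_def c by (rule theI[of _ c]) (auto simp: const_inj)
qed

lemma ev0_J: "ev0 A (J f) = 0"
  using const_ev0[of "J f"] const_inj[of _ 0] by simp

lemma ev0_const: "ev0 A (\<kappa> c) = c"
  using const_ev0[of "\<kappa> c"] by (simp add: const_inj J_simps)

lemma ev0_add: "ev0 A (f + g) = ev0 A f + ev0 A g"
  by (subst const_inj[symmetric]) (simp add: const_ev0 const_add D_simps J_simps)

lemma ev0_cmult: "ev0 A (\<kappa> c * f) = c * ev0 A f"
  by (subst const_inj[symmetric]) (simp add: const_ev0 const_mult D_cmult J_cmult right_diff_distrib)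

text \<open>With \<open>f = f(0) + \<integral>f'\<close> multiplicativity amounts to \<open>(\<integral>a \<cdot> \<integral>b)(0) = 0\<close>, and the Baxter axiom writes
  this product as an integral.\<close>

lemma ev0_mult: "ev0 A (f * g) = ev0 A f * ev0 A g"
proof -
  have JJ: "ev0 A (J a * J b) = 0" for a b
    by (simp add: baxter[of "J a" b] ev0_add ev0_J)
  have f: "f = \<kappa> (ev0 A f) + J (D f)" and g: "g = \<kappa> (ev0 A g) + J (D g)"
    by (simp_all add: const_ev0)
  have "f * g = \<kappa> (ev0 A f) * \<kappa> (ev0 A g) + \<kappa> (ev0 A f) * J (D g) + \<kappa> (ev0 A g) * J (D f)
      + J (D f) * J (D g)"
    by (subst f, subst g) (simp add: algebra_simps)
  then show ?thesis
    by (simp add: ev0_add ev0_cmult ev0_J JJ ev0_const)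
qed

lemma shf_lin: "klin A (shf A c)" and shf_1: "shf A c 1 = 1" and shf_bij: "bij (shf A c)"
  and shf_mult: "shf A c (f * g) = shf A c f * shf A c g"
  using shift unfolding shifted_def by blast+

lemma shf_0: "shf A 0 f = f"
proof -
  have "shf A (0 + 0) = shf A 0 \<circ> shf A 0"
    using shift unfolding shifted_def by blast
  then have "shf A 0 (shf A 0 f) = shf A 0 f" by (metis add_0 comp_apply)
  then show ?thesis using shf_bij[of 0] by (meson bij_def injD)
qed

lemma e_additive: "additive (e c)"
  using shf_lin[of c] by (simp add: additive_def ev_def klin_iff ev0_add)

lemma e_mult: "e c (f * g) = e c f * e c g"
  by (simp add: ev_def shf_mult ev0_mult)

lemma e_const [simp]: "e c (\<kappa> a) = a"
proof -
  have "shf A c (\<kappa> a * 1) = \<kappa> a * shf A c 1"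
    using shf_lin[of c] by (simp only: klin_iff)
  then show ?thesis by (simp add: ev_def shf_1 ev0_const)
qed

lemma e_1 [simp]: "e c 1 = 1"
  using e_const[of c 1] by (simp del: e_const)

lemma e_cmult: "e c (\<kappa> a * f) = a * e c f"
  by (simp add: e_mult)

lemma e_0_J [simp]: "e 0 (J f) = 0"
  by (simp add: ev_def shf_0 ev0_J)

lemma const_e_0: "\<kappa> (e 0 f) = f - J (D f)"
  by (simp add: ev_def shf_0 const_ev0)

lemmas e_simps = additive.add[OF e_additive] additive.zero[OF e_additive]
  additive.minus[OF e_additive] additive.diff[OF e_additive] additive.sum[OF e_additive]

lemma D_pow_additive: "additive (D ^^ k)"
  by (induction k) (simp_all add: additive_def D_simps)

lemmas D_pow_simps = additive.add[OF D_pow_additive] additive.zero[OF D_pow_additive]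
  additive.minus[OF D_pow_additive] additive.diff[OF D_pow_additive] additive.sum[OF D_pow_additive]

lemma D_pow_cmult: "(D ^^ k) (\<kappa> c * f) = \<kappa> c * (D ^^ k) f"
  by (induction k) (simp_all add: D_cmult)

lemma diffop_additive: "additive (diffop A T)"
  by (simp add: additive_def diffop_def D_pow_simps algebra_simps sum.distrib)

lemmas diffop_simps = additive.add[OF diffop_additive] additive.zero[OF diffop_additive]
  additive.minus[OF diffop_additive] additive.diff[OF diffop_additive]
  additive.sum[OF diffop_additive]

lemma diffop_cmult: "diffop A T (\<kappa> c * f) = \<kappa> c * diffop A T f"
  by (simp add: diffop_def D_pow_cmult sum_distrib_left mult.left_commute)

text \<open>By \<open>f = \<integral>f' + f(0)\<close>.\<close>

lemma antiderivative_unique: "D f = D g \<Longrightarrow> e 0 f = e 0 g \<Longrightarrow> f = g"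
  by (metis const_e_0 diff_add_cancel)

lemma e_itg_from: "e a (itg_from A a f) = 0"
  by (simp add: itg_from_def e_simps)

lemma D_itg_from [simp]: "D (itg_from A a f) = f"
  by (simp add: itg_from_def D_simps)

lemma itg_from_additive: "additive (itg_from A a)"
  by (simp add: additive_def itg_from_def J_simps e_simps const_add)

lemma itg_between_0: "itg_between A 0 a f = e a (J f)"
  by (simp add: itg_between_def itg_from_def e_simps)

end

section \<open>Modules over the operator ring\<close>

text \<open>The relations that rewrite a product beginning with \<open>\<integral>\<close> are consequences of these axioms: both
  sides have the same derivative and the same value at the initialization point, and by
  \<open>determined\<close> these two data fix an element of \<open>M\<close>.\<close>

locale op_module = shifted_ida A
  for A :: "('k::linordered_field, 'f::comm_ring_1) ida" +
  fixes M :: "'m::ab_group_add set" and act :: "'f \<Rightarrow> 'm \<Rightarrow> 'm" and dm jm :: "'m \<Rightarrow> 'm"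
    and em :: "'k \<Rightarrow> 'm \<Rightarrow> 'm"
  assumes M_0: "0 \<in> M" and M_add: "m \<in> M \<Longrightarrow> m' \<in> M \<Longrightarrow> m + m' \<in> M"
    and M_act: "m \<in> M \<Longrightarrow> act f m \<in> M" and M_dm: "m \<in> M \<Longrightarrow> dm m \<in> M"
    and M_jm: "m \<in> M \<Longrightarrow> jm m \<in> M" and M_em: "m \<in> M \<Longrightarrow> em a m \<in> M"
    and act_plus: "m \<in> M \<Longrightarrow> m' \<in> M \<Longrightarrow> act f (m + m') = act f m + act f m'"
    and dm_plus: "m \<in> M \<Longrightarrow> m' \<in> M \<Longrightarrow> dm (m + m') = dm m + dm m'"
    and jm_plus: "m \<in> M \<Longrightarrow> m' \<in> M \<Longrightarrow> jm (m + m') = jm m + jm m'"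
    and em_plus: "m \<in> M \<Longrightarrow> m' \<in> M \<Longrightarrow> em a (m + m') = em a m + em a m'"
    and act_1: "m \<in> M \<Longrightarrow> act 1 m = m"
    and act_add: "m \<in> M \<Longrightarrow> act (f + g) m = act f m + act g m"
    and act_mult: "m \<in> M \<Longrightarrow> act (f * g) m = act f (act g m)"
    and dm_act: "m \<in> M \<Longrightarrow> dm (act f m) = act f (dm m) + act (D f) m"
    and dm_jm: "m \<in> M \<Longrightarrow> dm (jm m) = m"
    and dm_em: "m \<in> M \<Longrightarrow> dm (em a m) = 0"
    and em_act: "m \<in> M \<Longrightarrow> em a (act f m) = act (\<kappa> (e a f)) (em a m)"
    and em_em: "m \<in> M \<Longrightarrow> em b (em a m) = em a m"
    and em_0_jm: "m \<in> M \<Longrightarrow> em 0 (jm m) = 0"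
    and determined: "m \<in> M \<Longrightarrow> dm m = 0 \<Longrightarrow> em 0 m = 0 \<Longrightarrow> m = 0"
begin

lemma act_0_left: "m \<in> M \<Longrightarrow> act 0 m = 0"
  using act_add[of m 0 0] by simp

lemma zeros [simp]: "act f 0 = 0" "dm 0 = 0" "jm 0 = 0" "em a 0 = 0"
  using act_plus[OF M_0 M_0] dm_plus[OF M_0 M_0] jm_plus[OF M_0 M_0] em_plus[OF M_0 M_0] by simp_all

lemma act_uminus: "m \<in> M \<Longrightarrow> act (- 1) m = - m"
  using act_add[of m 1 "-1"] by (simp add: act_0_left act_1 eq_neg_iff_add_eq_0 add.commute)

lemma M_uminus: "m \<in> M \<Longrightarrow> - m \<in> M"
  using M_act[of m "-1"] by (simp add: act_uminus)

lemma M_diff: "m \<in> M \<Longrightarrow> m' \<in> M \<Longrightarrow> m - m' \<in> M"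
  using M_add[of m "- m'"] by (simp add: M_uminus)

lemma diff_simps:
  assumes "m \<in> M" "m' \<in> M"
  shows "act f (m - m') = act f m - act f m'" "dm (m - m') = dm m - dm m'"
    "jm (m - m') = jm m - jm m'" "em a (m - m') = em a m - em a m'"
  using act_plus[OF M_diff[OF assms] assms(2)] dm_plus[OF M_diff[OF assms] assms(2)]
    jm_plus[OF M_diff[OF assms] assms(2)] em_plus[OF M_diff[OF assms] assms(2)]
  by simp_all

lemma eqI: "m \<in> M \<Longrightarrow> m' \<in> M \<Longrightarrow> dm m = dm m' \<Longrightarrow> em 0 m = em 0 m' \<Longrightarrow> m = m'"
  using determined[of "m - m'"] M_diff by (simp add: diff_simps)

lemma dm_act_const: "m \<in> M \<Longrightarrow> dm (act (\<kappa> c) m) = act (\<kappa> c) (dm m)"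
  by (simp add: dm_act act_0_left)

lemma em_act_const: "m \<in> M \<Longrightarrow> em a (act (\<kappa> c) m) = act (\<kappa> c) (em a m)"
  by (simp add: em_act)

lemma jm_act_const: "m \<in> M \<Longrightarrow> jm (act (\<kappa> c) m) = act (\<kappa> c) (jm m)"
  by (rule eqI) (simp_all add: M_jm M_act dm_jm dm_act_const em_0_jm em_act_const)

lemma act_commute: "m \<in> M \<Longrightarrow> act f (act g m) = act g (act f m)"
  using act_mult[of m f g] act_mult[of m g f] by (simp add: mult.commute)

lemma jm_act_jm:
  assumes m: "m \<in> M"
  shows "jm (act f (jm m)) = act (J f) (jm m) - jm (act (J f) m)"
  by (rule eqI) (simp_all add: m M_jm M_act M_diff diff_simps dm_jm dm_act em_0_jm em_act)

lemma jm_act_dm: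
  assumes m: "m \<in> M"
  shows "jm (act f (dm m)) = act f m - jm (act (D f) m) - act (\<kappa> (e 0 f)) (em 0 m)"
  by (rule eqI) (simp_all add: m M_jm M_act M_diff M_dm M_em diff_simps dm_jm dm_act dm_em em_0_jm
      em_act em_em act_0_left)

lemma jm_act_em:
  assumes m: "m \<in> M"
  shows "jm (act f (em a m)) = act (J f) (em a m)"
  by (rule eqI) (simp_all add: m M_jm M_act M_em dm_jm dm_act dm_em em_0_jm em_act act_0_left)

fun letter_rep :: "('k, 'f) opletter \<Rightarrow> 'm \<Rightarrow> 'm" where
  "letter_rep (LFun f) m = act f m"
| "letter_rep LDer m = dm m"
| "letter_rep LInt m = jm m"
| "letter_rep (LEv a) m = em a m"

fun word_rep :: "('k, 'f) opletter word \<Rightarrow> 'm \<Rightarrow> 'm" where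
  "word_rep (Word ls) m = foldr letter_rep ls m"

definition rep :: "('k, 'f) oper \<Rightarrow> 'm \<Rightarrow> 'm" where
  "rep P m = pm_sum (\<lambda>w c. act (\<kappa> c) (word_rep w m)) P"

lemma letter_rep_props:
  assumes "m \<in> M"
  shows "letter_rep l m \<in> M" "m' \<in> M \<Longrightarrow> letter_rep l (m + m') = letter_rep l m + letter_rep l m'"
    "letter_rep l (act (\<kappa> c) m) = act (\<kappa> c) (letter_rep l m)"
  using assms
  by (cases l; simp add: M_act M_dm M_jm M_em act_plus dm_plus jm_plus em_plus dm_act_const
      jm_act_const em_act_const act_commute; fail)+

lemma foldr_rep_props:
  assumes "m \<in> M"
  shows "foldr letter_rep ls m \<in> M"
    "m' \<in> M \<Longrightarrow> foldr letter_rep ls (m + m') = foldr letter_rep ls m + foldr letter_rep ls m'"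
    "foldr letter_rep ls (act (\<kappa> c) m) = act (\<kappa> c) (foldr letter_rep ls m)"
proof -
  have closed: "foldr letter_rep ls x \<in> M" if "x \<in> M" for x
    using that by (induction ls) (simp_all add: letter_rep_props)
  show "foldr letter_rep ls m \<in> M" by (rule closed[OF assms])
  show "foldr letter_rep ls (act (\<kappa> c) m) = act (\<kappa> c) (foldr letter_rep ls m)"
  proof (induction ls)
    case (Cons l ls)
    have "foldr letter_rep ls m \<in> M" using assms by (induction ls) (simp_all add: letter_rep_props)
    then show ?case by (simp add: Cons letter_rep_props)
  qed simp
  show "foldr letter_rep ls (m + m') = foldr letter_rep ls m + foldr letter_rep ls m'"
    if m': "m' \<in> M"
  proof (induction ls)
    case (Cons l ls)
    have "foldr letter_rep ls m \<in> M" "foldr letter_rep ls m' \<in> M"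
      using assms m' by (induction ls) (simp_all add: letter_rep_props)
    then show ?case by (simp add: Cons letter_rep_props)
  qed simp
qed

lemma word_rep_props:
  assumes "m \<in> M"
  shows "word_rep w m \<in> M" "m' \<in> M \<Longrightarrow> word_rep w (m + m') = word_rep w m + word_rep w m'"
    "word_rep w (act (\<kappa> c) m) = act (\<kappa> c) (word_rep w m)"
  by (cases w; simp add: assms foldr_rep_props)+

lemma word_rep_plus: "word_rep (v + w) m = word_rep v (word_rep w m)"
  by (cases v; cases w) simp

lemma rep_additive:
  assumes "m \<in> M"
  shows "additive (\<lambda>P. rep P m)"
  unfolding rep_def
  by (rule pm_sum_additive) (simp add: additive_def const_add act_add word_rep_props assms)

lemma rep_simps:
  assumes "m \<in> M"
  shows "rep (P + Q) m = rep P m + rep Q m" "rep (P - Q) m = rep P m - rep Q m" "rep 0 m = 0"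
    "rep (\<Sum>i\<in>I. F i) m = (\<Sum>i\<in>I. rep (F i) m)"
  using additive.add[OF rep_additive[OF assms]] additive.diff[OF rep_additive[OF assms]]
    additive.zero[OF rep_additive[OF assms]] additive.sum[OF rep_additive[OF assms]] by simp_all

lemma rep_single: "m \<in> M \<Longrightarrow> rep (single w c) m = act (\<kappa> c) (word_rep w m)"
  unfolding rep_def by (rule pm_sum_single) (simp add: act_0_left word_rep_props)

lemma M_rep: "m \<in> M \<Longrightarrow> rep P m \<in> M"
  by (induction P rule: pm_induct)
    (simp_all add: rep_simps rep_single M_0 M_add M_act word_rep_props)

lemma rep_plus: "m \<in> M \<Longrightarrow> m' \<in> M \<Longrightarrow> rep P (m + m') = rep P m + rep P m'"
  by (induction P rule: pm_induct)
    (simp_all add: rep_simps rep_single M_add act_plus word_rep_props)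

lemma rep_zero: "rep P 0 = 0"
  using rep_plus[OF M_0 M_0] by simp

lemma rep_mult: "m \<in> M \<Longrightarrow> rep (P * Q) m = rep P (rep Q m)"
proof (induction P rule: pm_induct)
  case zero
  then show ?case by (simp add: rep_simps M_rep)
next
  case (add w c P)
  note m = \<open>m \<in> M\<close>
  have "rep (single w c * Q) m = rep (single w c) (rep Q m)"
  proof (induction Q rule: pm_induct)
    case (add w' c' Q)
    have "rep (single w c * single w' c') m
        = act (\<kappa> c) (act (\<kappa> c') (word_rep w (word_rep w' m)))"
      by (simp add: mult_single rep_single word_rep_plus const_mult act_mult word_rep_props m)
    also have "\<dots> = rep (single w c) (rep (single w' c') m)"
      by (simp add: rep_single m M_act word_rep_props)
    finally show ?case
      using add m by (simp add: distrib_left rep_simps rep_plus M_rep)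
  qed (simp add: rep_simps rep_zero m)
  with add show ?case by (simp add: distrib_right rep_simps M_rep)
qed

lemma rep_letter: "m \<in> M \<Longrightarrow> rep (op_letter l) m = letter_rep l m"
  by (simp add: op_letter_def rep_single act_1 letter_rep_props)

lemma rep_scalar: "m \<in> M \<Longrightarrow> rep (op_scalar c) m = act (\<kappa> c) m"
  by (simp add: op_scalar_def rep_single zero_word_def)

lemma rep_1: "m \<in> M \<Longrightarrow> rep 1 m = m"
  using rep_scalar[of m 1] by (simp add: op_scalar_def act_1)

lemma rep_relation:
  assumes "P \<in> op_relations A" "m \<in> M"
  shows "rep P m = 0"
  using assms unfolding op_relations_def
  by (auto simp: rep_simps rep_mult rep_letter rep_scalar rep_1 M_rep M_act M_dm M_jm M_em
      act_add act_mult dm_act dm_jm dm_em em_act em_em em_0_jm jm_act_jm jm_act_dm jm_act_em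
      jm_act_const)

lemma rep_ideal: "P \<in> op_ideal A \<Longrightarrow> m \<in> M \<Longrightarrow> rep P m = 0"
  by (induction arbitrary: m rule: op_ideal.induct)
    (simp_all add: rep_relation rep_simps rep_mult rep_zero M_rep)

lemma rep_op_eq: "op_eq A P Q \<Longrightarrow> m \<in> M \<Longrightarrow> rep P m = rep Q m"
  using rep_ideal[of "P - Q" m] by (simp add: op_eq_def rep_simps)

lemma rep_der_power: "m \<in> M \<Longrightarrow> rep (op_der ^ i) m = (dm ^^ i) m \<and> (dm ^^ i) m \<in> M"
  by (induction i) (simp_all add: rep_1 rep_mult rep_letter M_rep M_dm)

lemma rep_diffop:
  "m \<in> M \<Longrightarrow> rep (op_of_diffop T) m = (\<Sum>i\<le>degree T. act (coeff T i) ((dm ^^ i) m))"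
  by (simp add: op_of_diffop_def rep_simps rep_mult rep_letter M_rep rep_der_power)

end

context shifted_ida
begin

sublocale base: op_module A UNIV "(*)" D J "\<lambda>a f. \<kappa> (e a f)"
proof
  show "m = 0" if "D m = 0" "\<kappa> (e 0 m) = 0" for m
    using antiderivative_unique[of m 0] that const_inj[of _ 0] by (simp add: D_simps e_simps)
qed (simp_all add: algebra_simps D_simps J_simps e_simps const_add leibniz e_mult const_mult)

lemma op_act_eq_rep: "op_act A P f = base.rep P f"
proof -
  have "letter_act A l = base.letter_rep l" for l
    by (cases l) (auto simp: fun_eq_iff)
  then have "letter_act A = base.letter_rep" by (simp add: fun_eq_iff)
  then have "word_act A w f = base.word_rep w f" for w
    by (cases w) simp
  then show ?thesis by (simp add: op_act_def base.rep_def scl_eq)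
qed

lemma op_act_diffop: "op_act A (op_of_diffop T) f = diffop A T f"
  by (simp add: op_act_eq_rep base.rep_diffop diffop_def)

lemma klin_op_act: "klin A (op_act A P)"
proof -
  have "base.rep P (\<kappa> c * f) = \<kappa> c * base.rep P f" for c f
    by (induction P rule: pm_induct)
      (simp_all add: base.rep_simps base.rep_single base.word_rep_props distrib_left mult.left_commute)
  then show ?thesis
    by (simp add: klin_iff op_act_eq_rep additive_def base.rep_plus)
qed

lemma diffop_op_act:
  assumes "op_eq A (op_of_diffop T * G) 1"
  shows "diffop A T (op_act A G f) = f"
  using base.rep_op_eq[OF assms, of f]
  by (simp add: base.rep_mult base.rep_1 op_act_diffop[symmetric] op_act_eq_rep)

end

section \<open>Differential operators and their leading coefficients\<close>

context shifted_ida
begin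

text \<open>Points with values in \<open>F\<close>: the identity is the generic point, and \<open>f \<mapsto> f(a)\<close> is the point
  \<open>a \<in> K\<close>.\<close>

definition point :: "('f \<Rightarrow> 'f) \<Rightarrow> bool" where
  "point \<epsilon> \<longleftrightarrow> additive \<epsilon> \<and> (\<forall>f g. \<epsilon> (f * g) = \<epsilon> f * \<epsilon> g) \<and> (\<forall>c. \<epsilon> (\<kappa> c) = \<kappa> c)"

lemma point_id: "point (\<lambda>f. f)"
  by (simp add: point_def additive_def)

lemma point_e: "point (\<lambda>f. \<kappa> (e a f))"
  by (simp add: point_def additive_def e_simps const_add e_mult const_mult)

text \<open>\<open>L\<close> is a differential operator of order at most \<open>m\<close> followed by \<open>\<epsilon>\<close>, and \<open>c\<close>, possibly \<open>0\<close>, is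
  its coefficient at \<open>\<partial>\<^sup>m\<close>.\<close>

definition dop :: "('f \<Rightarrow> 'f) \<Rightarrow> nat \<Rightarrow> 'f \<Rightarrow> ('f \<Rightarrow> 'f) \<Rightarrow> bool" where
  "dop \<epsilon> m c L \<longleftrightarrow> (\<exists>b. b m = c \<and> L = (\<lambda>\<phi>. \<Sum>j\<le>m. b j * \<epsilon> ((D ^^ j) \<phi>)))"

lemma dopI: "b m = c \<Longrightarrow> (\<And>\<phi>. L \<phi> = (\<Sum>j\<le>m. b j * \<epsilon> ((D ^^ j) \<phi>))) \<Longrightarrow> dop \<epsilon> m c L"
  by (auto simp: dop_def fun_eq_iff)

lemma dop_zero: "dop \<epsilon> m 0 (\<lambda>\<phi>. 0)"
  by (rule dopI[where b = "\<lambda>j. 0"]) simp_all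

lemma dop_add:
  assumes "dop \<epsilon> m c L" "dop \<epsilon> m c' L'"
  shows "dop \<epsilon> m (c + c') (\<lambda>\<phi>. L \<phi> + L' \<phi>)"
proof -
  obtain b b' where "b m = c" "L = (\<lambda>\<phi>. \<Sum>j\<le>m. b j * \<epsilon> ((D ^^ j) \<phi>))"
    "b' m = c'" "L' = (\<lambda>\<phi>. \<Sum>j\<le>m. b' j * \<epsilon> ((D ^^ j) \<phi>))"
    using assms by (auto simp: dop_def)
  then show ?thesis
    by (intro dopI[where b = "\<lambda>j. b j + b' j"]) (simp_all add: distrib_right sum.distrib)
qed

lemma dop_cmult:
  assumes "dop \<epsilon> m c L"
  shows "dop \<epsilon> m (d * c) (\<lambda>\<phi>. d * L \<phi>)"
proof -
  obtain b where "b m = c" "L = (\<lambda>\<phi>. \<Sum>j\<le>m. b j * \<epsilon> ((D ^^ j) \<phi>))"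
    using assms by (auto simp: dop_def)
  then show ?thesis
    by (intro dopI[where b = "\<lambda>j. d * b j"]) (simp_all add: sum_distrib_left mult.assoc)
qed

lemma dop_diff:
  assumes "dop \<epsilon> m c L" "dop \<epsilon> m c' L'"
  shows "dop \<epsilon> m (c - c') (\<lambda>\<phi>. L \<phi> - L' \<phi>)"
  using dop_add[OF assms(1) dop_cmult[OF assms(2), of "-1"]] by simp

lemma dop_sum:
  "(\<And>i. i \<in> I \<Longrightarrow> dop \<epsilon> m (c i) (L i)) \<Longrightarrow> dop \<epsilon> m (\<Sum>i\<in>I. c i) (\<lambda>\<phi>. \<Sum>i\<in>I. L i \<phi>)"
  by (induction I rule: infinite_finite_induct) (simp_all add: dop_zero dop_add)

lemma dop_Suc:
  assumes "dop \<epsilon> m c L"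
  shows "dop \<epsilon> (Suc m) 0 L"
proof -
  obtain b where "b m = c" "L = (\<lambda>\<phi>. \<Sum>j\<le>m. b j * \<epsilon> ((D ^^ j) \<phi>))"
    using assms by (auto simp: dop_def)
  then show ?thesis
    by (intro dopI[where b = "b(Suc m := 0)"]) simp_all
qed

lemma dop_less:
  assumes "dop \<epsilon> m c L" "m < m'"
  shows "dop \<epsilon> m' 0 L"
  using assms(2,1)
proof (induction m' arbitrary: c)
  case (Suc m')
  show ?case
  proof (cases "m = m'")
    case True
    then show ?thesis using dop_Suc Suc.prems by blast
  next
    case False
    then show ?thesis using Suc.IH[OF _ Suc.prems(2)] Suc.prems(1) dop_Suc by simp
  qed
qed simp

lemma dop_lower:
  assumes "dop \<epsilon> (Suc m) 0 L"
  shows "\<exists>c. dop \<epsilon> m c L"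
proof -
  obtain b where "b (Suc m) = 0" "L = (\<lambda>\<phi>. \<Sum>j\<le>Suc m. b j * \<epsilon> ((D ^^ j) \<phi>))"
    using assms by (auto simp: dop_def)
  then have "dop \<epsilon> m (b m) L"
    by (intro dopI[where b = b]) simp_all
  then show ?thesis ..
qed

lemma dop_const: "dop \<epsilon> 0 c (\<lambda>\<phi>. c * \<epsilon> \<phi>)"
  by (rule dopI[where b = "\<lambda>j. c"]) simp_all

lemma dop_D:
  assumes "dop \<epsilon> m c L"
  shows "dop \<epsilon> (Suc m) c (\<lambda>\<phi>. L (D \<phi>))"
proof -
  obtain b where "b m = c" "L = (\<lambda>\<phi>. \<Sum>j\<le>m. b j * \<epsilon> ((D ^^ j) \<phi>))"
    using assms by (auto simp: dop_def)
  then show ?thesis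
    by (intro dopI[where b = "\<lambda>j. case j of 0 \<Rightarrow> 0 | Suc i \<Rightarrow> b i"])
      (simp_all add: sum.atMost_Suc_shift funpow_swap1 del: sum.atMost_Suc)
qed

lemma dop_D_power_mult:
  assumes "point \<epsilon>"
  shows "dop \<epsilon> m (\<epsilon> g) (\<lambda>\<phi>. \<epsilon> ((D ^^ m) (g * \<phi>)))"
proof (induction m arbitrary: g)
  case 0
  show ?case using dop_const[of \<epsilon> "\<epsilon> g"] assms by (simp add: point_def)
next
  case (Suc m)
  have "\<epsilon> ((D ^^ Suc m) (g * \<phi>)) = \<epsilon> ((D ^^ m) (D g * \<phi>)) + \<epsilon> ((D ^^ m) (g * D \<phi>))" for \<phi>
    using assms by (simp add: funpow_swap1 leibniz D_pow_simps point_def additive.add)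
  then show ?case
    using dop_add[OF dop_Suc[OF Suc[of "D g"]] dop_D[OF Suc[of g]]] by (simp del: funpow.simps)
qed

lemma dop_mult:
  assumes \<epsilon>: "point \<epsilon>" and "dop \<epsilon> m c L"
  shows "dop \<epsilon> m (c * \<epsilon> g) (\<lambda>\<phi>. L (g * \<phi>))"
proof -
  obtain b where b: "b m = c" "L = (\<lambda>\<phi>. \<Sum>j\<le>m. b j * \<epsilon> ((D ^^ j) \<phi>))"
    using assms by (auto simp: dop_def)
  have "dop \<epsilon> m (if j = m then c * \<epsilon> g else 0) (\<lambda>\<phi>. b j * \<epsilon> ((D ^^ j) (g * \<phi>)))" if "j \<le> m" for j
    using dop_cmult[OF dop_D_power_mult[OF \<epsilon>, of j g], of "b j"] dop_less[of \<epsilon> j _ _ m] that b(1)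
    by (cases "j = m") auto
  from dop_sum[of "{..m}" \<epsilon> m "\<lambda>j. if j = m then c * \<epsilon> g else 0", OF this]
  show ?thesis by (simp add: b(2))
qed

lemma D_J1_power: "D (J 1 ^ Suc j) = \<kappa> (of_nat (Suc j)) * J 1 ^ j"
proof (induction j)
  case (Suc j)
  have "D (J 1 ^ Suc (Suc j)) = J 1 ^ Suc j + J 1 * D (J 1 ^ Suc j)"
    by (subst power_Suc) (simp only: leibniz DJ mult_1)
  also have "\<dots> = J 1 ^ Suc j + \<kappa> (of_nat (Suc j)) * J 1 ^ Suc j"
    by (simp only: Suc) (simp add: mult.left_commute)
  finally show ?case
    by (simp only: of_nat_Suc[of "Suc j"] const_add const_1 distrib_right mult_1)
qed (simp add: leibniz)

lemma D_power_J1_power: "(D ^^ j) (J 1 ^ j) = \<kappa> (fact j)"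
proof (induction j)
  case (Suc j)
  have "(D ^^ Suc j) (J 1 ^ Suc j) = (D ^^ j) (D (J 1 ^ Suc j))"
    by (simp only: funpow_Suc_right comp_apply)
  also have "\<dots> = \<kappa> (of_nat (Suc j)) * (D ^^ j) (J 1 ^ j)"
    by (simp only: D_J1_power D_pow_cmult)
  finally show ?case by (simp only: Suc const_mult[symmetric] fact_Suc)
qed simp

lemma D_power_J1_power_less:
  assumes "j < i"
  shows "(D ^^ i) (J 1 ^ j) = 0"
proof -
  obtain d where "i = d + Suc j" using assms by (metis add.commute less_imp_Suc_add add_Suc_right)
  then have "(D ^^ i) (J 1 ^ j) = (D ^^ d) (D ((D ^^ j) (J 1 ^ j)))"
    by (simp only: funpow_add funpow.simps comp_apply)
  then show ?thesis by (simp add: D_power_J1_power D_pow_simps)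
qed

text \<open>In characteristic \<open>0\<close> the powers of \<open>\<integral>1\<close> separate the coefficients of a differential
  operator, at every point.\<close>

lemma dop_zero_coeffs:
  assumes \<epsilon>: "point \<epsilon>" and zero: "\<And>\<phi>. (\<Sum>j\<le>m. b j * \<epsilon> ((D ^^ j) \<phi>)) = 0" and "i \<le> m"
  shows "b i = 0"
  using \<open>i \<le> m\<close>
proof (induction i rule: less_induct)
  case (less i)
  have "b j * \<epsilon> ((D ^^ j) (J 1 ^ i)) = (if j = i then b i * \<kappa> (fact i) else 0)" if "j \<le> m" for j
    using \<epsilon> less that D_power_J1_power_less[of i j] D_power_J1_power[of i]
    by (cases j i rule: linorder_cases) (auto simp: point_def additive.zero)
  then have "b i * \<kappa> (fact i) = 0"
    using zero[of "J 1 ^ i"] less.prems by simp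
  then have "b i * (\<kappa> (inverse (fact i)) * \<kappa> (fact i)) = 0"
    by (metis mult.left_commute mult_zero_right)
  then show ?case by (simp add: const_inverse)
qed

lemma dop_unique:
  assumes "point \<epsilon>" "dop \<epsilon> m c L" "dop \<epsilon> m c' L"
  shows "c = c'"
proof -
  obtain b where "b m = c - c'" "(\<lambda>\<phi>. L \<phi> - L \<phi>) = (\<lambda>\<phi>. \<Sum>j\<le>m. b j * \<epsilon> ((D ^^ j) \<phi>))"
    using dop_diff[OF assms(2,3)] unfolding dop_def by blast
  then have zero: "(\<Sum>j\<le>m. b j * \<epsilon> ((D ^^ j) \<phi>)) = 0" for \<phi>
    by (metis diff_self)
  have "b m = 0"
    by (rule dop_zero_coeffs[OF assms(1) zero]) simp
  with \<open>b m = c - c'\<close> show ?thesis by simp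
qed

lemma sign_cancel: "(-1) ^ n * ((-1) ^ n * c) = (c :: 'f)"
  by (simp flip: mult.assoc power_mult_distrib)

text \<open>For a distribution \<open>w = \<Phi> H + l\<^sub>0\<close> with \<open>l\<^sub>0\<close> supported at the point \<open>\<epsilon>\<close>, \<open>l i \<phi>\<close> is the part of
  \<open>\<partial>\<^sup>i w\<close> supported at \<open>\<epsilon>\<close>, tested against \<open>\<phi>\<close>, and \<open>q i\<close> is the value of \<open>\<Phi>\<^sup>(\<^sup>i\<^sup>)\<close> there.  Suppose that
  the singular part of \<open>Tw\<close> is \<open>r \<delta>\<close>.  The top order of this singular part comes from
  \<open>\<partial>\<^sup>n l\<^sub>0\<close>, which forces \<open>l\<^sub>0 = 0\<close>; after that, the first nonzero \<open>q k\<close> contributes the derivative of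
  order \<open>n - 1 - k\<close> of \<open>\<delta>\<close>, so it can only occur for \<open>k = n - 1\<close> and is equal to \<open>r\<close>.\<close>

lemma jets_of_impulse_response:
  fixes l :: "nat \<Rightarrow> 'f \<Rightarrow> 'f"
  assumes \<epsilon>: "point \<epsilon>"
    and l0: "dop \<epsilon> m0 c0 (l 0)"
    and lSuc: "\<And>i \<phi>. l (Suc i) \<phi> = q i * \<epsilon> \<phi> - l i (D \<phi>)"
    and n: "0 < n" and t: "t n = 1"
    and sum: "\<And>\<phi>. (\<Sum>i\<le>n. l i (t i * \<phi>)) = r * \<epsilon> \<phi>"
  shows "k < n \<Longrightarrow> q k = (if k = n - 1 then r else 0)"
proof -
  \<comment> \<open>Only the summand \<open>i = n\<close> of the singular part of \<open>Tw\<close> reaches its top order.\<close>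
  have top: "dop \<epsilon> m (c n) (\<lambda>\<phi>. r * \<epsilon> \<phi>)"
    if "dop \<epsilon> m (c n) (l n)" and "\<And>i. i < n \<Longrightarrow> dop \<epsilon> m 0 (l i)" for m c
  proof -
    have "dop \<epsilon> m (if i = n then c n else 0) (\<lambda>\<phi>. l i (t i * \<phi>))" if "i \<le> n" for i
      using dop_mult[OF \<epsilon> \<open>dop \<epsilon> m (c n) (l n)\<close>, of "t n"] dop_mult[OF \<epsilon>, of m 0 "l i" "t i"] that
        \<open>i < n \<Longrightarrow> dop \<epsilon> m 0 (l i)\<close> \<epsilon> t
      by (cases "i = n") (auto simp: point_def, metis const_1 mult.right_neutral)
    from dop_sum[of "{..n}" \<epsilon> m "\<lambda>i. if i = n then c n else 0", OF this]
    show ?thesis by (simp add: sum)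
  qed
  have step: "dop \<epsilon> (Suc m) (- c) (l (Suc i))" if "dop \<epsilon> m c (l i)" for m c i
    using dop_diff[OF dop_less[OF dop_const[of \<epsilon> "q i"], of "Suc m"] dop_D[OF that]]
    by (simp add: lSuc[abs_def])
  have "l 0 = (\<lambda>\<phi>. 0)"
    using l0
  proof (induction m0 arbitrary: c0)
    have c0: "c = 0" if "dop \<epsilon> m c (l 0)" for m c
    proof -
      have d: "dop \<epsilon> (m + i) ((-1) ^ i * c) (l i)" for i
        by (induction i) (use that step[of "m + _"] in auto)
      have "dop \<epsilon> (m + n) ((-1) ^ n * c) (\<lambda>\<phi>. r * \<epsilon> \<phi>)"
        by (rule top[where c = "\<lambda>i. (-1) ^ i * c"]) (use d dop_less[OF d] in auto)
      moreover have "dop \<epsilon> (m + n) 0 (\<lambda>\<phi>. r * \<epsilon> \<phi>)"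
        using dop_less[OF dop_const] n by simp
      ultimately have "(-1) ^ n * c = 0" by (rule dop_unique[OF \<epsilon>])
      then have "(-1) ^ n * ((-1) ^ n * c) = 0" by simp
      then show "c = 0" by (simp only: sign_cancel)
    qed
    {
      case 0
      then show ?case using c0[OF 0] by (auto simp: dop_def)
    next
      case (Suc m)
      then show ?case using c0[OF Suc.prems] dop_lower by blast
    }
  qed
  show "q k = (if k = n - 1 then r else 0)" if "k < n"
    using that
  proof (induction k rule: less_induct)
    case (less k)
    have z: "l i = (\<lambda>\<phi>. 0)" if "i \<le> k" for i
      using that
    proof (induction i)
      case (Suc i)
      then have "q i = 0" using less by auto
      then show ?case using Suc by (simp add: lSuc[abs_def])
    qed (simp add: \<open>l 0 = (\<lambda>\<phi>. 0)\<close>)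
    have d: "dop \<epsilon> i ((-1) ^ i * q k) (l (Suc (k + i)))" for i
    proof (induction i)
      case 0
      show ?case using dop_const[of \<epsilon> "q k"] z[of k] by (simp add: lSuc[abs_def])
    qed (use step in fastforce)
    define s where "s = n - 1 - k"
    have n_eq: "n = Suc (k + s)" using less.prems by (simp add: s_def)
    have "dop \<epsilon> s ((-1) ^ s * q k) (\<lambda>\<phi>. r * \<epsilon> \<phi>)"
    proof (rule top[where c = "\<lambda>i. (-1) ^ s * q k"])
      show "dop \<epsilon> s ((-1) ^ s * q k) (l n)" using d n_eq by simp
      show "dop \<epsilon> s 0 (l i)" if "i < n" for i
      proof (cases "i \<le> k")
        case False
        then obtain j where "i = Suc (k + j)" by (metis less_imp_Suc_add not_le)
        then show ?thesis using d[of j] dop_less that n_eq by auto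
      qed (simp add: z dop_zero)
    qed
    moreover have "dop \<epsilon> s (if s = 0 then r else 0) (\<lambda>\<phi>. r * \<epsilon> \<phi>)"
      using dop_const[of \<epsilon> r] dop_less[OF dop_const, of s \<epsilon> r] by (cases s) auto
    ultimately have "(-1) ^ s * q k = (if s = 0 then r else 0)" by (rule dop_unique[OF \<epsilon>])
    then have "(-1) ^ s * ((-1) ^ s * q k) = (if s = 0 then r else 0)" by simp
    then have "q k = (if s = 0 then r else 0)" by (simp only: sign_cancel)
    moreover have "s = 0 \<longleftrightarrow> k = n - 1" using n_eq by linarith
    ultimately show ?case by simp
  qed
qed

section \<open>Dual vectors\<close>

definition functional :: "('f \<Rightarrow> 'k) \<Rightarrow> bool" where
  "functional \<gamma> \<longleftrightarrow> additive \<gamma> \<and> (\<forall>c f. \<gamma> (\<kappa> c * f) = c * \<gamma> f)"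

lemma functional_simps:
  assumes "functional \<gamma>"
  shows "\<gamma> (f + g) = \<gamma> f + \<gamma> g" "\<gamma> (f - g) = \<gamma> f - \<gamma> g" "\<gamma> 0 = 0" "\<gamma> (- f) = - \<gamma> f"
    "\<gamma> (\<Sum>i\<in>I. F i) = (\<Sum>i\<in>I. \<gamma> (F i))" "\<gamma> (\<kappa> c * f) = c * \<gamma> f"
  using assms additive.add[of \<gamma>] additive.diff[of \<gamma>] additive.zero[of \<gamma>] additive.minus[of \<gamma>]
    additive.sum[of \<gamma> F I] by (auto simp: functional_def)

lemma functional_e_D: "functional (\<lambda>f. e a ((D ^^ k) f))"
  by (simp add: functional_def additive_def D_pow_simps e_simps D_pow_cmult e_cmult)

text \<open>By induction on \<open>n\<close>: if \<open>y\<close> is dual to the first \<open>n\<close> functionals, independence yields an \<open>f\<close> with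
  \<open>\<gamma>\<^sub>n(f) \<noteq> \<Sum>j. \<gamma>\<^sub>n(y\<^sub>j) \<gamma>\<^sub>j(f)\<close>.  Then \<open>f - \<Sum>j. \<gamma>\<^sub>j(f) y\<^sub>j\<close> is a multiple of the new dual vector, by
  which the other \<open>y\<^sub>j\<close> are corrected.\<close>

lemma dual_vectors:
  fixes \<gamma> :: "nat \<Rightarrow> 'f \<Rightarrow> 'k"
  assumes "\<And>i. i < n \<Longrightarrow> functional (\<gamma> i)"
    and "\<And>c i. (\<And>f. (\<Sum>i<n. c i * \<gamma> i f) = 0) \<Longrightarrow> i < n \<Longrightarrow> c i = 0"
  shows "\<exists>y. \<forall>i<n. \<forall>j<n. \<gamma> i (y j) = (if i = j then 1 else 0)"
  using assms
proof (induction n)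
  case (Suc n)
  note lin = functional_simps[OF Suc.prems(1)]
  have "\<exists>y. \<forall>i<n. \<forall>j<n. \<gamma> i (y j) = (if i = j then 1 else 0)"
  proof (rule Suc.IH)
    fix c i assume c: "\<And>f. (\<Sum>i<n. c i * \<gamma> i f) = 0" and "i < n"
    then have "(c(n := 0)) i = 0"
      by (intro Suc.prems(2)[of "c(n := 0)"]) simp_all
    then show "c i = 0" using \<open>i < n\<close> by simp
  qed (use Suc.prems in auto)
  then obtain y where y: "\<And>i j. i < n \<Longrightarrow> j < n \<Longrightarrow> \<gamma> i (y j) = (if i = j then 1 else 0)"
    by blast
  have "\<exists>f. \<gamma> n f - (\<Sum>j<n. \<gamma> n (y j) * \<gamma> j f) \<noteq> 0"
  proof (rule ccontr)
    assume neg: "\<nexists>f. \<gamma> n f - (\<Sum>j<n. \<gamma> n (y j) * \<gamma> j f) \<noteq> 0"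
    define c where "c i = (if i = n then 1 else - \<gamma> n (y i))" for i
    have "(\<Sum>i<Suc n. c i * \<gamma> i f) = 0" for f
    proof -
      have "\<gamma> n f - (\<Sum>j<n. \<gamma> n (y j) * \<gamma> j f) = 0" using neg by blast
      then show ?thesis by (simp add: c_def sum_negf)
    qed
    from Suc.prems(2)[OF this, of n] have "c n = 0" by simp
    then have "(1 :: 'k) = 0" by (simp add: c_def)
    then show False by simp
  qed
  then obtain f where f: "\<gamma> n f - (\<Sum>j<n. \<gamma> n (y j) * \<gamma> j f) \<noteq> 0" ..
  define d where "d = \<gamma> n f - (\<Sum>j<n. \<gamma> n (y j) * \<gamma> j f)"
  define w where "w = \<kappa> (inverse d) * (f - (\<Sum>j<n. \<kappa> (\<gamma> j f) * y j))"
  have "d \<noteq> 0" using f by (simp add: d_def)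
  have "\<gamma> n w = inverse d * (\<gamma> n f - (\<Sum>j<n. \<gamma> j f * \<gamma> n (y j)))"
    by (simp add: w_def lin)
  then have wn: "\<gamma> n w = 1"
    using \<open>d \<noteq> 0\<close> by (simp add: d_def mult.commute)
  have wi: "\<gamma> i w = 0" if "i < n" for i
  proof -
    have "\<gamma> i w = inverse d * (\<gamma> i f - (\<Sum>j<n. \<gamma> j f * \<gamma> i (y j)))"
      using that by (simp add: w_def lin)
    also have "(\<Sum>j<n. \<gamma> j f * \<gamma> i (y j)) = (\<Sum>j<n. if j = i then \<gamma> i f else 0)"
      by (rule sum.cong) (use that y in auto)
    finally show ?thesis using that by simp
  qed
  define z where "z j = (if j = n then w else y j - \<kappa> (\<gamma> n (y j)) * w)" for j
  have "\<gamma> i (z j) = (if i = j then 1 else 0)" if "i < Suc n" "j < Suc n" for i j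
    using that wi wn y by (cases "i = n"; cases "j = n") (simp_all add: z_def lin)
  then show ?case by blast
qed simp

text \<open>Otherwise \<open>x\<close> and the \<open>y\<^sub>j\<close> would be \<open>n + 1\<close> independent vectors in the span of \<open>n\<close> vectors.\<close>

lemma zero_of_dual_vectors:
  fixes \<gamma> :: "nat \<Rightarrow> 'f \<Rightarrow> 'k"
  assumes lin: "\<And>i. i < n \<Longrightarrow> functional (\<gamma> i)"
    and dual: "\<And>i j. i < n \<Longrightarrow> j < n \<Longrightarrow> \<gamma> i (y j) = (if i = j then 1 else 0)"
    and span: "\<And>j. j < n \<Longrightarrow> y j \<in> V.span (z ` {..<n})" "x \<in> V.span (z ` {..<n})"
    and x: "\<And>i. i < n \<Longrightarrow> \<gamma> i x = 0"
  shows "x = 0"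
proof (rule ccontr)
  assume "x \<noteq> 0"
  have kill: "\<gamma> i v = 0" if "i < n" "v \<in> V.span (y ` {..<m})" "m \<le> i" for i m v
    using that(2)
    by (induction rule: V.span_induct_alt)
      (use lin that(1,3) dual in \<open>auto simp: functional_simps scl_eq\<close>)
  have indep: "V.independent (y ` {..<m}) \<and> card (y ` {..<m}) = m" if "m \<le> n" for m
    using that
  proof (induction m)
    case (Suc m)
    have "y m \<notin> V.span (y ` {..<m})"
    proof
      assume "y m \<in> V.span (y ` {..<m})"
      then have "\<gamma> m (y m) = 0" using kill[of m "y m" m] Suc.prems by linarith
      then show False using dual[of m m] Suc.prems by simp
    qed
    moreover from this have "y m \<notin> y ` {..<m}" by (rule contra_subsetD[OF V.span_superset])
    ultimately show ?case
      using Suc by (simp add: lessThan_Suc V.independent_insertI)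
  qed (simp add: V.independent_empty)
  have "v = (\<Sum>i<n. \<kappa> (\<gamma> i v) * y i)" if "v \<in> V.span (y ` {..<n})" for v
    using that
  proof (induction rule: V.span_induct_alt)
    case base
    show ?case using lin by (simp add: functional_simps)
  next
    case (step c b v)
    then obtain j where j: "j < n" "b = y j" by auto
    have "(\<Sum>i<n. \<kappa> (\<gamma> i (scl A c b + v)) * y i)
        = (\<Sum>i<n. (if i = j then \<kappa> c * y j else 0) + \<kappa> (\<gamma> i v) * y i)"
      by (rule sum.cong)
        (use lin j dual in \<open>auto simp: functional_simps scl_eq const_add const_mult distrib_right\<close>)
    also have "\<dots> = \<kappa> c * y j + v"
      using j step by (simp add: sum.distrib)
    finally show ?case by (simp add: j scl_eq)
  qed
  then have "x \<notin> V.span (y ` {..<n})" using x \<open>x \<noteq> 0\<close> by force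
  moreover from this have "x \<notin> y ` {..<n}" by (rule contra_subsetD[OF V.span_superset])
  ultimately have "V.independent (insert x (y ` {..<n})) \<and> card (insert x (y ` {..<n})) = Suc n"
    using indep[of n] by (simp add: V.independent_insertI)
  moreover have "insert x (y ` {..<n}) \<subseteq> V.span (z ` {..<n})"
    using span by auto
  ultimately have "Suc n \<le> card (z ` {..<n})"
    using V.independent_span_bound[of "z ` {..<n}" "insert x (y ` {..<n})"] by auto
  then show False using card_image_le[of "{..<n}" z] by simp
qed

end

section \<open>The impulse at a generic point\<close>

lemma additive_sum_list: "additive f \<Longrightarrow> f (\<Sum>x\<leftarrow>xs. g x) = (\<Sum>x\<leftarrow>xs. f (g x))"
  by (induction xs) (simp_all add: additive.zero additive.add)

context shifted_ida
begin

lemma klin_intros: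
  "klin A D" "klin A J" "klin A (\<lambda>f. f)" "klin A ((*) g)" "klin A (\<lambda>f. \<kappa> (e c f))"
  "klin A l \<Longrightarrow> klin A l' \<Longrightarrow> klin A (\<lambda>f. l f + l' f)"
  "klin A l \<Longrightarrow> klin A (\<lambda>f. g * l f)"
  "klin A l \<Longrightarrow> klin A l' \<Longrightarrow> klin A (\<lambda>f. l (l' f))"
  by (auto simp: klin_iff additive_def D_simps J_simps D_cmult J_cmult e_simps e_cmult const_add
      const_mult distrib_left mult.left_commute)

lemma klin_const: "klin A l \<Longrightarrow> l (\<kappa> c) = \<kappa> c * l 1"
  unfolding klin_iff by (metis mult.right_neutral)

text \<open>\<open>F \<otimes> F\<close> embeds into the functions of \<open>K\<close>-linear maps \<open>l : F \<rightarrow> F\<close> by \<open>(u \<otimes> v)(l) = l(u) v\<close>.  An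
  operator \<open>P\<close> on the first factor becomes \<open>\<Phi> \<mapsto> (l \<mapsto> \<Phi>(l \<circ> P))\<close>, restriction to the diagonal
  becomes evaluation at the identity, and evaluating the first factor at \<open>c\<close> becomes evaluation
  at \<open>f \<mapsto> f(c)\<close>.  The set contains all functions that are additive and \<open>F\<close>-linear
  in \<open>l\<close>, as the elements of the image are; the value \<open>0\<close> at nonlinear \<open>l\<close> makes equality of
  functions the same as equality on linear maps.\<close>

definition tensors :: "(('f \<Rightarrow> 'f) \<Rightarrow> 'f) set" where
  "tensors = {\<Phi>. (\<forall>l. \<not> klin A l \<longrightarrow> \<Phi> l = 0) \<and>
     (\<forall>l l'. klin A l \<longrightarrow> klin A l' \<longrightarrow> \<Phi> (\<lambda>f. l f + l' f) = \<Phi> l + \<Phi> l') \<and>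
     (\<forall>g l. klin A l \<longrightarrow> \<Phi> (\<lambda>f. g * l f) = g * \<Phi> l)}"

definition tens :: "'f \<Rightarrow> 'f \<Rightarrow> ('f \<Rightarrow> 'f) \<Rightarrow> 'f" where
  "tens u v = (\<lambda>l. if klin A l then l u * v else 0)"

definition tmap :: "('f \<Rightarrow> 'f) \<Rightarrow> (('f \<Rightarrow> 'f) \<Rightarrow> 'f) \<Rightarrow> ('f \<Rightarrow> 'f) \<Rightarrow> 'f" where
  "tmap P \<Phi> = (\<lambda>l. if klin A l then \<Phi> (\<lambda>f. l (P f)) else 0)"

lemma tensorsD:
  assumes "\<Phi> \<in> tensors"
  shows "klin A l \<Longrightarrow> klin A l' \<Longrightarrow> \<Phi> (\<lambda>f. l f + l' f) = \<Phi> l + \<Phi> l'"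
    "klin A l \<Longrightarrow> \<Phi> (\<lambda>f. g * l f) = g * \<Phi> l" "\<not> klin A l \<Longrightarrow> \<Phi> l = 0"
  using assms by (auto simp: tensors_def)

lemma tensors_sum:
  assumes \<Phi>: "\<Phi> \<in> tensors" and "\<And>i. i \<in> I \<Longrightarrow> klin A (l i)"
  shows "klin A (\<lambda>f. \<Sum>i\<in>I. l i f) \<and> \<Phi> (\<lambda>f. \<Sum>i\<in>I. l i f) = (\<Sum>i\<in>I. \<Phi> (l i))"
proof -
  have z: "klin A (\<lambda>f. 0)" by (simp add: klin_iff additive_def)
  have "\<Phi> (\<lambda>f. 0) = 0" using tensorsD(2)[OF \<Phi> z, of 0] by simp
  with assms(2) show ?thesis
    by (induction I rule: infinite_finite_induct) (simp_all add: z klin_intros tensorsD(1)[OF \<Phi>])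
qed

lemma tensors_closed:
  "0 \<in> tensors" "\<Phi> \<in> tensors \<Longrightarrow> \<Psi> \<in> tensors \<Longrightarrow> \<Phi> + \<Psi> \<in> tensors"
  "\<Phi> \<in> tensors \<Longrightarrow> \<Psi> \<in> tensors \<Longrightarrow> \<Phi> - \<Psi> \<in> tensors"
  "tens u v \<in> tensors" "\<Phi> \<in> tensors \<Longrightarrow> klin A P \<Longrightarrow> tmap P \<Phi> \<in> tensors"
  by (auto simp: tensors_def tens_def tmap_def klin_intros algebra_simps)

lemma tmap_simps:
  "tmap P (\<Phi> + \<Psi>) = tmap P \<Phi> + tmap P \<Psi>" "tmap P (\<Phi> - \<Psi>) = tmap P \<Phi> - tmap P \<Psi>" "tmap P 0 = 0"
  "klin A P \<Longrightarrow> tmap P (tens u v) = tens (P u) v"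
  by (auto simp: tmap_def tens_def fun_eq_iff klin_intros)

lemma tmap_add_left: "\<Phi> \<in> tensors \<Longrightarrow> klin A P \<Longrightarrow> klin A Q \<Longrightarrow>
    tmap (\<lambda>f. P f + Q f) \<Phi> = tmap P \<Phi> + tmap Q \<Phi>"
  by (auto simp: tmap_def fun_eq_iff klin_iff additive_def
      intro!: tensorsD(1)[of \<Phi> "\<lambda>f. _ (P f)" "\<lambda>f. _ (Q f)"])

lemma tmap_tmap: "klin A P \<Longrightarrow> tmap P (tmap Q \<Phi>) = tmap (\<lambda>f. P (Q f)) \<Phi>"
  by (auto simp: tmap_def fun_eq_iff klin_intros)

lemma tmap_id: "\<Phi> \<in> tensors \<Longrightarrow> tmap (\<lambda>f. f) \<Phi> = \<Phi>"
  by (auto simp: tmap_def fun_eq_iff tensorsD)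

lemma tmap_leibniz:
  assumes "\<Phi> \<in> tensors"
  shows "tmap D (tmap ((*) g) \<Phi>) = tmap ((*) g) (tmap D \<Phi>) + tmap ((*) (D g)) \<Phi>"
proof -
  have "(\<lambda>f. D (g * f)) = (\<lambda>f. g * D f + D g * f)"
    by (simp add: leibniz fun_eq_iff add.commute)
  then show ?thesis
    using tmap_add_left[OF assms klin_intros(8)[OF klin_intros(4,1), of g] klin_intros(4)[of "D g"]]
    by (simp add: tmap_tmap klin_intros)
qed

lemma tens_simps:
  "tens u 0 = 0" "tens 0 v = 0" "tens u (v + w) = tens u v + tens u w" "tens (u + u') v = tens u v + tens u' v"
  "tens (\<kappa> c * u) v = tens u (\<kappa> c * v)"
  by (auto simp: tens_def fun_eq_iff algebra_simps klin_iff additive_def additive.zero)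

lemma tens_apply_id: "tens u v (\<lambda>f. f) = u * v"
  by (simp add: tens_def klin_intros)

lemma tensor_apply_ev:
  assumes "\<Phi> \<in> tensors" "klin A l"
  shows "\<Phi> (\<lambda>f. l (\<kappa> (e c f))) = l 1 * \<Phi> (\<lambda>f. \<kappa> (e c f))"
  using tensorsD(2)[OF assms(1), of "\<lambda>f. \<kappa> (e c f)" "l 1"]
  by (simp add: klin_intros klin_const[OF assms(2)] mult.commute)

lemma tmap_apply_ev:
  assumes "\<Phi> \<in> tensors"
  shows "tmap ((*) g) \<Phi> (\<lambda>f. \<kappa> (e c f)) = \<kappa> (e c g) * \<Phi> (\<lambda>f. \<kappa> (e c f))"
  using tensorsD(2)[OF assms, of "\<lambda>f. \<kappa> (e c f)" "\<kappa> (e c g)"]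
  by (simp add: tmap_def klin_intros e_mult const_mult)

lemma tmap_apply_ev_0:
  assumes "\<Phi> \<in> tensors"
  shows "tmap J \<Phi> (\<lambda>f. \<kappa> (e 0 f)) = 0"
  using tensors_sum[OF assms, of "{}"] by (simp add: tmap_def klin_intros)

lemma tens_apply_ev: "tens 1 v (\<lambda>f. \<kappa> (e c f)) = v"
  by (simp add: tens_def klin_intros)

lemma tens_const: "tens (\<kappa> c) v = tens 1 (\<kappa> c * v)"
  using tens_simps(5)[of c 1 v] by simp

text \<open>In the first factor \<open>id = \<integral>\<partial> + e\<^sub>0\<close>, so a tensor is fixed by its derivative and its value at \<open>0\<close>.\<close>

lemma tensor_zero:
  assumes \<Phi>: "\<Phi> \<in> tensors" and D: "tmap D \<Phi> = 0" and ev: "\<Phi> (\<lambda>f. \<kappa> (e 0 f)) = 0"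
  shows "\<Phi> = 0"
proof
  fix l
  show "\<Phi> l = 0 l"
  proof (cases "klin A l")
    case True
    have "klin A (\<lambda>f. l (J (D f)))" "klin A (\<lambda>f. l (\<kappa> (e 0 f)))"
      by (rule klin_intros(8)[OF True klin_intros(8)[OF klin_intros(2,1)]]
          klin_intros(8)[OF True klin_intros(5)])+
    then have "\<Phi> (\<lambda>f. l (J (D f)) + l (\<kappa> (e 0 f)))
        = \<Phi> (\<lambda>f. l (J (D f))) + \<Phi> (\<lambda>f. l (\<kappa> (e 0 f)))"
      by (rule tensorsD(1)[OF \<Phi>])
    moreover have "l (J (D f)) + l (\<kappa> (e 0 f)) = l f" for f
      using True by (simp add: const_e_0 klin_iff additive.diff)
    moreover have "\<Phi> (\<lambda>f. l (J (D f))) = 0"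
      using fun_cong[OF D, of "\<lambda>f. l (J f)"] True by (simp add: tmap_def klin_intros)
    ultimately show ?thesis using ev by (simp add: tensor_apply_ev[OF \<Phi> True])
  qed (simp add: tensorsD[OF \<Phi>])
qed

text \<open>\<open>(a, b, L)\<close> stands for \<open>a + b H\<^sub>\<xi> + L\<close>, where \<open>\<xi>\<close> is a generic point and \<open>L\<close> is a combination of
  derivatives of \<open>\<delta>\<^sub>\<xi>\<close>, given as the differential operator that sends a test function \<open>\<phi>\<close> to
  \<open>\<langle>L, \<phi>\<rangle>\<close>.\<close>

type_synonym 'g generic = "(('g \<Rightarrow> 'g) \<Rightarrow> 'g) \<times> (('g \<Rightarrow> 'g) \<Rightarrow> 'g) \<times> ('g \<Rightarrow> 'g)"

definition gen_carrier :: "'f generic set" where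
  "gen_carrier = {(a, b, L). a \<in> tensors \<and> b \<in> tensors \<and> (\<exists>m c. dop (\<lambda>f. f) m c L)}"

fun gen_act :: "'f \<Rightarrow> 'f generic \<Rightarrow> 'f generic" where
  "gen_act g (a, b, L) = (tmap ((*) g) a, tmap ((*) g) b, \<lambda>\<phi>. L (g * \<phi>))"

text \<open>\<open>(b H\<^sub>\<xi>)' = b' H\<^sub>\<xi> + b(\<xi>, \<xi>) \<delta>\<^sub>\<xi>\<close>, and \<open>b(\<xi>, \<xi>)\<close> is the value of \<open>b\<close> at the identity.\<close>

fun gen_der :: "'f generic \<Rightarrow> 'f generic" where
  "gen_der (a, b, L) = (tmap D a, tmap D b, \<lambda>\<phi>. b (\<lambda>f. f) * \<phi> - L (D \<phi>))"

text \<open>The \<open>H\<^sub>\<xi>\<close>-part is \<open>\<integral>\<^sub>\<xi> b + \<langle>L, 1\<rangle>\<close>: the total mass of \<open>L\<close> becomes a jump, and \<open>b J\<close> is the value of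
  \<open>\<integral>b\<close> at \<open>\<xi>\<close>.  The constant subtracted from \<open>\<integral>a\<close> makes the whole integral vanish at \<open>0\<close>.\<close>

fun gen_int :: "('k \<Rightarrow> 'k) \<Rightarrow> 'f generic \<Rightarrow> 'f generic" where
  "gen_int h (a, b, L) = (tmap J a - tens 1 (\<kappa> (h 0) * (L 1 - b J)),
     tmap J b + tens 1 (L 1 - b J), \<lambda>\<phi>. J \<phi> * L 1 - L (J \<phi>))"

fun gen_ev :: "('k \<Rightarrow> 'k) \<Rightarrow> 'k \<Rightarrow> 'f generic \<Rightarrow> 'f generic" where
  "gen_ev h c (a, b, L) =
     (tens 1 (a (\<lambda>f. \<kappa> (e c f)) + \<kappa> (h c) * b (\<lambda>f. \<kappa> (e c f))), 0, \<lambda>\<phi>. 0)"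

lemma dop_linear:
  assumes "dop (\<lambda>f. f) m c L"
  shows "additive L" "L (\<kappa> d * \<phi>) = \<kappa> d * L \<phi>"
  using assms by (auto simp: dop_def additive_def D_pow_simps D_pow_cmult distrib_left mult.left_commute
      sum.distrib sum_distrib_left)

lemma dop_gen_int:
  assumes "dop (\<lambda>f. f) m c L"
  shows "\<exists>m c. dop (\<lambda>f. f) m c (\<lambda>\<phi>. J \<phi> * L 1 - L (J \<phi>))"
proof -
  obtain b where L: "L = (\<lambda>\<phi>. \<Sum>j\<le>m. b j * (D ^^ j) \<phi>)"
    using assms by (auto simp: dop_def)
  have L1: "L 1 = b 0"
  proof -
    have "b j * (D ^^ j) 1 = (if j = 0 then b 0 else 0)" for j
      by (cases j) (simp_all add: funpow_swap1 D_pow_simps del: funpow.simps(2),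
          simp add: funpow_Suc_right D_pow_simps del: funpow.simps(2))
    then show ?thesis by (simp add: L)
  qed
  show ?thesis
  proof (cases m)
    case 0
    then have "(\<lambda>\<phi>. J \<phi> * L 1 - L (J \<phi>)) = (\<lambda>\<phi>. 0)" by (simp add: L1 L mult.commute)
    then show ?thesis using dop_zero by auto
  next
    case (Suc m')
    have "J \<phi> * L 1 - L (J \<phi>) = (\<Sum>j\<le>m'. - b (Suc j) * (D ^^ j) \<phi>)" for \<phi>
      unfolding L1 unfolding L Suc sum.atMost_Suc_shift
      by (simp add: sum_negf funpow_Suc_right del: funpow.simps(2))
    then show ?thesis by (intro exI dopI[where b = "\<lambda>j. - b (Suc j)"]) simp_all
  qed
qed

lemma dop_gen_der:
  assumes "dop (\<lambda>f. f) m c L"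
  shows "\<exists>m c. dop (\<lambda>f. f) m c (\<lambda>\<phi>. r * \<phi> - L (D \<phi>))"
  using dop_diff[OF dop_less[OF dop_const[of "\<lambda>f. f" r], of "Suc m"] dop_D[OF assms]] by auto

text \<open>\<open>H\<^sub>\<xi>\<close> for a generic point \<open>\<xi>\<close> takes no definite value at the points \<open>c \<in> K\<close>; any values
  \<open>h c\<close> may be prescribed.\<close>

lemma gen_module: "op_module A gen_carrier gen_act gen_der (gen_int h) (gen_ev h)"
proof
  fix m m' :: "'f generic" and f g :: 'f and a b :: 'k
  obtain x y L where m: "m = (x, y, L)" by (cases m)
  obtain x' y' L' where m': "m' = (x', y', L')" by (cases m')
  show "0 \<in> gen_carrier"
    using dop_zero[of "\<lambda>f. f"] tensors_closed(1)
    by (auto simp: gen_carrier_def zero_prod_def zero_fun_def)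
  assume mc: "m \<in> gen_carrier"
  then have x: "x \<in> tensors" and y: "y \<in> tensors" and "\<exists>m c. dop (\<lambda>f. f) m c L"
    by (auto simp: m gen_carrier_def)
  then obtain k c where L: "dop (\<lambda>f. f) k c L" by blast
  note Ll = dop_linear[OF L] and La = additive.add[OF dop_linear(1)[OF L]]
    additive.diff[OF dop_linear(1)[OF L]] additive.zero[OF dop_linear(1)[OF L]]
  show "gen_act f m \<in> gen_carrier"
    using dop_mult[OF point_id L, of f] x y by (auto simp: gen_carrier_def m tensors_closed klin_intros)
  show "gen_der m \<in> gen_carrier"
    using dop_gen_der[OF L] x y by (auto simp: gen_carrier_def m tensors_closed klin_intros)
  show "gen_int h m \<in> gen_carrier"
    using dop_gen_int[OF L] x y by (auto simp: gen_carrier_def m tensors_closed klin_intros)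
  show "gen_ev h a m \<in> gen_carrier"
    using dop_zero[of "\<lambda>f. f"] x y by (auto simp: gen_carrier_def m tensors_closed klin_intros)
  have "((*) 1 :: 'f \<Rightarrow> 'f) = (\<lambda>f. f)" by (simp add: fun_eq_iff)
  then show "gen_act 1 m = m"
    using x y by (simp add: m tmap_id)
  have split: "(\<lambda>x. (f + g) * x) = (\<lambda>x. f * x + g * x)" by (simp add: distrib_right)
  show "gen_act (f + g) m = gen_act f m + gen_act g m"
    using x y by (auto simp: m split tmap_add_left klin_intros plus_prod_def La distrib_right fun_eq_iff)
  have "((*) (f * g)) = (\<lambda>x. f * (g * x))" by (simp add: mult.assoc fun_eq_iff)
  then show "gen_act (f * g) m = gen_act f (gen_act g m)"
    by (simp add: m tmap_tmap klin_intros mult.assoc mult.left_commute)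
  have "tmap ((*) f) y (\<lambda>f. f) = f * y (\<lambda>f. f)"
    using tensorsD(2)[OF y, of "\<lambda>f. f" f] by (simp add: tmap_def klin_intros)
  then show "gen_der (gen_act f m) = gen_act f (gen_der m) + gen_act (D f) m"
    using x y by (simp add: m tmap_leibniz plus_prod_def fun_eq_iff La leibniz algebra_simps)
  have LJ: "L (J (D \<phi>)) = L \<phi> - (\<phi> - J (D \<phi>)) * L 1" for \<phi>
  proof -
    have "L \<phi> - L (J (D \<phi>)) = (\<phi> - J (D \<phi>)) * L 1"
      using Ll(2)[of "e 0 \<phi>" 1] by (simp add: const_e_0 La)
    then show ?thesis by (metis diff_diff_eq2 add_diff_cancel_left')
  qed
  have J1: "tmap J y (\<lambda>f. f) = y J"
    by (simp add: tmap_def klin_intros)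
  show "gen_der (gen_int h m) = m"
    using x y by (simp add: m tmap_simps tmap_tmap klin_intros tmap_id tens_simps D_simps fun_eq_iff
        LJ J1 tens_apply_id algebra_simps)
  show "gen_der (gen_ev h a m) = 0"
    by (simp add: m tmap_simps klin_intros zero_prod_def tens_simps fun_eq_iff La)
  show "gen_ev h a (gen_act f m) = gen_act (\<kappa> (e a f)) (gen_ev h a m)"
    using x y by (simp add: m tmap_apply_ev tmap_simps klin_intros tens_const distrib_left
        mult.left_commute)
  show "gen_ev h b (gen_ev h a m) = gen_ev h a m"
    by (simp add: m tens_def klin_intros)
  show "gen_ev h 0 (gen_int h m) = 0"
    using x y by (simp add: m tmap_apply_ev_0 tens_apply_ev tens_simps zero_prod_def fun_eq_iff)
  show "m = 0" if "gen_der m = 0" "gen_ev h 0 m = 0"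
  proof -
    have D: "tmap D x = 0" "tmap D y = 0" and LD: "\<And>\<phi>. y (\<lambda>f. f) * \<phi> = L (D \<phi>)"
      using that(1) by (auto simp: m zero_prod_def fun_eq_iff)
    have "y (\<lambda>f. f) = 0" using LD[of 1] by (simp add: La)
    moreover have "y (\<lambda>f. J (D f) + \<kappa> (e 0 f)) = y (\<lambda>f. J (D f)) + y (\<lambda>f. \<kappa> (e 0 f))"
      by (rule tensorsD(1)[OF y]) (simp_all add: klin_intros)
    moreover have "y (\<lambda>f. J (D f)) = 0"
      using fun_cong[OF D(2), of J] by (simp add: tmap_def klin_intros)
    ultimately have y0: "y = 0"
      using tensor_zero[OF y D(2)] by (simp add: const_e_0)
    have "L (D (J \<phi>)) = 0" for \<phi>
      using LD[of "J \<phi>"] \<open>y (\<lambda>f. f) = 0\<close> by (simp del: DJ)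
    then have "L = 0" by (simp add: fun_eq_iff)
    have "tens 1 (x (\<lambda>f. \<kappa> (e 0 f))) (\<lambda>f. f) = 0"
      using that(2) y0 by (simp add: m zero_prod_def)
    then have "x (\<lambda>f. \<kappa> (e 0 f)) = 0" by (simp add: tens_def klin_intros)
    then show ?thesis
      using tensor_zero[OF x D(1)] y0 \<open>L = 0\<close> by (simp add: m zero_prod_def)
  qed
  assume mc': "m' \<in> gen_carrier"
  then have x': "x' \<in> tensors" and y': "y' \<in> tensors" and "\<exists>m c. dop (\<lambda>f. f) m c L'"
    by (auto simp: m' gen_carrier_def)
  then obtain k' c' where L': "dop (\<lambda>f. f) k' c' L'" by blast
  have "\<exists>m c. dop (\<lambda>f. f) m c (\<lambda>f. L f + L' f)"
  proof -
    define n where "n = Suc (max k k')"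
    have "dop (\<lambda>f. f) n 0 L" "dop (\<lambda>f. f) n 0 L'"
      by (rule dop_less[OF L] dop_less[OF L']; simp add: n_def)+
    from dop_add[OF this] show ?thesis by blast
  qed
  then show "m + m' \<in> gen_carrier"
    using tensors_closed(2)[OF x x'] tensors_closed(2)[OF y y']
    by (simp add: m m' gen_carrier_def plus_prod_def plus_fun_def)
  show "gen_act f (m + m') = gen_act f m + gen_act f m'"
    by (simp add: m m' plus_prod_def tmap_simps fun_eq_iff)
  show "gen_der (m + m') = gen_der m + gen_der m'"
    by (simp add: m m' plus_prod_def tmap_simps fun_eq_iff algebra_simps)
  show "gen_int h (m + m') = gen_int h m + gen_int h m'"
    by (auto simp: m m' plus_prod_def tmap_simps fun_eq_iff algebra_simps tens_def)
  show "gen_ev h a (m + m') = gen_ev h a m + gen_ev h a m'"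
    by (auto simp: m m' plus_prod_def fun_eq_iff algebra_simps tens_def)
qed

definition impulse :: "'f generic" where
  "impulse = (0, 0, \<lambda>\<phi>. \<phi>)"

lemma impulse_carrier: "impulse \<in> gen_carrier"
proof -
  have "dop (\<lambda>f. f) 0 1 (\<lambda>\<phi>. \<phi>)" using dop_const[of "\<lambda>f. f" 1] by simp
  then show ?thesis using tensors_closed(1) by (auto simp: impulse_def gen_carrier_def)
qed

text \<open>\<open>u \<integral> v\<close> sends \<open>\<delta>\<^sub>\<xi>\<close> to \<open>u(x) v(\<xi>) (H\<^sub>\<xi> - h 0)\<close>, and \<open>u e\<^sub>a \<integral> v\<close> sends it to
  \<open>u(x) v(\<xi>) (h a - h 0)\<close>.\<close>

lemma rep_integral_op_impulse:
  "op_module.rep A gen_act gen_der (gen_int h) (gen_ev h) (op_of_integral_op gs) impulse =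
    ((\<Sum>(u, s, v)\<leftarrow>gs. tens u (\<kappa> (case s of None \<Rightarrow> - h 0 | Some a \<Rightarrow> h a - h 0) * v)),
     (\<Sum>(u, s, v)\<leftarrow>gs. if s = None then tens u v else 0), \<lambda>\<phi>. 0)"
proof -
  interpret gen: op_module A gen_carrier gen_act gen_der "gen_int h" "gen_ev h" by (rule gen_module)
  note mem = impulse_carrier gen.M_act gen.M_jm gen.M_em gen.M_rep
  have J0: "gen_int h (0, 0, \<lambda>\<phi>. v * \<phi>) = (- tens 1 (\<kappa> (h 0) * v), tens 1 v, \<lambda>\<phi>. 0)" for v
    by (simp add: tmap_simps fun_eq_iff)
  have neg: "- tens u w = tens u (- w)" for u w
    by (auto simp: tens_def fun_eq_iff)
  have term_rep: "gen.rep (op_fun u * (case s of None \<Rightarrow> 1 | Some a \<Rightarrow> op_ev a) * op_int * op_fun v) impulse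
      = (tens u (\<kappa> (case s of None \<Rightarrow> - h 0 | Some a \<Rightarrow> h a - h 0) * v),
         if s = None then tens u v else 0, \<lambda>\<phi>. 0)" for u v s
  proof -
    have "gen_int h (gen_act v impulse) = (- tens 1 (\<kappa> (h 0) * v), tens 1 v, \<lambda>\<phi>. 0)"
      by (simp add: impulse_def tmap_simps J0 del: gen_int.simps)
    moreover have "gen.rep (op_fun u * (case s of None \<Rightarrow> 1 | Some a \<Rightarrow> op_ev a) * op_int * op_fun v) impulse
        = gen_act u (case s of None \<Rightarrow> gen_int h (gen_act v impulse)
            | Some a \<Rightarrow> gen_ev h a (gen_int h (gen_act v impulse)))"
      by (cases s) (simp_all add: gen.rep_mult gen.rep_letter gen.rep_1 mem)
    moreover have "tmap ((*) u) 0 = (\<lambda>l. 0)"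
      by (simp add: tmap_def fun_eq_iff)
    ultimately show ?thesis
      by (cases s) (simp_all add: neg tens_apply_ev tmap_simps klin_intros zero_fun_def const_diff
          const_minus algebra_simps)
  qed
  have "gen.rep (op_of_integral_op gs) impulse
      = (\<Sum>(u, s, v)\<leftarrow>gs. (tens u (\<kappa> (case s of None \<Rightarrow> - h 0 | Some a \<Rightarrow> h a - h 0) * v),
         if s = None then tens u v else 0, \<lambda>\<phi>. 0))"
    unfolding op_of_integral_op_def additive_sum_list[OF gen.rep_additive[OF impulse_carrier]]
    by (simp add: case_prod_unfold term_rep)
  also have "\<dots> = ((\<Sum>(u, s, v)\<leftarrow>gs. tens u (\<kappa> (case s of None \<Rightarrow> - h 0 | Some a \<Rightarrow> h a - h 0) * v)),
     (\<Sum>(u, s, v)\<leftarrow>gs. if s = None then tens u v else 0), \<lambda>\<phi>. 0)"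
    by (induction gs) (auto simp: zero_prod_def plus_prod_def zero_fun_def plus_fun_def)
  finally show ?thesis .
qed

text \<open>An integral operator sends \<open>\<delta>\<^sub>\<xi>\<close> to a function.\<close>

lemma integral_op_not_1: "\<not> op_eq A (op_of_integral_op gs) 1"
proof
  interpret gen: op_module A gen_carrier gen_act gen_der "gen_int (\<lambda>c. 0)" "gen_ev (\<lambda>c. 0)"
    by (rule gen_module)
  assume "op_eq A (op_of_integral_op gs) 1"
  from gen.rep_op_eq[OF this impulse_carrier]
  have "(\<lambda>\<phi>. 0) = (\<lambda>\<phi> :: 'f. \<phi>)"
    unfolding rep_integral_op_impulse gen.rep_1[OF impulse_carrier] by (simp add: impulse_def)
  from fun_cong[OF this, of 1] show False by simp
qed

text \<open>The tensor \<open>\<Sum> u \<otimes> v\<close> over the terms of one kind.\<close>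

definition kernel_at :: "('k, 'f) integral_op \<Rightarrow> 'k option \<Rightarrow> ('f \<Rightarrow> 'f) \<Rightarrow> 'f" where
  "kernel_at gs s l = (\<Sum>(u, s', v)\<leftarrow>gs. if s' = s then l u * v else 0)"

lemma sum_list_fun_apply: "(\<Sum>x\<leftarrow>xs. F x) y = (\<Sum>x\<leftarrow>xs. F x y :: 'b::ab_group_add)"
  by (induction xs) auto

text \<open>The terms \<open>u \<integral> v\<close> are the \<open>H\<^sub>\<xi>\<close>-part of the action on \<open>\<delta>\<^sub>\<xi>\<close>.  The terms with \<open>e\<^sub>a\<close>, \<open>a \<noteq> 0\<close>, are
  isolated by prescribing the values \<open>h a = 1\<close> and \<open>h c = 0\<close> at all other points.  Terms with
  \<open>e\<^sub>0\<close> are invisible, as \<open>e\<^sub>0 \<integral> = 0\<close>.\<close>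

lemma kernel_at_cong:
  assumes eq: "op_eq A (op_of_integral_op gs) (op_of_integral_op gs')"
    and l: "klin A l" and s: "s \<noteq> Some 0"
  shows "kernel_at gs s l = kernel_at gs' s l"
proof -
  define h :: "'k \<Rightarrow> 'k" where "h a = (if s = Some a then 1 else 0)" for a
  have h0: "h 0 = 0" using s by (simp add: h_def)
  interpret gen: op_module A gen_carrier gen_act gen_der "gen_int h" "gen_ev h" by (rule gen_module)
  note gen.rep_op_eq[OF eq impulse_carrier]
  then have
    0: "(\<Sum>(u, s, v)\<leftarrow>gs. tens u (\<kappa> (case s of None \<Rightarrow> - h 0 | Some a \<Rightarrow> h a - h 0) * v)) l
      = (\<Sum>(u, s, v)\<leftarrow>gs'. tens u (\<kappa> (case s of None \<Rightarrow> - h 0 | Some a \<Rightarrow> h a - h 0) * v)) l" and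
    1: "(\<Sum>(u, s, v)\<leftarrow>gs. if s = None then tens u v else 0) l
      = (\<Sum>(u, s, v)\<leftarrow>gs'. if s = None then tens u v else 0) l"
    by (simp_all add: rep_integral_op_impulse)
  show ?thesis
  proof (cases s)
    case None
    have "kernel_at xs s l = (\<Sum>(u, s, v)\<leftarrow>xs. if s = None then tens u v else 0) l" for xs
      unfolding kernel_at_def sum_list_fun_apply using None l
      by (intro arg_cong[where f = sum_list] map_cong) (auto simp: tens_def)
    then show ?thesis using 1 by simp
  next
    case (Some a)
    have "kernel_at xs s l
      = (\<Sum>(u, s, v)\<leftarrow>xs. tens u (\<kappa> (case s of None \<Rightarrow> - h 0 | Some a \<Rightarrow> h a - h 0) * v)) l" for xs
      unfolding kernel_at_def sum_list_fun_apply using Some l h0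
      by (intro arg_cong[where f = sum_list] map_cong) (auto simp: tens_def h_def split: option.split)
    then show ?thesis using 0 by simp
  qed
qed

text \<open>The biadditive maps that factor through \<open>F \<otimes>\<^sub>K F\<close>.\<close>

definition balanced :: "('f \<Rightarrow> 'f \<Rightarrow> 'x::ab_group_add) \<Rightarrow> bool" where
  "balanced B \<longleftrightarrow> (\<forall>v. additive (\<lambda>u. B u v)) \<and> (\<forall>u. additive (B u)) \<and>
     (\<forall>c u v. B (\<kappa> c * u) v = B u (\<kappa> c * v))"

text \<open>The universal property of the tensor product: expand the \<open>u\<close> in a \<open>K\<close>-basis of \<open>F\<close>; the coordinates
  are among the linear maps \<open>l\<close>.\<close>

lemma balanced_sum_eq_0:
  assumes B: "balanced B"
    and zero: "\<And>l. klin A l \<Longrightarrow> (\<Sum>(u, v)\<leftarrow>xs. l u * v) = 0"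
  shows "(\<Sum>(u, v)\<leftarrow>xs. B u v) = 0"
proof -
  define X where "X = V.extend_basis {}"
  define R where "R = V.representation X"
  have X: "V.independent X" "V.span X = UNIV"
    using V.independent_extend_basis[OF V.independent_empty] V.span_extend_basis[OF V.independent_empty]
    by (simp_all add: X_def)
  have R: "klin A (\<lambda>f. \<kappa> (R f b))" for b
    using V.representation_add[OF X(1)] V.representation_scale[OF X(1)] X(2)
    by (simp add: klin_iff additive_def R_def const_add const_mult flip: scl_eq)
  define S where "S = (\<Union>(u, v)\<in>set xs. {b. R u b \<noteq> 0})"
  have fin: "finite S"
    by (auto simp: S_def R_def V.finite_representation)
  have expand: "u = (\<Sum>b\<in>S. \<kappa> (R u b) * b)" if "(u, v) \<in> set xs" for u v
  proof -
    have "(\<Sum>b\<in>S. scl A (R u b) b) = (\<Sum>b | R u b \<noteq> 0. scl A (R u b) b)"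
      using that fin by (intro sum.mono_neutral_right) (auto simp: S_def)
    also have "\<dots> = u"
      unfolding R_def by (rule V.sum_nonzero_representation_eq[OF X(1)]) (simp add: X(2))
    finally show ?thesis by (simp add: scl_eq)
  qed
  have Bl: "additive (\<lambda>u. B u v)" and Br: "additive (B u)" and Bc: "B (\<kappa> c * u) v = B u (\<kappa> c * v)" for u v c
    using B by (auto simp: balanced_def)
  have "(\<Sum>(u, v)\<leftarrow>xs. B u v) = (\<Sum>(u, v)\<leftarrow>xs. \<Sum>b\<in>S. B b (\<kappa> (R u b) * v))"
  proof (intro arg_cong[where f = sum_list] map_cong refl, clarify)
    fix u v assume "(u, v) \<in> set xs"
    then have "B u v = B (\<Sum>b\<in>S. \<kappa> (R u b) * b) v" using expand by metis
    then show "B u v = (\<Sum>b\<in>S. B b (\<kappa> (R u b) * v))"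
      by (simp add: additive.sum[OF Bl] Bc)
  qed
  also have "\<dots> = (\<Sum>b\<in>S. \<Sum>(u, v)\<leftarrow>xs. B b (\<kappa> (R u b) * v))"
    by (induction xs) (auto simp: sum.distrib)
  also have "\<dots> = (\<Sum>b\<in>S. B b (\<Sum>(u, v)\<leftarrow>xs. \<kappa> (R u b) * v))"
    by (simp add: additive_sum_list[OF Br] case_prod_unfold)
  also have "\<dots> = 0"
    using zero[OF R] by (simp add: additive.zero[OF Br])
  finally show ?thesis .
qed

text \<open>Everything computed from a representation of an operator that respects tensors and ignores terms
  with \<open>e\<^sub>0\<close> depends only on the operator.\<close>

lemma balanced_sums_cong:
  fixes B :: "'k option \<Rightarrow> 'f \<Rightarrow> 'f \<Rightarrow> 'x::ab_group_add"
  assumes eq: "op_eq A (op_of_integral_op gs) (op_of_integral_op gs')"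
    and B: "\<And>s. balanced (B s)" and B0: "\<And>u v. B (Some 0) u v = 0"
  shows "(\<Sum>(u, s, v)\<leftarrow>gs. B s u v) = (\<Sum>(u, s, v)\<leftarrow>gs'. B s u v)"
proof -
  define xs where "xs = gs @ map (\<lambda>(u, s, v). (- u, s, v)) gs'"
  have Bneg: "B s (- u) v = - B s u v" for s u v
    using B[of s] additive.minus[of "\<lambda>u. B s u v"] by (simp add: balanced_def)
  have split: "(\<Sum>(u, s, v)\<leftarrow>xs. F s u v) = (\<Sum>(u, s, v)\<leftarrow>gs. F s u v) - (\<Sum>(u, s, v)\<leftarrow>gs'. F s u v)"
    if "\<And>s u v. F s (- u) v = - F s u v" for F :: "'k option \<Rightarrow> 'f \<Rightarrow> 'f \<Rightarrow> 'y::ab_group_add"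
  proof -
    have "(\<Sum>(u, s, v)\<leftarrow>map (\<lambda>(u, s, v). (- u, s, v)) gs'. F s u v) = - (\<Sum>(u, s, v)\<leftarrow>gs'. F s u v)"
      by (induction gs') (auto simp: that)
    then show ?thesis by (simp add: xs_def)
  qed
  define S where "S = (\<lambda>(u, s, v). s) ` set xs"
  have tags: "(\<Sum>(u, s, v)\<leftarrow>ys. B s u v)
      = (\<Sum>s\<in>S. \<Sum>(u, v)\<leftarrow>map (\<lambda>(u, s, v). (u, v)) (filter (\<lambda>(u, s', v). s' = s) ys). B s u v)"
    if "set ys \<subseteq> set xs" for ys
    using that
  proof (induction ys)
    case (Cons y ys)
    obtain u s v where y: "y = (u, s, v)" by (cases y)
    have s: "s \<in> S" using Cons.prems by (force simp: S_def y)
    have "(\<Sum>t\<in>S. (if s = t then B t u v else 0)) = B s u v"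
      using s by (simp add: S_def)
    moreover have "(\<Sum>(u, v)\<leftarrow>map (\<lambda>(u, s, v). (u, v)) (filter (\<lambda>(u, s', v). s' = t) (y # ys)). B t u v)
       = (if s = t then B t u v else 0)
         + (\<Sum>(u, v)\<leftarrow>map (\<lambda>(u, s, v). (u, v)) (filter (\<lambda>(u, s', v). s' = t) ys). B t u v)" for t
      by (simp add: y)
    ultimately show ?case
      using Cons by (simp add: y[symmetric] sum.distrib del: filter.simps) (simp add: y)
  qed simp
  have "(\<Sum>(u, v)\<leftarrow>map (\<lambda>(u, s, v). (u, v)) (filter (\<lambda>(u, s', v). s' = s) xs). B s u v) = 0" for s
  proof (cases "s = Some 0")
    case True
    show ?thesis unfolding True by (induction xs) (auto simp: B0)
  next
    case False
    show ?thesis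
    proof (rule balanced_sum_eq_0[OF B])
      fix l assume l: "klin A l"
      have "(\<Sum>(u, v)\<leftarrow>map (\<lambda>(u, s, v). (u, v)) (filter (\<lambda>(u, s', v). s' = s) xs). l u * v) = kernel_at xs s l"
        unfolding kernel_at_def by (induction xs) auto
      also have "\<dots> = kernel_at gs s l - kernel_at gs' s l"
        unfolding kernel_at_def
        by (rule split[of "\<lambda>s' u v. if s' = s then l u * v else 0"])
          (use l in \<open>auto simp: klin_iff additive.minus\<close>)
      finally show "(\<Sum>(u, v)\<leftarrow>map (\<lambda>(u, s, v). (u, v)) (filter (\<lambda>(u, s', v). s' = s) xs). l u * v) = 0"
        using kernel_at_cong[OF eq l False] by simp
    qed
  qed
  then have "(\<Sum>(u, s, v)\<leftarrow>xs. B s u v) = 0"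
    using tags[of xs] by simp
  then show ?thesis using split[of B] Bneg by simp
qed

end

section \<open>Fundamental systems\<close>

context shifted_ida
begin

lemma functional_cond: "functional (cond A b)"
  unfolding functional_def additive_def cond_def pm_sum_def
  by (simp add: case_prod_unfold D_pow_simps D_pow_cmult e_simps e_cmult J_simps J_cmult
      distrib_left mult.left_commute sum.distrib sum_distrib_left)

end

locale regular_problem = shifted_ida A
  for A :: "('k::linordered_field, 'f::comm_ring_1) ida" +
  fixes T :: "'f poly" and bs :: "('k, 'f) stieltjes list" and G :: "('k, 'f) oper"
  assumes stieltjes: "stieltjes_problem A T bs" and reg: "regular A T bs"
    and right_inverse: "op_eq A (op_of_diffop T * G) 1"
    and pos: "0 < degree T"
begin

abbreviation n where "n \<equiv> degree T"
abbreviation \<beta> where "\<beta> i \<equiv> cond A (bs ! i)"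
abbreviation Tact where "Tact \<equiv> diffop A T"

lemma coeff_n: "coeff T n = 1" and length_bs: "length bs = n"
  using stieltjes by (simp_all add: stieltjes_problem_def)

lemma functional_\<beta>: "functional (\<beta> i)"
  by (rule functional_cond)

lemmas \<beta>_simps = functional_simps[OF functional_\<beta>]

lemma zero_of_kernel_orth: "Tact f = 0 \<Longrightarrow> (\<And>i. i < n \<Longrightarrow> \<beta> i f = 0) \<Longrightarrow> f = 0"
proof -
  assume "Tact f = 0" "\<And>i. i < n \<Longrightarrow> \<beta> i f = 0"
  then have "cond A b f = 0" if "b \<in> set bs" for b
    using that length_bs by (metis in_set_conv_nth)
  with \<open>Tact f = 0\<close> have "f \<in> {f. Tact f = 0} \<inter> orth A bs"
    by (simp add: orth_def)
  then show "f = 0" using reg unfolding regular_def by blast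
qed

text \<open>Vectors dual to the boundary conditions stay dual after projection to \<open>ker T\<close> along \<open>\<B>\<^sup>\<bottom>\<close>.\<close>

lemma ex_dual_kernel:
  "\<exists>z. \<forall>j<n. Tact (z j) = 0 \<and> (\<forall>i<n. \<beta> i (z j) = (if i = j then 1 else 0))"
proof -
  have "\<exists>y. \<forall>i<n. \<forall>j<n. \<beta> i (y j) = (if i = j then 1 else 0)"
    by (rule dual_vectors) (use functional_\<beta> stieltjes in \<open>auto simp: stieltjes_problem_def\<close>)
  then obtain y where y: "\<And>i j. i < n \<Longrightarrow> j < n \<Longrightarrow> \<beta> i (y j) = (if i = j then 1 else 0)"
    by blast
  have "\<exists>z w. Tact z = 0 \<and> w \<in> orth A bs \<and> y j = z + w" for j
    using reg unfolding regular_def by blast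
  then obtain z w where zw: "\<And>j. Tact (z j) = 0" "\<And>j. w j \<in> orth A bs" "\<And>j. y j = z j + w j"
    by metis
  have "\<beta> i (w j) = 0" if "i < n" for i j
    using zw(2)[of j] that length_bs by (auto simp: orth_def)
  then have "\<beta> i (z j) = \<beta> i (y j)" if "i < n" for i j
    using that by (simp add: zw(3) \<beta>_simps)
  with y zw(1) show ?thesis by (intro exI[of _ z]) simp
qed

end

locale dual_kernel = regular_problem +
  fixes z :: "nat \<Rightarrow> 'b"
  assumes Tz: "j < n \<Longrightarrow> Tact (z j) = 0"
    and \<beta>z: "i < n \<Longrightarrow> j < n \<Longrightarrow> \<beta> i (z j) = (if i = j then 1 else 0)"
begin

lemma kernel_expand:
  assumes "Tact f = 0"
  shows "f = (\<Sum>j<n. \<kappa> (\<beta> j f) * z j)"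
proof -
  have "f - (\<Sum>j<n. \<kappa> (\<beta> j f) * z j) = 0"
  proof (rule zero_of_kernel_orth)
    show "Tact (f - (\<Sum>j<n. \<kappa> (\<beta> j f) * z j)) = 0"
      by (simp add: diffop_simps diffop_cmult assms Tz)
    show "\<beta> i (f - (\<Sum>j<n. \<kappa> (\<beta> j f) * z j)) = 0" if "i < n" for i
    proof -
      have "(\<Sum>j<n. \<beta> j f * \<beta> i (z j)) = (\<Sum>j<n. if j = i then \<beta> i f else 0)"
        by (rule sum.cong) (use that \<beta>z in auto)
      then show ?thesis using that by (simp add: \<beta>_simps)
    qed
  qed
  then show ?thesis by simp
qed

lemma sum_fun_apply: "(\<Sum>i\<in>I. F i) x = (\<Sum>i\<in>I. F i x :: 'x::ab_group_add)"
  by (induction I rule: infinite_finite_induct) auto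

lemma klin_D_pow: "klin A (D ^^ k)"
  by (simp add: klin_iff D_pow_additive D_pow_cmult)

text \<open>This is where the right inverse has to lie in the operator ring.  Its value at \<open>\<delta>\<^sub>\<xi>\<close> has an
  \<open>H\<^sub>\<xi>\<close>-coefficient \<open>\<Phi> \<in> F \<otimes> F\<close> with \<open>T\<^sub>x \<Phi> = 0\<close>.  Projecting the first factor to \<open>ker T\<close> gives
  \<open>\<Phi> = \<Sum>j. z\<^sub>j \<otimes> v\<^sub>j\<close> with \<open>v\<^sub>j = \<beta>\<^sub>j(\<Phi>)\<close>, and the sums in the claim are the derivatives of
  \<open>\<Phi>\<close> on the diagonal.\<close>

lemma ex_impulse_response:
  "\<exists>v. \<forall>k<n. (\<Sum>j<n. (D ^^ k) (z j) * v j) = (if k = n - 1 then 1 else 0)"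
proof -
  interpret gen: op_module A gen_carrier gen_act gen_der "gen_int (\<lambda>c. 0)" "gen_ev (\<lambda>c. 0)"
    by (rule gen_module)
  define m where "m = gen.rep G impulse"
  have mc: "m \<in> gen_carrier" unfolding m_def by (rule gen.M_rep[OF impulse_carrier])
  obtain a \<Phi> L where m: "m = (a, \<Phi>, L)" by (cases m)
  have \<Phi>: "\<Phi> \<in> tensors" and "\<exists>k c. dop (\<lambda>f. f) k c L"
    using mc by (auto simp: m gen_carrier_def)
  then obtain k0 c0 where L: "dop (\<lambda>f. f) k0 c0 L" by blast
  define l where "l i = snd (snd ((gen_der ^^ i) m))" for i
  have der_pow: "\<exists>x. (gen_der ^^ i) m = (x, tmap (D ^^ i) \<Phi>, l i)" for i
  proof (induction i)
    case 0
    have "D ^^ 0 = (\<lambda>f. f)" by auto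
    then show ?case using tmap_id[OF \<Phi>] by (simp add: m l_def)
  next
    case (Suc i)
    then obtain x where x: "(gen_der ^^ i) m = (x, tmap (D ^^ i) \<Phi>, l i)" ..
    have "(\<lambda>f. (D ^^ i) (D f)) = D ^^ Suc i" by (simp add: fun_eq_iff funpow_swap1)
    moreover have "(\<lambda>f. D ((D ^^ i) f)) = D ^^ Suc i" by (simp add: fun_eq_iff)
    moreover have "(gen_der ^^ Suc i) m = gen_der (x, tmap (D ^^ i) \<Phi>, l i)"
      by (simp only: funpow.simps comp_apply x)
    ultimately show ?case
      using tmap_tmap[of D "D ^^ i" \<Phi>] klin_intros(1) by (simp add: l_def[of "Suc i"] del: funpow.simps)
  qed
  have lSuc: "l (Suc i) \<phi> = \<Phi> (D ^^ i) * \<phi> - l i (D \<phi>)" for i \<phi>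
  proof -
    obtain x where x: "(gen_der ^^ i) m = (x, tmap (D ^^ i) \<Phi>, l i)" using der_pow by blast
    have "tmap (D ^^ i) \<Phi> (\<lambda>f. f) = \<Phi> (D ^^ i)"
      by (simp add: tmap_def klin_intros)
    then show ?thesis by (simp add: l_def[of "Suc i"] x)
  qed
  have "(\<Sum>i\<le>n. gen_act (coeff T i) ((gen_der ^^ i) m)) = impulse"
    using gen.rep_op_eq[OF right_inverse impulse_carrier]
    by (simp add: gen.rep_mult gen.rep_1 impulse_carrier gen.rep_diffop[OF mc] m_def[symmetric])
  moreover obtain x where "\<And>i. (gen_der ^^ i) m = (x i, tmap (D ^^ i) \<Phi>, l i)"
    using der_pow by metis
  ultimately have eq: "(\<Sum>i\<le>n. (tmap ((*) (coeff T i)) (x i),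
      tmap ((*) (coeff T i)) (tmap (D ^^ i) \<Phi>), \<lambda>\<phi>. l i (coeff T i * \<phi>))) = impulse"
    by simp
  have "(\<Sum>i\<le>n. tmap ((*) (coeff T i)) (tmap (D ^^ i) \<Phi>)) = 0"
    using arg_cong[OF eq, of "\<lambda>p. fst (snd p)"] by (simp add: fst_sum snd_sum impulse_def)
  then have kill: "(\<Sum>i\<le>n. tmap ((*) (coeff T i)) (tmap (D ^^ i) \<Phi>) \<mu>) = 0" for \<mu>
    using sum_fun_apply[of "\<lambda>i. tmap ((*) (coeff T i)) (tmap (D ^^ i) \<Phi>)" "{..n}" \<mu>] by simp
  have sum_l: "(\<Sum>i\<le>n. l i (coeff T i * \<phi>)) = 1 * \<phi>" for \<phi>
    using fun_cong[OF arg_cong[OF eq, of "\<lambda>p. snd (snd p)"], of \<phi>]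
    by (simp add: snd_sum impulse_def sum_fun_apply)
  have "l 0 = L" by (simp add: l_def m)
  then have jets: "\<Phi> (D ^^ k) = (if k = n - 1 then 1 else 0)" if "k < n" for k
    using jets_of_impulse_response[OF point_id, of k0 c0 l "\<lambda>i. \<Phi> (D ^^ i)" n "coeff T" 1 k]
      L lSuc pos coeff_n sum_l that by simp
  have \<Phi>T: "\<Phi> (\<lambda>f. \<mu> (Tact f)) = 0" if \<mu>: "klin A \<mu>" for \<mu>
  proof -
    have kl: "klin A (\<lambda>f. \<mu> (coeff T i * f))" for i
      by (rule klin_intros(8)[OF \<mu> klin_intros(4)])
    have "\<Phi> (\<lambda>f. \<Sum>i\<le>n. \<mu> (coeff T i * (D ^^ i) f)) = (\<Sum>i\<le>n. \<Phi> (\<lambda>f. \<mu> (coeff T i * (D ^^ i) f)))"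
      using tensors_sum[OF \<Phi>, of "{..n}" "\<lambda>i f. \<mu> (coeff T i * (D ^^ i) f)"]
        klin_intros(8)[OF kl klin_D_pow] by blast
    also have "\<dots> = (\<Sum>i\<le>n. tmap ((*) (coeff T i)) (tmap (D ^^ i) \<Phi>) \<mu>)"
      by (simp add: tmap_def \<mu> kl)
    also have "\<dots> = 0" by (rule kill)
    finally show ?thesis
      using \<mu> by (simp add: diffop_def klin_iff additive.sum)
  qed
  define P where "P f = (\<Sum>j<n. \<kappa> (\<beta> j f) * z j)" for f
  have Plin: "klin A P"
    by (simp add: P_def klin_iff additive_def \<beta>_simps const_add const_mult distrib_right
        sum.distrib sum_distrib_left mult.assoc)
  define S where "S = op_act A G"
  have S: "klin A S" "\<And>f. Tact (S f) = f"
    by (simp_all add: S_def klin_op_act diffop_op_act[OF right_inverse])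
  \<comment> \<open>\<open>f - P f\<close> depends only on \<open>Tact f\<close>, because \<open>f - S (Tact f)\<close> lies in the kernel, where \<open>P\<close> is the
    identity.  So the part of \<open>\<mu>\<close> on \<open>f - P f\<close> factors through \<open>T\<close> and is killed by \<open>\<Phi>\<close>.\<close>
  have \<Phi>_expand: "\<Phi> \<mu> = (\<Sum>j<n. \<mu> (z j) * \<Phi> (\<lambda>f. \<kappa> (\<beta> j f)))" if \<mu>: "klin A \<mu>" for \<mu>
  proof -
    note \<mu>_lin = additive.add additive.diff additive.sum
    have ma: "additive \<mu>" and mc: "\<And>c f. \<mu> (\<kappa> c * f) = \<kappa> c * \<mu> f"
      using \<mu> by (auto simp: klin_iff)
    have "P (f - S (Tact f)) = f - S (Tact f)" for f
      unfolding P_def by (rule kernel_expand[symmetric]) (simp add: diffop_simps S)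
    then have "P f - P (S (Tact f)) = f - S (Tact f)" for f
      using Plin by (simp add: klin_iff additive.diff[symmetric])
    then have "P f + (S (Tact f) - P (S (Tact f))) = f" for f
      by (metis add_diff_eq diff_add_eq diff_add_cancel)
    then have mu: "\<mu> (P f) + \<mu> (S (Tact f) - P (S (Tact f))) = \<mu> f" for f
      by (simp flip: additive.add[OF ma])
    have split: "\<mu> = (\<lambda>f. \<mu> (P f) + \<mu> (S (Tact f) - P (S (Tact f))))"
      by (rule ext) (rule mu[symmetric])
    have l1: "klin A (\<lambda>f. \<mu> (P f))" by (rule klin_intros(8)[OF \<mu> Plin])
    have l2: "klin A (\<lambda>g. \<mu> (S g - P (S g)))"
      using \<mu> S(1) Plin
      by (simp add: klin_iff additive_def additive.diff[OF ma] right_diff_distrib)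
    have Tact_lin: "klin A Tact" by (simp add: klin_iff diffop_additive diffop_cmult)
    have l3: "klin A (\<lambda>f. \<mu> (S (Tact f) - P (S (Tact f))))"
      by (rule klin_intros(8)[OF l2 Tact_lin])
    have "\<Phi> \<mu> = \<Phi> (\<lambda>f. \<mu> (P f)) + \<Phi> (\<lambda>f. \<mu> (S (Tact f) - P (S (Tact f))))"
      using arg_cong[OF split, of \<Phi>] tensorsD(1)[OF \<Phi> l1 l3] by (rule trans)
    also have "\<Phi> (\<lambda>f. \<mu> (S (Tact f) - P (S (Tact f)))) = 0"
      by (rule \<Phi>T[OF l2])
    also have "(\<lambda>f. \<mu> (P f)) = (\<lambda>f. \<Sum>j<n. \<mu> (z j) * \<kappa> (\<beta> j f))"
      by (simp add: P_def additive.sum[OF ma] mc) (simp add: mult.commute)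
    also have "\<Phi> \<dots> = (\<Sum>j<n. \<Phi> (\<lambda>f. \<mu> (z j) * \<kappa> (\<beta> j f)))"
    proof -
      have "klin A (\<lambda>f. \<kappa> (\<beta> j f))" for j
        by (simp add: klin_iff additive_def \<beta>_simps const_add const_mult)
      then show ?thesis
        using tensors_sum[OF \<Phi>, of "{..<n}" "\<lambda>j f. \<mu> (z j) * \<kappa> (\<beta> j f)"] klin_intros(7) by blast
    qed
    also have "\<dots> = (\<Sum>j<n. \<mu> (z j) * \<Phi> (\<lambda>f. \<kappa> (\<beta> j f)))"
      by (intro sum.cong refl tensorsD(2)[OF \<Phi>])
        (simp add: klin_iff additive_def \<beta>_simps const_add const_mult)
    finally show ?thesis by simp
  qed
  show ?thesis
    by (rule exI[of _ "\<lambda>j. \<Phi> (\<lambda>f. \<kappa> (\<beta> j f))"])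
      (simp add: \<Phi>_expand[OF klin_D_pow, symmetric] jets)
qed

end

locale fundamental_system = dual_kernel +
  fixes v :: "nat \<Rightarrow> 'b"
  assumes zv: "k < n \<Longrightarrow> (\<Sum>j<n. (D ^^ k) (z j) * v j) = (if k = n - 1 then 1 else 0)"
begin

text \<open>Up to order \<open>n - 1\<close> the equations for \<open>z\<close> and \<open>v\<close> remove the terms in which a \<open>Q\<^sub>j\<close> is
  differentiated; in order \<open>n\<close> they leave \<open>\<phi>\<close>.\<close>

lemma variation_of_constants:
  assumes Q: "\<And>j. j < n \<Longrightarrow> D (Q j) = v j * \<phi>"
  shows "k < n \<Longrightarrow> (D ^^ k) (\<Sum>j<n. z j * Q j) = (\<Sum>j<n. (D ^^ k) (z j) * Q j)"
    and "Tact (\<Sum>j<n. z j * Q j) = \<phi>"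
proof -
  have step: "D (\<Sum>j<n. (D ^^ k) (z j) * Q j)
      = (\<Sum>j<n. (D ^^ Suc k) (z j) * Q j) + (if k = n - 1 then \<phi> else 0)" if "k < n" for k
  proof -
    have "D (\<Sum>j<n. (D ^^ k) (z j) * Q j)
        = (\<Sum>j<n. (D ^^ Suc k) (z j) * Q j) + (\<Sum>j<n. (D ^^ k) (z j) * v j) * \<phi>"
      by (simp add: D_simps leibniz Q sum.distrib sum_distrib_right mult.assoc)
    then show ?thesis using zv[OF that] by (simp split: if_splits)
  qed
  have low: "(D ^^ k) (\<Sum>j<n. z j * Q j) = (\<Sum>j<n. (D ^^ k) (z j) * Q j)" if "k < n" for k
    using that by (induction k) (simp_all add: step del: funpow.simps(2), simp add: step)
  then show "k < n \<Longrightarrow> (D ^^ k) (\<Sum>j<n. z j * Q j) = (\<Sum>j<n. (D ^^ k) (z j) * Q j)" .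
  have "(D ^^ n) (\<Sum>j<n. z j * Q j) = D ((D ^^ (n - 1)) (\<Sum>j<n. z j * Q j))"
  proof -
    obtain m where m: "n = Suc m" using pos by (cases n) auto
    then show ?thesis by simp
  qed
  also have "\<dots> = (\<Sum>j<n. (D ^^ n) (z j) * Q j) + \<phi>"
    using low[of "n - 1"] step[of "n - 1"] pos by simp
  finally have top: "(D ^^ n) (\<Sum>j<n. z j * Q j) = (\<Sum>j<n. (D ^^ n) (z j) * Q j) + \<phi>" .
  have "coeff T k * (D ^^ k) (\<Sum>j<n. z j * Q j)
      = coeff T k * (\<Sum>j<n. (D ^^ k) (z j) * Q j) + (if k = n then \<phi> else 0)" if "k \<le> n" for k
  proof (cases "k = n")
    case True
    then show ?thesis by (simp only: top coeff_n mult_1 if_True simp_thms)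
  next
    case False
    then have "k < n" using that by simp
    from low[OF this] show ?thesis using False by (simp only: if_False add_0_right)
  qed
  then have "Tact (\<Sum>j<n. z j * Q j)
      = (\<Sum>k\<le>n. coeff T k * (\<Sum>j<n. (D ^^ k) (z j) * Q j) + (if k = n then \<phi> else 0))"
    unfolding diffop_def by (intro sum.cong) simp_all
  also have "\<dots> = (\<Sum>k\<le>n. coeff T k * (\<Sum>j<n. (D ^^ k) (z j) * Q j)) + \<phi>"
    by (simp add: sum.distrib)
  also have "(\<Sum>k\<le>n. coeff T k * (\<Sum>j<n. (D ^^ k) (z j) * Q j)) = (\<Sum>j<n. Tact (z j) * Q j)"
    unfolding diffop_def sum_distrib_left sum_distrib_right mult.assoc by (rule sum.swap)
  finally show "Tact (\<Sum>j<n. z j * Q j) = \<phi>" by (simp add: Tz)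
qed

text \<open>Let \<open>p\<^sub>j\<close> be dual to the functionals \<open>f \<mapsto> f\<^sup>(\<^sup>i\<^sup>)(a)\<close>, \<open>i < n\<close>.  Variation of constants with
  \<open>\<integral>\<^sub>a\<close> gives \<open>w\<^sub>j\<close> with \<open>T w\<^sub>j = T p\<^sub>j\<close> and zero initial values at \<open>a\<close>.  So the \<open>p\<^sub>j - w\<^sub>j\<close> are \<open>n\<close> elements
  of \<open>ker T\<close> with dual initial values, and \<open>ker T\<close> is spanned by \<open>n\<close> elements.\<close>

lemma zero_of_initial_values:
  assumes "Tact f = 0" and "\<And>i. i < n \<Longrightarrow> e a ((D ^^ i) f) = 0"
  shows "f = 0"
proof -
  have in_span: "g \<in> V.span (z ` {..<n})" if "Tact g = 0" for g
  proof -
    have "(\<Sum>j<n. scl A (\<beta> j g) (z j)) \<in> V.span (z ` {..<n})"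
      by (intro V.span_sum V.span_scale V.span_base) simp
    then show ?thesis using kernel_expand[OF that] by (simp add: scl_eq)
  qed
  have "\<exists>p. \<forall>i<n. \<forall>j<n. e a ((D ^^ i) (p j)) = (if i = j then 1 else 0)"
  proof (rule dual_vectors)
    fix c :: "nat \<Rightarrow> 'a" and i
    assume c: "\<And>f. (\<Sum>i<n. c i * e a ((D ^^ i) f)) = 0" and i: "i < n"
    have "{..n - 1} = {..<n}" using pos by auto
    then have "(\<Sum>j\<le>n - 1. \<kappa> (c j) * \<kappa> (e a ((D ^^ j) \<phi>))) = 0" for \<phi>
      using c[of \<phi>] by (simp flip: const_mult const_sum)
    then have "\<kappa> (c i) = 0"
      by (rule dop_zero_coeffs[OF point_e]) (use i in simp)
    then show "c i = 0" using const_inj[of _ 0] by simp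
  qed (rule functional_e_D)
  then obtain p where p: "\<And>i j. i < n \<Longrightarrow> j < n \<Longrightarrow> e a ((D ^^ i) (p j)) = (if i = j then 1 else 0)"
    by blast
  define w where "w j = (\<Sum>i<n. z i * itg_from A a (v i * Tact (p j)))" for j
  have w: "Tact (w j) = Tact (p j)" "i < n \<Longrightarrow> e a ((D ^^ i) (w j)) = 0" for i j
    unfolding w_def
    by (simp_all add: variation_of_constants e_simps e_mult e_itg_from)
  show ?thesis
  proof (rule zero_of_dual_vectors[where n = n and \<gamma> = "\<lambda>i f. e a ((D ^^ i) f)"
        and y = "\<lambda>j. p j - w j" and z = z])
    show "p j - w j \<in> V.span (z ` {..<n})" for j
      by (rule in_span) (simp add: diffop_simps w)
  qed (use assms p w in \<open>auto simp: functional_e_D D_pow_simps e_simps in_span\<close>)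
qed

end

section \<open>Distributions\<close>

lemma lookup_additive: "additive (\<lambda>p. lookup p k :: 'a::ab_group_add)"
  by (simp add: additive_def lookup_add)

lemma pm_eq_sum_single: "p = (\<Sum>k\<in>keys p. single k (lookup p k))"
  by (rule poly_mapping_eqI)
    (simp add: lookup_sum lookup_single when_def in_keys_iff)

lemma lookup_dist_scl: "lookup (dist_scl f p) g = f * lookup p g"
  by (auto simp: dist_scl_def Poly_Mapping.map.rep_eq when_def)

lemma dist_scl_single: "dist_scl f (single g x) = single g (f * x)"
  by (rule poly_mapping_eqI) (simp add: lookup_dist_scl lookup_single when_def)

lemma dist_module: "module (dist_scl :: 'f::comm_ring_1 \<Rightarrow> ('k, 'f) dist \<Rightarrow> _)"
  by standard (auto intro!: poly_mapping_eqI simp: lookup_dist_scl lookup_add algebra_simps)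

interpretation dist: module "dist_scl :: 'f::comm_ring_1 \<Rightarrow> ('k, 'f) dist \<Rightarrow> _"
  by (rule dist_module)

lemma dist_scl_additive: "additive (dist_scl f)"
  by (simp add: additive_def dist.scale_right_distrib)

lemma dist_of_pw_additive: "additive (dist_of_pw :: ('k, 'f::comm_ring_1) pw \<Rightarrow> _)"
  unfolding dist_of_pw_def by (rule pm_sum_additive) (rule additive_single)

lemma dist_of_pw_single:
  "dist_of_pw (single h f) = single (dgen_of_heavi h) f"
  unfolding dist_of_pw_def by (simp add: pm_sum_single)

lemma lookup_dist_of_pw:
  fixes u :: "('a, 'b::comm_ring_1) pw"
  shows "lookup (dist_of_pw u) g
    = (case g of DOne \<Rightarrow> lookup u HOne
       | DH a k \<Rightarrow> if k = 0 then lookup u (Hv a) else 0)"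
proof (rule pm_additive_eqI)
  show "additive (\<lambda>u :: ('a, 'b) pw. lookup (dist_of_pw u) g)"
    by (rule additive_compose[OF lookup_additive dist_of_pw_additive])
  show "additive (\<lambda>u :: ('a, 'b) pw. case g of DOne \<Rightarrow> lookup u HOne
       | DH a k \<Rightarrow> if k = 0 then lookup u (Hv a) else 0)"
    by (cases g) (auto simp: additive_def lookup_add)
qed (auto simp: dist_of_pw_single lookup_single when_def split: dgen.split elim: dgen_of_heavi.elims)

context shifted_ida
begin

abbreviation dd where "dd \<equiv> dist_der A"

lemma dd_additive: "additive dd"
  unfolding dist_der_def
proof (rule pm_sum_additive)
  show "additive (dist_der_term A g)" for g
    by (cases g) (simp_all add: additive_def D_simps single_add)
qed

lemmas dd_simps = additive.add[OF dd_additive] additive.zero[OF dd_additive]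
  additive.diff[OF dd_additive]

lemma dd_single: "dd (single g f) = dist_der_term A g f"
proof -
  have "dist_der_term A g 0 = 0" by (cases g) (simp_all add: D_simps)
  then show ?thesis unfolding dist_der_def by (rule pm_sum_single)
qed

lemma lookup_dd:
  "lookup (dd p) g = D (lookup p g)
     + (case g of DH a (Suc k) \<Rightarrow> lookup p (DH a k) | _ \<Rightarrow> 0)"
proof (rule pm_additive_eqI)
  show "additive (\<lambda>p. lookup (dd p) g)"
    by (rule additive_compose[OF lookup_additive dd_additive])
  show "additive (\<lambda>p. D (lookup p g)
     + (case g of DH a (Suc k) \<Rightarrow> lookup p (DH a k) | _ \<Rightarrow> 0))"
    by (auto simp: additive_def lookup_add D_simps split: dgen.split nat.split)
  show "lookup (dd (single g' f)) g
     = D (lookup (single g' f) g)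
     + (case g of DH a (Suc k) \<Rightarrow> lookup (single g' f) (DH a k) | _ \<Rightarrow> 0)"
    for g' f
    by (cases g')
      (auto simp: dd_single lookup_single lookup_add when_def D_simps split: dgen.split nat.split)
qed

lemma dd_scl: "dd (dist_scl f p) = dist_scl (D f) p + dist_scl f (dd p)"
  by (rule poly_mapping_eqI)
    (auto simp: lookup_dd lookup_dist_scl lookup_add leibniz distrib_left split: dgen.split nat.split)

lemma lookup_dd_pow:
  "lookup ((dd ^^ i) p) DOne = (D ^^ i) (lookup p DOne)"
  "lookup ((dd ^^ i) p) (DH a 0) = (D ^^ i) (lookup p (DH a 0))"
  by (induction i) (simp_all add: lookup_dd)

text \<open>Testing against \<open>\<phi> \<in> F\<close> at the point \<open>a\<close>:
  \<open>\<langle>f \<delta>\<^sub>a\<^sup>(\<^sup>k\<^sup>), \<phi>\<rangle> = (-1)\<^sup>k (f \<phi>)\<^sup>(\<^sup>k\<^sup>)(a)\<close>.\<close>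

fun pair_term :: "'k \<Rightarrow> 'f \<Rightarrow> 'k dgen \<Rightarrow> 'f \<Rightarrow> 'k" where
  "pair_term a \<phi> DOne f = 0"
| "pair_term a \<phi> (DH b 0) f = 0"
| "pair_term a \<phi> (DH b (Suc k)) f = (if b = a then (-1) ^ k * e a ((D ^^ k) (f * \<phi>)) else 0)"

definition pair :: "'k \<Rightarrow> 'f \<Rightarrow> ('k, 'f) dist \<Rightarrow> 'k" where
  "pair a \<phi> = pm_sum (pair_term a \<phi>)"

lemma pair_term_additive: "additive (pair_term a \<phi> g)"
  unfolding additive_def
  by (intro allI; cases "(a, \<phi>, g, 0 :: 'f)" rule: pair_term.cases)
    (auto simp: distrib_left distrib_right D_pow_simps e_simps)

lemma pair_additive: "additive (pair a \<phi>)"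
  unfolding pair_def by (rule pm_sum_additive) (rule pair_term_additive)

lemmas pair_simps = additive.add[OF pair_additive] additive.zero[OF pair_additive]
  additive.diff[OF pair_additive] additive.sum[OF pair_additive]

lemma pair_single: "pair a \<phi> (single g f) = pair_term a \<phi> g f"
  unfolding pair_def by (rule pm_sum_single) (rule additive.zero[OF pair_term_additive])

lemma pair_dd: "pair a \<phi> (dd p) = e a (lookup p (DH a 0) * \<phi>) - pair a (D \<phi>) p"
proof (rule pm_additive_eqI)
  show "additive (\<lambda>p. pair a \<phi> (dd p))"
    by (rule additive_compose[OF pair_additive dd_additive])
  show "additive (\<lambda>p. e a (lookup p (DH a 0) * \<phi>) - pair a (D \<phi>) p)"
    by (simp add: additive_def lookup_add pair_simps e_simps distrib_right)
  fix g f
  show "pair a \<phi> (dd (single g f))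
      = e a (lookup (single g f) (DH a 0) * \<phi>)
        - pair a (D \<phi>) (single g f)"
  proof (cases g)
    case DOne
    then show ?thesis by (simp add: dd_single pair_single lookup_single e_simps)
  next
    case (DH b k)
    show ?thesis
    proof (cases k)
      case 0
      then show ?thesis
        by (simp add: DH dd_single pair_single pair_simps lookup_single when_def e_simps)
    next
      case (Suc j)
      then show ?thesis
        by (simp add: DH dd_single pair_single pair_simps lookup_single e_simps leibniz funpow_swap1
            D_pow_simps distrib_left)
    qed
  qed
qed

lemma pair_scl: "pair a \<phi> (dist_scl f p) = pair a (f * \<phi>) p"
proof (rule pm_additive_eqI[OF additive_compose[OF pair_additive dist_scl_additive] pair_additive])
  show "pair a \<phi> (dist_scl f (single g x)) = pair a (f * \<phi>) (single g x)" for g x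
    unfolding dist_scl_single pair_single
    by (cases "(a, \<phi>, g, 0 :: 'f)" rule: pair_term.cases) (auto simp: ac_simps)
qed

lemma pair_dist_of_pw: "pair a \<phi> (dist_of_pw u) = 0"
proof (rule pm_additive_eqI[OF additive_compose[OF pair_additive dist_of_pw_additive]])
  show "additive (\<lambda>u :: ('k, 'f) pw. 0 :: 'k)" by (simp add: additive_def)
  show "pair a \<phi> (dist_of_pw (single h f)) = 0" for h f
    by (cases h) (simp_all add: dist_of_pw_single pair_single)
qed

text \<open>Conditions that every consequence of the relations satisfies.\<close>

definition pure_delta :: "('k, 'f) dist \<Rightarrow> bool" where
  "pure_delta p \<longleftrightarrow> lookup p DOne = 0 \<and> (\<forall>a. lookup p (DH a 0) = 0)
     \<and> (\<forall>a \<phi>. pair a \<phi> p = 0)"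

lemma pure_delta_dd_pow: "pure_delta p \<Longrightarrow> pure_delta ((dd ^^ j) p)"
  by (induction j) (simp_all add: pure_delta_def lookup_dd pair_dd D_simps e_simps)

lemma span_relations_vanish:
  assumes "p \<in> dist.span (dist_relations A)"
  shows "pure_delta p"
  using assms
proof (induction rule: dist.span_induct_alt)
  case base
  show ?case by (simp add: pure_delta_def pair_simps)
next
  case (step c r p)
  then obtain j b f where r: "r = (dd ^^ j) (single (DH b 1) f
      - single (DH b 1) (\<kappa> (e b f)))"
    by (auto simp: dist_relations_def)
  have "pure_delta (single (DH b 1) f - single (DH b 1) (\<kappa> (e b f)))"
    by (auto simp: pure_delta_def lookup_minus lookup_single pair_simps pair_single e_mult)
  then have "pure_delta r" unfolding r by (rule pure_delta_dd_pow)
  then show ?case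
    using step.IH by (simp add: pure_delta_def lookup_add lookup_dist_scl pair_simps pair_scl)
qed

lemma span_relations_dd:
  assumes "p \<in> dist.span (dist_relations A)"
  shows "dd p \<in> dist.span (dist_relations A)"
  using assms
proof (induction rule: dist.span_induct_alt)
  case base
  show ?case by (simp add: dd_simps dist.span_zero)
next
  case (step c r p)
  then obtain j b f where r: "r = (dd ^^ j) (single (DH b 1) f
      - single (DH b 1) (\<kappa> (e b f)))"
    by (auto simp: dist_relations_def)
  have "dd r = (dd ^^ Suc j) (single (DH b 1) f
      - single (DH b 1) (\<kappa> (e b f)))"
    by (simp add: r)
  then have "dd r \<in> dist_relations A" unfolding dist_relations_def by blast
  with step show ?case
    by (simp add: dd_simps dd_scl dist.span_add dist.span_scale dist.span_base)
qed

lemma lookup_map_D: "lookup (Poly_Mapping.map (D ^^ i) u) h = (D ^^ i) (lookup u h)"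
  by (auto simp: Poly_Mapping.map.rep_eq when_def D_pow_simps)

text \<open>The delta terms created by differentiation are \<open>u\<^sub>a \<delta>\<^sub>a = u\<^sub>a(a) \<delta>\<^sub>a = 0\<close>.\<close>

lemma dd_dist_of_pw:
  assumes "\<And>a. e a (lookup u (Hv a)) = 0"
  shows "dd (dist_of_pw u) - dist_of_pw (Poly_Mapping.map D u) \<in> dist.span (dist_relations A)"
proof -
  define d where "d = dd (dist_of_pw u) - dist_of_pw (Poly_Mapping.map D u)"
  have lookup_d: "lookup d g = (case g of DH a (Suc 0) \<Rightarrow> lookup u (Hv a) | _ \<Rightarrow> 0)" for g
    using lookup_map_D[of 1 u]
    by (auto simp: d_def lookup_minus lookup_dd lookup_dist_of_pw D_simps split: dgen.split nat.split)
  have "single g (lookup d g) \<in> dist.span (dist_relations A)"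
    if "g \<in> keys d" for g
  proof -
    have "lookup d g \<noteq> 0" using that by (simp add: in_keys_iff)
    then obtain a where g: "g = DH a 1" "lookup d g = lookup u (Hv a)"
      using lookup_d[of g] by (auto split: dgen.splits nat.splits)
    have "(dd ^^ 0) (single (DH a 1) (lookup u (Hv a))
        - single (DH a 1) (\<kappa> (e a (lookup u (Hv a))))) \<in> dist_relations A"
      unfolding dist_relations_def by blast
    then show ?thesis
      using assms[of a] dist.span_base g(2) by (simp add: g(1))
  qed
  then have "(\<Sum>g\<in>keys d. single g (lookup d g))
      \<in> dist.span (dist_relations A)"
    by (rule dist.span_sum)
  then have "d \<in> dist.span (dist_relations A)"
    by (simp flip: pm_eq_sum_single)
  then show ?thesis by (simp add: d_def)
qed

text \<open>If the equation holds, comparing the coefficients of \<open>1\<close> and \<open>H\<^sub>a\<close> gives the first condition, and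
  testing the derivatives of \<open>\<delta>\<^sub>a\<close> gives the second by \<open>jets_of_impulse_response\<close> with \<open>r = 0\<close>.
  Conversely, as long as \<open>u\<^sub>a\<^sup>(\<^sup>i\<^sup>)(a) = 0\<close> the relation \<open>f \<delta>\<^sub>a = f(a) \<delta>\<^sub>a\<close> makes differentiation
  coefficientwise.\<close>

lemma diffop_dist_eq_iff:
  assumes lead: "coeff T (degree T) = 1"
  shows "dist_eq A (dist_diffop A T (dist_of_pw u)) (dist_of_pw f) \<longleftrightarrow>
    (\<forall>h. diffop A T (lookup u h) = lookup f h) \<and>
    (\<forall>a. \<forall>i<degree T. e a ((D ^^ i) (lookup u (Hv a))) = 0)"
    (is "?L \<longleftrightarrow> ?R")
proof
  let ?n = "degree T" and ?p = "dist_of_pw u"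
  assume ?L
  then have pd: "pure_delta (dist_diffop A T ?p - dist_of_pw f)"
    unfolding dist_eq_def by (rule span_relations_vanish)
  have "diffop A T (lookup u h) = lookup f h" for h
    using pd by (cases h) (auto simp: pure_delta_def lookup_minus dist_diffop_def lookup_sum
        lookup_dist_scl lookup_dd_pow lookup_dist_of_pw diffop_def)
  moreover have "e a ((D ^^ i) (lookup u (Hv a))) = 0" if i: "i < ?n" for a i
  proof -
    define l where "l i \<phi> = \<kappa> (pair a \<phi> ((dd ^^ i) ?p))" for i \<phi>
    have "\<kappa> (e a ((D ^^ i) (lookup u (Hv a)))) = (if i = ?n - 1 then 0 else 0)"
    proof (rule jets_of_impulse_response[OF point_e, where l = l and n = ?n and t = "coeff T" and r = 0
          and ?m0.0 = 0 and ?c0.0 = 0])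
      show "dop (\<lambda>f. \<kappa> (e a f)) 0 0 (l 0)"
        using dop_zero[of "\<lambda>f. \<kappa> (e a f)" 0] by (simp add: l_def[abs_def] pair_dist_of_pw)
      show "l (Suc i) \<phi> = \<kappa> (e a ((D ^^ i) (lookup u (Hv a)))) * \<kappa> (e a \<phi>) - l i (D \<phi>)" for i \<phi>
        by (simp add: l_def pair_dd lookup_dd_pow lookup_dist_of_pw const_diff const_mult e_mult)
      show "(\<Sum>i\<le>?n. l i (coeff T i * \<phi>)) = 0 * \<kappa> (e a \<phi>)" for \<phi>
      proof -
        have "pair a \<phi> (dist_diffop A T ?p - dist_of_pw f) = 0"
          using pd by (simp add: pure_delta_def)
        then have "(\<Sum>i\<le>?n. pair a (coeff T i * \<phi>) ((dd ^^ i) ?p)) = 0"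
          by (simp add: pair_simps pair_dist_of_pw dist_diffop_def pair_scl)
        then show ?thesis by (simp add: l_def flip: const_sum)
      qed
    qed (use lead i in auto)
    then show ?thesis using const_inj[of _ 0] by simp
  qed
  ultimately show ?R by blast
next
  let ?n = "degree T" and ?p = "dist_of_pw u" and ?S = "dist.span (dist_relations A)"
  assume R: ?R
  have pw: "(dd ^^ i) ?p - dist_of_pw (Poly_Mapping.map (D ^^ i) u) \<in> ?S" if "i \<le> ?n" for i
    using that
  proof (induction i)
    case 0
    have "Poly_Mapping.map (D ^^ 0) u = u"
      by (rule poly_mapping_eqI) (simp only: lookup_map_D, simp)
    then have "(dd ^^ 0) ?p - dist_of_pw (Poly_Mapping.map (D ^^ 0) u) = 0"
      by (simp del: funpow.simps)
    then show ?case by (metis dist.span_zero)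
  next
    case (Suc i)
    define w where "w = Poly_Mapping.map (D ^^ i) u"
    have "Poly_Mapping.map D w = Poly_Mapping.map (D ^^ Suc i) u"
      using lookup_map_D[of 1 w] lookup_map_D[of "Suc i" u] lookup_map_D[of i u]
      by (intro poly_mapping_eqI) (simp add: w_def)
    moreover have "dd (dist_of_pw w) - dist_of_pw (Poly_Mapping.map D w) \<in> ?S"
      by (rule dd_dist_of_pw) (use R Suc.prems in \<open>simp add: w_def lookup_map_D\<close>)
    moreover have "dd ((dd ^^ i) ?p - dist_of_pw w) \<in> ?S"
      using Suc by (simp add: w_def span_relations_dd)
    ultimately show ?case
      using dist.span_add[of "dd ((dd ^^ i) ?p - dist_of_pw w)" _
          "dd (dist_of_pw w) - dist_of_pw (Poly_Mapping.map D w)"]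
      by (simp add: dd_simps comp_def)
  qed
  have "dist_of_pw f = (\<Sum>i\<le>?n. dist_scl (coeff T i) (dist_of_pw (Poly_Mapping.map (D ^^ i) u)))"
    using R by (intro poly_mapping_eqI)
      (auto simp: lookup_sum lookup_dist_scl lookup_dist_of_pw lookup_map_D diffop_def split: dgen.split)
  then have "dist_diffop A T ?p - dist_of_pw f
      = (\<Sum>i\<le>?n. dist_scl (coeff T i) ((dd ^^ i) ?p - dist_of_pw (Poly_Mapping.map (D ^^ i) u)))"
    by (simp add: dist_diffop_def sum_subtractf dist.scale_right_diff_distrib)
  also have "\<dots> \<in> ?S"
    by (intro dist.span_sum dist.span_scale pw) simp
  finally show ?L by (simp add: dist_eq_def)
qed


section \<open>Integration and evaluation of piecewise functions\<close>

text \<open>For \<open>h = 1\<close> and \<open>h = H\<^sub>a\<close> alike, \<open>\<integral> g h = (hv_int h g) h + hv_const h g\<close>.\<close>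

definition hv_int :: "'k heavi \<Rightarrow> 'f \<Rightarrow> 'f" where
  "hv_int h = (case h of HOne \<Rightarrow> J | Hv a \<Rightarrow> itg_from A a)"

definition hv_const :: "'k heavi \<Rightarrow> 'f \<Rightarrow> 'k" where
  "hv_const h g = (case h of HOne \<Rightarrow> 0 | Hv a \<Rightarrow> Hbar a * e a (J g))"

lemma D_hv_int [simp]: "D (hv_int h g) = g"
  by (simp add: hv_int_def split: heavi.split)

lemma hv_int_additive: "additive (hv_int h)"
  by (simp add: hv_int_def J_additive itg_from_additive split: heavi.split)

lemma hv_int_cmult: "hv_int h (\<kappa> c * g) = \<kappa> c * hv_int h g"
  by (simp add: hv_int_def itg_from_def J_cmult e_cmult const_mult right_diff_distrib split: heavi.split)

lemma hv_const_additive: "additive (hv_const h)"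
  by (simp add: hv_const_def additive_def J_simps e_simps distrib_left split: heavi.split)

lemma hv_const_cmult: "hv_const h (\<kappa> c * g) = c * hv_const h g"
  by (simp add: hv_const_def J_cmult e_cmult split: heavi.split)

lemma J_mult_antiderivative: "D Q = \<phi> \<Longrightarrow> J (g * Q) = J g * Q - J (J g * \<phi>)"
  by (rule antiderivative_unique) (simp_all add: D_simps leibniz e_simps e_mult)

lemma hv_int_baxter: "hv_int h (g * hv_int h \<phi>) = J g * hv_int h \<phi> - hv_int h (J g * \<phi>)"
proof (cases h)
  case HOne
  then show ?thesis using J_mult_antiderivative[of "hv_int h \<phi>" \<phi> g] by (simp add: hv_int_def)
next
  case (Hv a)
  have "itg_from A a (g * Q) = J g * Q - itg_from A a (J g * \<phi>)" if "D Q = \<phi>" "e a Q = 0" for Q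
    by (simp add: itg_from_def J_mult_antiderivative[OF that(1)] e_simps e_mult that(2) const_minus)
  from this[of "itg_from A a \<phi>"] show ?thesis
    by (simp add: Hv hv_int_def e_itg_from)
qed

lemma hv_const_baxter: "hv_const h (g * hv_int h \<phi>) = - hv_const h (J g * \<phi>)"
proof (cases h)
  case (Hv a)
  have "e a (J (g * hv_int h \<phi>)) = - e a (J (J g * \<phi>))"
    using J_mult_antiderivative[of "hv_int h \<phi>" \<phi> g] e_itg_from[of a \<phi>]
    by (simp add: Hv hv_int_def e_simps e_mult)
  then show ?thesis by (simp add: hv_const_def Hv)
qed (simp add: hv_const_def)

abbreviation of_F :: "'f \<Rightarrow> ('k, 'f) pw" where
  "of_F \<equiv> single HOne"

lemma of_F_mult_single: "of_F g * single h f = single h (g * f)"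
  by (simp add: mult_single)

lemma lookup_of_F_mult: "lookup (of_F g * u) h = g * lookup u h"
  by (rule pm_additive_eqI[where f = "\<lambda>u. lookup (of_F g * u) h"])
    (auto simp: additive_def lookup_add distrib_left of_F_mult_single lookup_single when_def)

lemma pw_itg_additive: "additive (pw_itg A)"
  unfolding pw_itg_def
proof (rule pm_sum_additive)
  show "additive (pw_itg_term A h)" for h
    by (cases h) (auto simp: additive_def pw_const_def J_simps single_add additive.add[OF itg_from_additive]
        itg_between_0 e_simps distrib_left const_add)
qed

lemmas pw_itg_simps = additive.add[OF pw_itg_additive] additive.zero[OF pw_itg_additive]
  additive.diff[OF pw_itg_additive] additive.sum[OF pw_itg_additive]

lemma pw_itg_single:
  "pw_itg A (single h g) = single h (hv_int h g) + of_F (\<kappa> (hv_const h g))"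
proof -
  have "pw_itg_term A h x = single h (hv_int h x) + of_F (\<kappa> (hv_const h x))" for x
    by (cases h) (simp_all add: hv_int_def hv_const_def pw_const_def itg_between_0)
  moreover have "hv_int h 0 = 0" "hv_const h 0 = 0"
    by (rule additive.zero[OF hv_int_additive] additive.zero[OF hv_const_additive])+
  ultimately show ?thesis
    unfolding pw_itg_def by (subst pm_sum_single) simp_all
qed

lemma D_lookup_pw_itg: "D (lookup (pw_itg A p) h) = lookup p h"
  by (rule pm_additive_eqI[where f = "\<lambda>p. D (lookup (pw_itg A p) h)"])
    (auto simp: additive_def lookup_add pw_itg_simps D_simps pw_itg_single lookup_single when_def)

lemma e_lookup_pw_itg: "e a (lookup (pw_itg A p) (Hv a)) = 0"
  by (rule pm_additive_eqI[where f = "\<lambda>p. e a (lookup (pw_itg A p) (Hv a))"])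
    (auto simp: additive_def lookup_add pw_itg_simps e_simps pw_itg_single lookup_single when_def
      hv_int_def e_itg_from)

lemma pw_baxter:
  "pw_itg A (of_F g * pw_itg A p) = of_F (J g) * pw_itg A p - pw_itg A (of_F (J g) * p)"
proof (rule pm_additive_eqI[where f = "\<lambda>p. pw_itg A (of_F g * pw_itg A p)"])
  show "additive (\<lambda>p. pw_itg A (of_F g * pw_itg A p))"
    "additive (\<lambda>p. of_F (J g) * pw_itg A p - pw_itg A (of_F (J g) * p))"
    by (simp_all add: additive_def pw_itg_simps distrib_left)
  show "pw_itg A (of_F g * pw_itg A (single h \<phi>))
      = of_F (J g) * pw_itg A (single h \<phi>)
        - pw_itg A (of_F (J g) * single h \<phi>)" for h \<phi>
    by (simp add: pw_itg_single pw_itg_simps distrib_left of_F_mult_single hv_int_baxter hv_const_baxter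
        hv_int_def[of HOne] hv_const_def[of HOne] const_minus single_uminus
        single_diff mult.commute[of _ "\<kappa> _"] J_cmult)
qed

definition pw_evD :: "'k \<Rightarrow> nat \<Rightarrow> ('k, 'f) pw \<Rightarrow> 'k" where
  "pw_evD c i = pm_sum (\<lambda>h f. e c ((D ^^ i) f) * ev_heavi c h)"

lemma pw_evD_additive: "additive (pw_evD c i)"
  unfolding pw_evD_def
  by (rule pm_sum_additive) (simp add: additive_def D_pow_simps e_simps distrib_right)

lemmas pw_evD_simps = additive.add[OF pw_evD_additive] additive.zero[OF pw_evD_additive]
  additive.diff[OF pw_evD_additive] additive.sum[OF pw_evD_additive]

lemma pw_evD_single: "pw_evD c i (single h f) = e c ((D ^^ i) f) * ev_heavi c h"
  unfolding pw_evD_def by (subst pm_sum_single) (simp_all add: D_pow_simps e_simps)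

lemma pw_ev_eq: "pw_ev A c = pw_evD c 0"
  by (simp add: pw_ev_def pw_evD_def)

lemma pw_ev_additive: "additive (pw_ev A c)"
  by (simp add: pw_ev_eq pw_evD_additive)

lemmas pw_ev_simps = additive.add[OF pw_ev_additive] additive.zero[OF pw_ev_additive]
  additive.diff[OF pw_ev_additive] additive.sum[OF pw_ev_additive]

lemma pw_ev_single: "pw_ev A c (single h f) = e c f * ev_heavi c h"
  by (simp add: pw_ev_eq pw_evD_single)

lemma ev_heavi_HOne [simp]: "ev_heavi c HOne = 1"
  by (simp add: ev_heavi_def)

lemma pw_ev_of_F_mult: "pw_ev A c (of_F g * u) = e c g * pw_ev A c u"
  by (rule pm_additive_eqI[where f = "\<lambda>u. pw_ev A c (of_F g * u)"])
    (auto simp: additive_def pw_ev_simps distrib_left of_F_mult_single pw_ev_single e_mult)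

lemma dist_ev_dd: "dist_ev A c ((dd ^^ i) (dist_of_pw u)) = pw_evD c i u"
proof -
  define W where "W i = pm_sum (\<lambda>g f. dist_ev_term A c g ((D ^^ i) f))" for i
  have term_add: "additive (\<lambda>f. dist_ev_term A c g ((D ^^ i) f))" for g i
    unfolding additive_def
    by (intro allI; cases "(A, c, g, 0 :: 'f)" rule: dist_ev_term.cases)
      (auto simp: D_pow_simps e_simps distrib_right)
  have W_add: "additive (W i)" for i
    unfolding W_def by (rule pm_sum_additive) (rule term_add)
  have W_single: "W i (single g f) = dist_ev_term A c g ((D ^^ i) f)" for i g f
    unfolding W_def by (rule pm_sum_single) (rule additive.zero[OF term_add])
  have W_dd: "W i (dd p) = W (Suc i) p" for i p
  proof (rule pm_additive_eqI[OF additive_compose[OF W_add dd_additive] W_add])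
    show "W i (dd (single g f)) = W (Suc i) (single g f)" for g f
      by (cases "(A, c, g, 0 :: 'f)" rule: dist_ev_term.cases)
        (auto simp: dd_single W_single additive.add[OF W_add] funpow_swap1)
  qed
  have "W j ((dd ^^ i) p) = W (i + j) p" for i j p
    by (induction i arbitrary: j) (simp_all add: W_dd)
  from this[of 0 i] have "W 0 ((dd ^^ i) p) = W i p" for p by simp
  moreover have "dist_ev A c = W 0" by (simp add: dist_ev_def W_def)
  moreover have "W i (dist_of_pw u) = pw_evD c i u"
  proof (rule pm_additive_eqI[OF additive_compose[OF W_add dist_of_pw_additive] pw_evD_additive])
    show "W i (dist_of_pw (single h f)) = pw_evD c i (single h f)" for h f
      by (cases h) (simp_all add: dist_of_pw_single W_single pw_evD_single ev_heavi_def)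
  qed
  ultimately show ?thesis by simp
qed

definition points :: "('k, 'f) stieltjes \<Rightarrow> 'k set" where
  "points b = fst ` keys (fst b) \<union> keys (snd b)"

lemma finite_points: "finite (points b)"
  by (simp add: points_def)

definition order_less :: "nat \<Rightarrow> ('k, 'f) stieltjes \<Rightarrow> bool" where
  "order_less n b \<longleftrightarrow> (\<forall>(a, k)\<in>keys (fst b). k < n)"

text \<open>Sorting a Stieltjes condition by evaluation points, with the terms of order below \<open>n\<close> listed for
  each point.\<close>

lemma stieltjes_sum:
  fixes X :: "'k \<Rightarrow> nat \<Rightarrow> 'k" and Y :: "'k \<Rightarrow> 'f \<Rightarrow> 'k"
  assumes "order_less n b" and "\<And>a. Y a 0 = 0"
  shows "pm_sum (\<lambda>(a, i) c. c * X a i) (fst b) + pm_sum Y (snd b)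
    = (\<Sum>a\<in>points b. (\<Sum>k<n. lookup (fst b) (a, k) * X a k)
        + Y a (lookup (snd b) a))"
proof -
  have "keys (fst b) \<subseteq> points b \<times> {..<n}"
    using assms(1) by (auto simp: points_def order_less_def rev_image_eqI)
  then have "pm_sum (\<lambda>(a, i) c. c * X a i) (fst b)
      = (\<Sum>p\<in>points b \<times> {..<n}. case p of (a, i) \<Rightarrow> lookup (fst b) p * X a i)"
    by (subst pm_sum_superset[of "points b \<times> {..<n}"]) (auto simp: finite_points intro!: sum.cong)
  also have "\<dots> = (\<Sum>a\<in>points b. \<Sum>k<n. lookup (fst b) (a, k) * X a k)"
    by (subst sum.cartesian_product) (auto intro!: sum.cong)
  finally show ?thesis
    using pm_sum_superset[of "points b" "snd b" Y] assms(2) finite_points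
    by (simp add: sum.distrib points_def)
qed

lemma cond_eq:
  assumes "order_less n b"
  shows "cond A b f = (\<Sum>a\<in>points b. (\<Sum>k<n. lookup (fst b) (a, k) * e a ((D ^^ k) f))
      + e a (J (lookup (snd b) a * f)))"
  unfolding cond_def by (rule stieltjes_sum[OF assms]) (simp add: J_simps e_simps)

lemma cond_pw_eq:
  assumes "order_less n b"
  shows "cond_pw A b u = (\<Sum>a\<in>points b. (\<Sum>k<n. lookup (fst b) (a, k) * pw_evD a k u)
      + pw_ev A a (pw_itg A (of_F (lookup (snd b) a) * u)))"
  unfolding cond_pw_def dist_ev_dd
  by (rule stieltjes_sum[OF assms]) (simp add: pw_itg_simps pw_ev_simps)

lemma cond_pw_additive: "order_less n b \<Longrightarrow> additive (cond_pw A b)"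
  by (simp add: additive_def cond_pw_eq pw_evD_simps pw_ev_simps pw_itg_simps distrib_left sum.distrib
      algebra_simps)

lemma cond_pw_of_F: "order_less n b \<Longrightarrow> cond_pw A b (of_F f) = cond A b f"
  by (simp add: cond_pw_eq cond_eq pw_evD_single of_F_mult_single pw_itg_single pw_ev_simps pw_ev_single
      hv_int_def hv_const_def)

end

section \<open>Solutions with piecewise forcing function\<close>

context shifted_ida
begin

lemma op_ideal_uminus: "p \<in> op_ideal A \<Longrightarrow> - p \<in> op_ideal A"
  using op_ideal.left[of p A "-1"] by simp

lemma op_eq_refl: "op_eq A p p"
  by (simp add: op_eq_def op_ideal.zero)

lemma op_eq_sym: "op_eq A p q \<Longrightarrow> op_eq A q p"
  using op_ideal_uminus[of "p - q"] by (simp add: op_eq_def)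

lemma op_eq_add: "op_eq A p q \<Longrightarrow> op_eq A p' q' \<Longrightarrow> op_eq A (p + p') (q + q')"
  using op_ideal.add[of "p - q" A "p' - q'"] by (simp add: op_eq_def algebra_simps)

lemma op_eq_trans [trans]: "op_eq A p q \<Longrightarrow> op_eq A q r \<Longrightarrow> op_eq A p r"
  using op_ideal.add[of "p - q" A "q - r"] by (simp add: op_eq_def)

lemma op_eq_mult: "op_eq A p q \<Longrightarrow> op_eq A p' q' \<Longrightarrow> op_eq A (p * p') (q * q')"
  using op_ideal.add[OF op_ideal.right[of "p - q" A p'] op_ideal.left[of "p' - q'" A q]]
  by (simp add: op_eq_def algebra_simps)

lemma op_eq_mult_left: "op_eq A p q \<Longrightarrow> op_eq A (r * p) (r * q)"
  by (rule op_eq_mult[OF op_eq_refl])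

lemma op_eq_mult_right: "op_eq A p q \<Longrightarrow> op_eq A (p * r) (q * r)"
  by (rule op_eq_mult[OF _ op_eq_refl])

lemma op_eq_sum: "(\<And>i. i \<in> I \<Longrightarrow> op_eq A (p i) (q i)) \<Longrightarrow> op_eq A (\<Sum>i\<in>I. p i) (\<Sum>i\<in>I. q i)"
  by (induction I rule: infinite_finite_induct) (simp_all add: op_eq_refl op_eq_add)

lemma op_eq_relations:
  "op_eq A (op_fun (f + g)) (op_fun f + op_fun g)"
  "op_eq A (op_fun f * op_fun g) (op_fun (f * g))"
  "op_eq A (op_fun (\<kappa> c)) (op_scalar c)"
  "op_eq A (op_der * op_fun f) (op_fun f * op_der + op_fun (D f))"
  "op_eq A (op_der * op_int) 1"
  "op_eq A (op_der * op_ev a) 0"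
proof -
  have "op_eq A (op_fun (f * g)) (op_fun f * op_fun g)"
    unfolding op_eq_def by (rule op_ideal.rel) (unfold op_relations_def, blast)
  then show "op_eq A (op_fun f * op_fun g) (op_fun (f * g))" by (rule op_eq_sym)
  show "op_eq A (op_der * op_ev a) 0"
    unfolding op_eq_def diff_zero by (rule op_ideal.rel) (unfold op_relations_def, blast)
qed (unfold op_eq_def, (rule op_ideal.rel, unfold op_relations_def, blast)+)

lemma op_fun_0: "op_eq A (op_fun 0) 0"
  using op_eq_relations(3)[of 0] by (simp add: op_scalar_def)

lemma op_fun_1: "op_eq A (op_fun 1) 1"
  using op_eq_relations(3)[of 1] by (simp add: op_scalar_def)

lemma op_fun_sum: "op_eq A (\<Sum>i\<in>I. op_fun (f i)) (op_fun (\<Sum>i\<in>I. f i))"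
proof (induction I rule: infinite_finite_induct)
  case (insert i I)
  then show ?case
    using op_eq_trans[OF op_eq_add[OF op_eq_refl insert.IH] op_eq_sym[OF op_eq_relations(1)]] by simp
qed (simp_all add: op_eq_sym[OF op_fun_0])

lemma op_diffop_fun_sum:
  "op_eq A (\<Sum>i\<le>degree T. op_fun (coeff T i) * (op_fun ((D ^^ i) f) * X)) (op_fun (diffop A T f) * X)"
proof -
  have "op_eq A (\<Sum>i\<le>degree T. op_fun (coeff T i) * op_fun ((D ^^ i) f)) (op_fun (diffop A T f))"
    unfolding diffop_def
    by (rule op_eq_trans[OF op_eq_sum op_fun_sum]) (rule op_eq_relations(2))
  from op_eq_mult_right[OF this, of X] show ?thesis
    by (simp add: sum_distrib_right mult.assoc)
qed

text \<open>\<open>\<partial>\<close> passes through \<open>f e\<^sub>a\<close> by differentiating \<open>f\<close> only, since \<open>\<partial> e\<^sub>a = 0\<close>.\<close>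

lemma op_diffop_fun_ev:
  assumes "diffop A T f = 0"
  shows "op_eq A (op_of_diffop T * (op_fun f * (op_ev a * X))) 0"
proof -
  have step: "op_eq A (op_der * (op_fun g * (op_ev a * X))) (op_fun (D g) * (op_ev a * X))" for g
  proof -
    have "op_eq A (op_der * op_fun g * (op_ev a * X)) ((op_fun g * op_der + op_fun (D g)) * (op_ev a * X))"
      by (rule op_eq_mult_right[OF op_eq_relations(4)])
    moreover have "op_eq A (op_fun g * (op_der * op_ev a) * X + op_fun (D g) * (op_ev a * X))
        (op_fun g * 0 * X + op_fun (D g) * (op_ev a * X))"
      by (intro op_eq_add op_eq_mult_right op_eq_mult_left op_eq_relations(6) op_eq_refl)
    ultimately show ?thesis
      using op_eq_trans by (simp add: distrib_right mult.assoc)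
  qed
  have pow: "op_eq A (op_der ^ i * (op_fun f * (op_ev a * X))) (op_fun ((D ^^ i) f) * (op_ev a * X))" for i
  proof (induction i)
    case (Suc i)
    show ?case
      using op_eq_trans[OF op_eq_mult_left[OF Suc, of op_der] step] by (simp add: mult.assoc)
  qed (simp add: op_eq_refl)
  have "op_eq A (op_of_diffop T * (op_fun f * (op_ev a * X)))
      (\<Sum>i\<le>degree T. op_fun (coeff T i) * (op_fun ((D ^^ i) f) * (op_ev a * X)))"
    unfolding op_of_diffop_def sum_distrib_right mult.assoc
    by (intro op_eq_sum op_eq_mult_left pow)
  also have "op_eq A \<dots> (op_fun (diffop A T f) * (op_ev a * X))"
    by (rule op_diffop_fun_sum)
  also have "op_eq A \<dots> (0 * (op_ev a * X))"
    unfolding assms by (rule op_eq_mult_right[OF op_fun_0])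
  finally show ?thesis by simp
qed

lemma of_F_mult: "of_F (x * y) = of_F x * of_F y"
  by (simp add: of_F_mult_single)

lemma pw_itg_cmult: "pw_itg A (of_F (\<kappa> c) * p) = of_F (\<kappa> c) * pw_itg A p"
  by (rule pm_additive_eqI[where f = "\<lambda>p. pw_itg A (of_F (\<kappa> c) * p)"])
    (auto simp: additive_def pw_itg_simps distrib_left of_F_mult_single pw_itg_single hv_int_cmult
      hv_const_cmult const_mult)

lemma integral_op_pw_cong:
  assumes "op_eq A (op_of_integral_op gs) (op_of_integral_op gs')"
  shows "integral_op_pw A gs f = integral_op_pw A gs' f"
proof -
  define W where "W v = pw_itg A (of_F v * f)" for v
  define B where "B s u v = of_F u * (case s of None \<Rightarrow> W v | Some a \<Rightarrow> pw_const A (pw_ev A a (W v)))"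
    for s u v
  have of_F_add: "of_F (x + y) = of_F x + of_F y" for x y by (rule single_add)
  have W_add: "W (x + y) = W x + W y" for x y
    by (simp add: W_def of_F_add distrib_right pw_itg_simps)
  have W_cmult: "W (\<kappa> c * x) = of_F (\<kappa> c) * W x" for c x
    unfolding W_def of_F_mult mult.assoc by (rule pw_itg_cmult)
  have pc: "pw_const A (c * d) = of_F (\<kappa> c) * pw_const A d"
    "pw_const A (c + d) = pw_const A c + pw_const A d" for c d
    by (simp_all add: pw_const_def const_mult const_add of_F_add of_F_mult)
  have "balanced (B s)" for s
    by (cases s) (simp_all add: balanced_def B_def additive_def of_F_add W_add W_cmult of_F_mult
        pc pw_ev_simps pw_ev_of_F_mult distrib_left distrib_right mult.assoc mult.left_commute)
  moreover have "pw_ev A 0 (pw_itg A p) = 0" for p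
    by (rule pm_additive_eqI[where f = "\<lambda>p. pw_ev A 0 (pw_itg A p)"])
      (auto simp: additive_def pw_itg_simps pw_ev_simps pw_itg_single pw_ev_single hv_int_def hv_const_def
        ev_heavi_def itg_from_def e_simps split: heavi.split)
  then have "B (Some 0) u v = 0" for u v
    by (simp add: B_def W_def pw_const_def)
  ultimately have "(\<Sum>(u, s, v)\<leftarrow>gs. B s u v) = (\<Sum>(u, s, v)\<leftarrow>gs'. B s u v)"
    by (rule balanced_sums_cong[OF assms])
  then show ?thesis unfolding integral_op_pw_def Let_def B_def W_def .
qed

end

locale well_posed_system = fundamental_system +
  assumes wellp: "well_posed T bs"
begin

lemma order_less_bs: "i < n \<Longrightarrow> order_less n (bs ! i)"
  using wellp length_bs by (auto simp: well_posed_def order_less_def)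

definition variation :: "('a, 'b) pw \<Rightarrow> ('a, 'b) pw" where
  "variation f = (\<Sum>j<n. of_F (z j) * pw_itg A (of_F (v j) * f))"

lemma variation_additive: "additive variation"
  by (simp add: variation_def additive_def distrib_left pw_itg_simps sum.distrib)

lemma lookup_variation:
  "lookup (variation f) h = (\<Sum>j<n. z j * lookup (pw_itg A (of_F (v j) * f)) h)"
  by (simp add: variation_def lookup_sum lookup_of_F_mult)

text \<open>The element with \<open>\<beta>(\<Sum>j. z\<^sub>j \<integral> v\<^sub>j f) = \<Sum>a. e\<^sub>a \<integral> (density \<beta> a) f\<close>; see \<open>cond_pw_variation\<close>.\<close>

definition density :: "('a, 'b) stieltjes \<Rightarrow> 'a \<Rightarrow> 'b" where
  "density b a = (let w = lookup (snd b) a in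
     \<Sum>j<n. \<kappa> ((\<Sum>k<n. lookup (fst b) (a, k) * e a ((D ^^ k) (z j))) + e a (J (w * z j))) * v j
       - v j * J (w * z j))"

lemma pw_evD_variation:
  assumes "k < n"
  shows "pw_evD a k (variation f) = (\<Sum>j<n. e a ((D ^^ k) (z j)) * pw_ev A a (pw_itg A (of_F (v j) * f)))"
proof (rule pm_additive_eqI[where f = "\<lambda>f. pw_evD a k (variation f)"])
  show "additive (\<lambda>f. pw_evD a k (variation f))"
    by (rule additive_compose[OF pw_evD_additive variation_additive])
  show "additive (\<lambda>f. \<Sum>j<n. e a ((D ^^ k) (z j)) * pw_ev A a (pw_itg A (of_F (v j) * f)))"
    by (simp add: additive_def distrib_left pw_itg_simps pw_ev_simps sum.distrib)
  fix h \<phi>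
  let ?H = "\<lambda>j. hv_int h (v j * \<phi>)" and ?c = "\<lambda>j. hv_const h (v j * \<phi>)"
  have eq: "variation (single h \<phi>)
      = single h (\<Sum>j<n. z j * ?H j) + (\<Sum>j<n. of_F (z j * \<kappa> (?c j)))"
    by (simp add: variation_def of_F_mult_single pw_itg_single distrib_left sum.distrib
        additive.sum[OF additive_single])
  have "pw_evD a k (variation (single h \<phi>))
      = e a ((D ^^ k) (\<Sum>j<n. z j * ?H j)) * ev_heavi a h + (\<Sum>j<n. ?c j * e a ((D ^^ k) (z j)))"
    by (simp add: eq pw_evD_simps pw_evD_single mult.commute[of _ "\<kappa> _"] D_pow_cmult e_cmult)
  also have "(D ^^ k) (\<Sum>j<n. z j * ?H j) = (\<Sum>j<n. (D ^^ k) (z j) * ?H j)"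
    by (rule variation_of_constants(1)[OF _ assms]) simp
  also have "e a \<dots> * ev_heavi a h + (\<Sum>j<n. ?c j * e a ((D ^^ k) (z j)))
      = (\<Sum>j<n. e a ((D ^^ k) (z j)) * pw_ev A a (pw_itg A (of_F (v j) * single h \<phi>)))"
  proof -
    have "pw_ev A a (pw_itg A (of_F (v j) * single h \<phi>)) = e a (?H j) * ev_heavi a h + ?c j" for j
      by (simp add: of_F_mult_single pw_itg_single pw_ev_simps pw_ev_single)
    then show ?thesis
      by (simp add: e_simps e_mult sum_distrib_right sum_distrib_left sum.distrib distrib_left ac_simps)
  qed
  finally show "pw_evD a k (variation (single h \<phi>))
      = (\<Sum>j<n. e a ((D ^^ k) (z j)) * pw_ev A a (pw_itg A (of_F (v j) * single h \<phi>)))" .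
qed

text \<open>In local terms \<open>\<partial>\<^sup>k\<close> with \<open>k < n\<close> acts on the \<open>z\<^sub>j\<close> only; in global terms the Baxter rule
  \<open>\<integral> g \<integral> = (\<integral>g) \<integral> - \<integral> (\<integral>g)\<close> with \<open>g = w z\<^sub>j\<close> removes the nested integral.\<close>

lemma cond_pw_variation:
  assumes "order_less n b"
  shows "cond_pw A b (variation f) = (\<Sum>a\<in>points b. pw_ev A a (pw_itg A (of_F (density b a) * f)))"
  unfolding cond_pw_eq[OF assms]
proof (rule sum.cong[OF refl])
  fix a
  define w where "w = lookup (snd b) a"
  define l where "l k = lookup (fst b) (a, k)" for k
  define y where "y j = pw_itg A (of_F (v j) * f)" for j
  have "(\<Sum>k<n. l k * pw_evD a k (variation f)) = (\<Sum>j<n. (\<Sum>k<n. l k * e a ((D ^^ k) (z j))) * pw_ev A a (y j))"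
    by (simp add: pw_evD_variation y_def sum_distrib_left sum_distrib_right mult.assoc)
      (rule sum.swap)
  moreover have "pw_ev A a (pw_itg A (of_F w * variation f))
      = (\<Sum>j<n. e a (J (w * z j)) * pw_ev A a (y j) - pw_ev A a (pw_itg A (of_F (v j * J (w * z j)) * f)))"
  proof -
    have "pw_itg A (of_F w * variation f) = (\<Sum>j<n. pw_itg A (of_F (w * z j) * y j))"
      by (simp add: variation_def y_def sum_distrib_left pw_itg_simps of_F_mult mult.assoc)
    also have "\<dots> = (\<Sum>j<n. of_F (J (w * z j)) * y j - pw_itg A (of_F (v j * J (w * z j)) * f))"
      unfolding y_def pw_baxter by (simp add: of_F_mult ac_simps)
    finally show ?thesis by (simp add: pw_ev_simps pw_ev_of_F_mult)
  qed
  moreover have "pw_ev A a (pw_itg A (of_F (density b a) * f))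
      = (\<Sum>j<n. ((\<Sum>k<n. l k * e a ((D ^^ k) (z j))) + e a (J (w * z j))) * pw_ev A a (y j)
          - pw_ev A a (pw_itg A (of_F (v j * J (w * z j)) * f)))"
  proof -
    have "of_F (density b a) * f
      = (\<Sum>j<n. of_F (\<kappa> ((\<Sum>k<n. l k * e a ((D ^^ k) (z j))) + e a (J (w * z j)))) * (of_F (v j) * f)
        - of_F (v j * J (w * z j)) * f)"
      by (simp add: density_def Let_def l_def w_def additive.sum[OF additive_single] single_diff of_F_mult
          sum_distrib_right left_diff_distrib mult.assoc)
    then show ?thesis
      by (simp add: pw_itg_simps pw_ev_simps pw_itg_cmult pw_ev_of_F_mult y_def)
  qed
  ultimately show "(\<Sum>k<n. l k * pw_evD a k (variation f)) + pw_ev A a (pw_itg A (of_F w * variation f))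
      = pw_ev A a (pw_itg A (of_F (density b a) * f))"
    by (simp add: sum.distrib sum_subtractf distrib_right)
qed

definition solution :: "('a, 'b) pw \<Rightarrow> ('a, 'b) pw" where
  "solution f = variation f - (\<Sum>i<n. of_F (\<kappa> (cond_pw A (bs ! i) (variation f)) * z i))"

lemma solves_iff:
  "solves A T bs f u \<longleftrightarrow>
    (\<forall>h. Tact (lookup u h) = lookup f h) \<and>
    (\<forall>a. \<forall>i<n. e a ((D ^^ i) (lookup u (Hv a))) = 0) \<and>
    (\<forall>i<n. cond_pw A (bs ! i) u = 0)"
  unfolding solves_def diffop_dist_eq_iff[OF coeff_n]
  by (simp add: all_set_conv_all_nth length_bs)

lemma lookup_solution:
  "lookup (solution f) h = lookup (variation f) h
    - (if h = HOne then \<Sum>i<n. \<kappa> (cond_pw A (bs ! i) (variation f)) * z i else 0)"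
  by (simp add: solution_def lookup_minus lookup_sum lookup_single when_def)

lemma solves_solution: "solves A T bs f (solution f)"
  unfolding solves_iff
proof (intro conjI allI impI)
  have Q: "D (lookup (pw_itg A (of_F (v j) * f)) h) = v j * lookup f h" for j h
    by (simp add: D_lookup_pw_itg lookup_of_F_mult)
  have "Tact (lookup (variation f) h) = lookup f h" for h
    unfolding lookup_variation by (rule variation_of_constants(2)) (rule Q)
  then show "Tact (lookup (solution f) h) = lookup f h" for h
    by (simp add: lookup_solution diffop_simps diffop_cmult Tz)
  show "e a ((D ^^ i) (lookup (solution f) (Hv a))) = 0" if "i < n" for a i
  proof -
    have "(D ^^ i) (lookup (variation f) h)
        = (\<Sum>j<n. (D ^^ i) (z j) * lookup (pw_itg A (of_F (v j) * f)) h)" for h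
      unfolding lookup_variation by (rule variation_of_constants(1)[OF _ that]) (rule Q)
    then show ?thesis
      by (simp add: lookup_solution e_simps e_mult e_lookup_pw_itg)
  qed
  show "cond_pw A (bs ! i) (solution f) = 0" if "i < n" for i
  proof -
    note add = cond_pw_additive[OF order_less_bs[OF that]]
    have "cond_pw A (bs ! i) (solution f) = cond_pw A (bs ! i) (variation f)
        - (\<Sum>j<n. cond_pw A (bs ! j) (variation f) * \<beta> i (z j))"
      by (simp add: solution_def additive.diff[OF add] additive.sum[OF add]
          cond_pw_of_F[OF order_less_bs[OF that]] \<beta>_simps)
    also have "(\<Sum>j<n. cond_pw A (bs ! j) (variation f) * \<beta> i (z j))
        = (\<Sum>j<n. if j = i then cond_pw A (bs ! i) (variation f) else 0)"
      by (rule sum.cong) (use that \<beta>z in auto)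
    finally show ?thesis using that by simp
  qed
qed

lemma solution_unique:
  assumes "solves A T bs f u" "solves A T bs f u'"
  shows "u = u'"
proof -
  define d where "d = u - u'"
  have d: "Tact (lookup d h) = 0" "i < n \<Longrightarrow> e a ((D ^^ i) (lookup d (Hv a))) = 0"
    "i < n \<Longrightarrow> cond_pw A (bs ! i) d = 0" for h i a
    using assms unfolding solves_iff d_def
    by (simp_all add: lookup_minus diffop_simps D_pow_simps e_simps
        additive.diff[OF cond_pw_additive[OF order_less_bs]])
  have Hv: "lookup d (Hv a) = 0" for a
    by (rule zero_of_initial_values[of _ a]) (simp_all add: d)
  have "d = of_F (lookup d HOne)"
  proof (rule poly_mapping_eqI)
    show "lookup d h = lookup (of_F (lookup d HOne)) h" for h
      by (cases h) (simp_all add: Hv lookup_single)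
  qed
  moreover from this have "\<beta> i (lookup d HOne) = 0" if "i < n" for i
    using d(3)[OF that] cond_pw_of_F[OF order_less_bs[OF that]] by metis
  then have "lookup d HOne = 0"
    using zero_of_kernel_orth[of "lookup d HOne"] d(1) by blast
  ultimately show ?thesis by (simp add: d_def)
qed

definition points_list :: "('a, 'b) stieltjes \<Rightarrow> 'a list" where
  "points_list b = (SOME xs. set xs = points b \<and> distinct xs)"

lemma points_list: "set (points_list b) = points b" "distinct (points_list b)"
  using someI_ex[OF finite_distinct_list[OF finite_points[of b]]] by (auto simp: points_list_def)

text \<open>The operator \<open>(1 - \<Sum>i. z\<^sub>i \<beta>\<^sub>i) (\<Sum>j. z\<^sub>j \<integral> v\<^sub>j)\<close>, written out.\<close>

definition greens_list :: "('a, 'b) integral_op" where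
  "greens_list = map (\<lambda>j. (z j, None, v j)) [0..<n] @
     concat (map (\<lambda>i. map (\<lambda>a. (- z i, Some a, density (bs ! i) a)) (points_list (bs ! i))) [0..<n])"

lemma sum_upt: "(\<Sum>i\<leftarrow>[0..<m]. F i) = (\<Sum>i<m. F i :: 'x::comm_monoid_add)"
  by (induction m) (simp_all add: add.commute)

lemma sum_greens_list:
  fixes F :: "'b \<Rightarrow> 'a option \<Rightarrow> 'b \<Rightarrow> 'x::comm_monoid_add"
  shows "(\<Sum>(u, s, v)\<leftarrow>greens_list. F u s v) = (\<Sum>j<n. F (z j) None (v j))
    + (\<Sum>i<n. \<Sum>a\<in>points (bs ! i). F (- z i) (Some a) (density (bs ! i) a))"
proof -
  have "(\<Sum>(u, s, v)\<leftarrow>concat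
        (map (\<lambda>i. map (\<lambda>a. (- z i, Some a, density (bs ! i) a)) (points_list (bs ! i))) is). F u s v)
      = (\<Sum>i\<leftarrow>is. \<Sum>a\<leftarrow>points_list (bs ! i). F (- z i) (Some a) (density (bs ! i) a))" for "is"
    by (induction "is") (simp_all add: comp_def)
  then show ?thesis
    by (simp add: greens_list_def comp_def sum_upt sum_list_distinct_conv_sum_set points_list)
qed

lemma integral_op_pw_greens_list: "integral_op_pw A greens_list f = solution f"
proof -
  have neg: "of_F (- x) = - of_F x" for x by (rule single_uminus)
  have "integral_op_pw A greens_list f = variation f
      - (\<Sum>i<n. \<Sum>a\<in>points (bs ! i).
          of_F (z i) * of_F (\<kappa> (pw_ev A a (pw_itg A (of_F (density (bs ! i) a) * f)))))"
    unfolding integral_op_pw_def sum_greens_list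
    by (simp add: variation_def pw_const_def neg sum_negf)
  also have "\<dots> = variation f - (\<Sum>i<n. of_F (\<kappa> (cond_pw A (bs ! i) (variation f)) * z i))"
  proof -
    have "of_F (\<kappa> (cond_pw A (bs ! i) (variation f)) * z i)
        = (\<Sum>a\<in>points (bs ! i). of_F (z i) * of_F (\<kappa> (pw_ev A a (pw_itg A (of_F (density (bs ! i) a) * f)))))"
      if "i < n" for i
      unfolding cond_pw_variation[OF order_less_bs[OF that]] mult.commute[of "\<kappa> _"]
      by (simp add: const_sum sum_distrib_left additive.sum[OF additive_single] of_F_mult)
    then show ?thesis by simp
  qed
  finally show ?thesis by (simp add: solution_def)
qed

lemma op_act_greens_list: "of_F (op_act A (op_of_integral_op greens_list) f) = solution (of_F f)"
proof -
  have "base.rep (op_fun u * (case s of None \<Rightarrow> 1 | Some a \<Rightarrow> op_ev a) * op_int * op_fun w) f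
      = u * (case s of None \<Rightarrow> J (w * f) | Some a \<Rightarrow> \<kappa> (e a (J (w * f))))" for u s w
    by (cases s) (simp_all add: base.rep_mult base.rep_letter base.rep_1)
  moreover have "additive (\<lambda>P. base.rep P f)" by (rule base.rep_additive) simp
  ultimately have "op_act A (op_of_integral_op gs) f
      = (\<Sum>(u, s, w)\<leftarrow>gs. u * (case s of None \<Rightarrow> J (w * f) | Some a \<Rightarrow> \<kappa> (e a (J (w * f)))))" for gs
    unfolding op_act_eq_rep op_of_integral_op_def
    by (subst additive_sum_list[where f = "\<lambda>P. base.rep P f"]) (auto simp: case_prod_unfold)
  moreover have "integral_op_pw A gs (of_F f)
      = of_F (\<Sum>(u, s, w)\<leftarrow>gs. u * (case s of None \<Rightarrow> J (w * f) | Some a \<Rightarrow> \<kappa> (e a (J (w * f)))))" for gs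
  proof -
    have "(let w = pw_itg A (of_F w * of_F f) in case s of None \<Rightarrow> w | Some a \<Rightarrow> pw_const A (pw_ev A a w))
        = of_F (case s of None \<Rightarrow> J (w * f) | Some a \<Rightarrow> \<kappa> (e a (J (w * f))))" for s w
      by (cases s) (simp_all add: of_F_mult_single pw_itg_single hv_int_def hv_const_def
          pw_ev_single pw_const_def)
    then show ?thesis
      unfolding integral_op_pw_def
      by (subst additive_sum_list[OF additive_single]) (simp add: case_prod_unfold of_F_mult)
  qed
  ultimately show ?thesis using integral_op_pw_greens_list[of "of_F f"] by simp
qed

lemma solves_of_F: "solves A T bs (of_F f) (of_F u) \<longleftrightarrow> Tact u = f \<and> (\<forall>i<n. \<beta> i u = 0)"
proof -
  have "(\<forall>h. Tact (lookup (of_F u) h) = lookup (of_F f) h) \<longleftrightarrow> Tact u = f"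
    by (auto simp: lookup_single when_def diffop_simps)
  moreover have "(\<forall>i<n. cond_pw A (bs ! i) (of_F u) = 0) \<longleftrightarrow> (\<forall>i<n. \<beta> i u = 0)"
    using cond_pw_of_F[OF order_less_bs] by simp
  ultimately show ?thesis
    unfolding solves_iff by (simp add: lookup_single D_pow_simps e_simps)
qed

lemma range_greens_list: "range (op_act A (op_of_integral_op greens_list)) = orth A bs"
proof -
  have orth: "g \<in> orth A bs \<longleftrightarrow> (\<forall>i<n. \<beta> i g = 0)" for g
    by (simp add: orth_def all_set_conv_all_nth length_bs)
  let ?G = "op_act A (op_of_integral_op greens_list)"
  have sol: "solves A T bs (of_F f) (of_F (?G f))" for f
    unfolding op_act_greens_list by (rule solves_solution)
  have "?G f \<in> orth A bs" for f
    using sol by (simp add: solves_of_F orth)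
  moreover have "g = ?G (Tact g)" if "g \<in> orth A bs" for g
  proof -
    have "of_F g = of_F (?G (Tact g))"
      by (rule solution_unique[OF _ sol]) (use that in \<open>simp add: solves_of_F orth\<close>)
    then show ?thesis by (metis lookup_single_eq)
  qed
  ultimately show ?thesis by blast
qed

text \<open>Variation of constants inside the operator ring; the terms with \<open>e\<^sub>a\<close> begin with an element of
  \<open>ker T\<close> and are annihilated by \<open>T\<close>.\<close>

lemma op_eq_greens_list: "op_eq A (op_of_diffop T * op_of_integral_op greens_list) 1"
proof -
  define I :: "nat \<Rightarrow> ('a, 'b) oper" where "I j = op_int * op_fun (v j)" for j
  \<comment> \<open>\<open>Y k\<close> represents \<open>\<partial>\<^sup>k \<Sum>j. z\<^sub>j \<integral> v\<^sub>j\<close> for \<open>k < n\<close>.\<close>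
  define Y :: "nat \<Rightarrow> ('a, 'b) oper" where "Y k = (\<Sum>j<n. op_fun ((D ^^ k) (z j)) * I j)" for k
  have step: "op_eq A (op_der * Y k) (Y (Suc k) + (if k = n - 1 then 1 else 0))" if "k < n" for k
  proof -
    have "op_eq A (op_der * op_fun f * (op_int * X)) (op_fun (D f) * (op_int * X) + op_fun f * X)" for f X
    proof -
      have "op_eq A (op_der * op_fun f * (op_int * X)) ((op_fun f * op_der + op_fun (D f)) * (op_int * X))"
        by (rule op_eq_mult_right[OF op_eq_relations(4)])
      moreover have "op_eq A (op_fun (D f) * (op_int * X) + op_fun f * (op_der * op_int) * X)
          (op_fun (D f) * (op_int * X) + op_fun f * 1 * X)"
        by (intro op_eq_add op_eq_mult_right op_eq_mult_left op_eq_relations(5) op_eq_refl)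
      ultimately show ?thesis
        using op_eq_trans by (simp add: distrib_right mult.assoc add.commute)
    qed
    then have "op_eq A (op_der * (op_fun f * (op_int * op_fun g)))
        (op_fun (D f) * (op_int * op_fun g) + op_fun (f * g))" for f g
      using op_eq_trans[OF _ op_eq_add[OF op_eq_refl op_eq_relations(2)]] by (simp add: mult.assoc)
    then have "op_eq A (op_der * Y k)
        (\<Sum>j<n. op_fun ((D ^^ Suc k) (z j)) * I j + op_fun ((D ^^ k) (z j) * v j))"
      unfolding Y_def I_def sum_distrib_left by (intro op_eq_sum) simp
    also have "\<dots> = Y (Suc k) + (\<Sum>j<n. op_fun ((D ^^ k) (z j) * v j))"
      by (simp only: sum.distrib Y_def)
    also have "op_eq A \<dots> (Y (Suc k) + op_fun (if k = n - 1 then 1 else 0))"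
      using op_fun_sum[of "\<lambda>j. (D ^^ k) (z j) * v j" "{..<n}"] zv[OF that]
      by (intro op_eq_add op_eq_refl) simp
    also have "op_eq A \<dots> (Y (Suc k) + (if k = n - 1 then 1 else 0))"
      by (intro op_eq_add op_eq_refl) (simp add: op_fun_0 op_fun_1)
    finally show ?thesis .
  qed
  have low: "op_eq A (op_der ^ k * Y 0) (Y k)" if "k < n" for k
    using that
  proof (induction k)
    case (Suc k)
    then have "op_eq A (op_der * (op_der ^ k * Y 0)) (Y (Suc k) + (if k = n - 1 then 1 else 0))"
      by (intro op_eq_trans[OF op_eq_mult_left step]) auto
    moreover have "k \<noteq> n - 1" using Suc.prems by linarith
    ultimately show ?case by (simp add: mult.assoc)
  qed (simp add: op_eq_refl)
  have top: "op_eq A (op_der ^ n * Y 0) (Y n + 1)"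
  proof -
    obtain m where m: "n = Suc m" using pos by (cases n) auto
    show ?thesis
      using op_eq_trans[OF op_eq_mult_left[OF low[of m]] step[of m]] by (simp add: m mult.assoc)
  qed
  have "op_eq A (op_of_diffop T * Y 0) (\<Sum>k\<le>n. op_fun (coeff T k) * (Y k + (if k = n then 1 else 0)))"
    unfolding op_of_diffop_def sum_distrib_right mult.assoc
  proof (intro op_eq_sum op_eq_mult_left)
    show "op_eq A (op_der ^ k * Y 0) (Y k + (if k = n then 1 else 0))" if "k \<in> {..n}" for k
      using low[of k] top that by (cases "k = n") simp_all
  qed
  also have "\<dots> = (\<Sum>j<n. \<Sum>k\<le>n. op_fun (coeff T k) * (op_fun ((D ^^ k) (z j)) * I j)) + op_fun 1"
  proof -
    have "(\<Sum>k\<le>n. op_fun (coeff T k) * (if k = n then 1 else 0 :: ('a, 'b) oper))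
        = (\<Sum>k\<le>n. if k = n then op_fun 1 else 0)"
      by (rule sum.cong) (auto simp: coeff_n)
    moreover have "(\<Sum>k\<le>n. op_fun (coeff T k) * Y k)
        = (\<Sum>j<n. \<Sum>k\<le>n. op_fun (coeff T k) * (op_fun ((D ^^ k) (z j)) * I j))"
      unfolding Y_def sum_distrib_left by (rule sum.swap)
    ultimately show ?thesis by (simp add: distrib_left sum.distrib)
  qed
  also have "op_eq A \<dots> ((\<Sum>j<n. 0) + 1)"
  proof (intro op_eq_add op_eq_sum op_fun_1)
    fix j assume "j \<in> {..<n}"
    then have "op_eq A (\<Sum>k\<le>n. op_fun (coeff T k) * (op_fun ((D ^^ k) (z j)) * I j))
        (op_fun 0 * I j)"
      using op_diffop_fun_sum[of T "z j" "I j"] Tz by simp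
    also have "op_eq A \<dots> (0 * I j)"
      by (rule op_eq_mult_right[OF op_fun_0])
    finally show "op_eq A (\<Sum>k\<le>n. op_fun (coeff T k) * (op_fun ((D ^^ k) (z j)) * I j)) 0"
      by simp
  qed
  finally have TY: "op_eq A (op_of_diffop T * Y 0) 1" by simp
  define E :: "('a, 'b) oper" where "E = (\<Sum>i<n. \<Sum>a\<in>points (bs ! i).
      op_fun (- z i) * (op_ev a * (op_int * op_fun (density (bs ! i) a))))"
  have "op_eq A (op_of_diffop T * E) (\<Sum>i<n. \<Sum>a\<in>points (bs ! i). 0)"
    unfolding E_def sum_distrib_left
    by (intro op_eq_sum op_diffop_fun_ev) (simp add: diffop_simps Tz)
  then have "op_eq A (op_of_diffop T * Y 0 + op_of_diffop T * E) (1 + 0)"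
    by (intro op_eq_add TY) simp
  moreover have "op_of_integral_op greens_list = Y 0 + E"
    unfolding op_of_integral_op_def sum_greens_list by (simp add: Y_def I_def E_def mult.assoc)
  ultimately show ?thesis by (simp add: distrib_left)
qed

lemma greens_equations_greens_list: "greens_equations A T bs (op_of_integral_op greens_list)"
  by (simp add: greens_equations_def op_eq_greens_list range_greens_list)

end

section \<open>Bivariate piecewise functions\<close>

lemma mono2_zero: "(0 :: ('k::linordered_field, 'f::comm_ring_1) mono2) = Mono 1 1 HOne HOne False"
  by (simp add: zero_mono2_def zero_heavi_def)

lemma heavi_add_HOne [simp]: "h + HOne = h" "HOne + h = (h :: 'k::linorder heavi)"
  by (cases h; simp)+

lemmas pw2_gens = fun_x_def fun_xi_def heavi_x_def heavi_xi_def Hhat_def pw2_const_def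

lemma pw2_mult:
  "fun_x f * fun_x g = (fun_x (f * g) :: ('k::linordered_field, 'f::comm_ring_1) pw2)"
  "fun_xi f * fun_xi g = (fun_xi (f * g) :: ('k, 'f) pw2)"
  "heavi_x h * heavi_x k = (heavi_x (h + k) :: ('k, 'f) pw2)"
  "heavi_xi h * heavi_xi k = (heavi_xi (h + k) :: ('k, 'f) pw2)"
  "Hhat * Hhat = (Hhat :: ('k, 'f) pw2)"
  by (simp_all add: pw2_gens mult_single zero_heavi_def)

lemma pw2_one:
  "fun_x 1 = (1 :: ('k::linordered_field, 'f::comm_ring_1) pw2)"
  "fun_xi 1 = (1 :: ('k, 'f) pw2)"
  "heavi_x HOne = (1 :: ('k, 'f) pw2)" "heavi_xi HOne = (1 :: ('k, 'f) pw2)"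
  "pw2_const 1 = (1 :: ('k, 'f) pw2)"
  by (simp_all add: pw2_gens mono2_zero[symmetric] zero_heavi_def)

lemma pw2_const_simps:
  "pw2_const (a + b) = (pw2_const a + pw2_const b :: ('k::linordered_field, 'f::comm_ring_1) pw2)"
  "pw2_const (a - b) = (pw2_const a - pw2_const b :: ('k, 'f) pw2)"
  "pw2_const (a * b) = (pw2_const a * pw2_const b :: ('k, 'f) pw2)"
  "pw2_const 0 = (0 :: ('k, 'f) pw2)"
  by (simp_all add: pw2_const_def single_add single_diff mult_single)

text \<open>Every monomial is the product of its factors, so that computations can be done with generators.\<close>

lemma single_Mono:
  "single (Mono f g h k b) r
    = pw2_const r * fun_x f * fun_xi g * heavi_x h * heavi_xi k * (if b then Hhat else 1)"
  by (simp add: pw2_gens mult_single mono2_zero zero_heavi_def)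

lemma pwx_closed:
  "p \<in> pwx_algebra \<Longrightarrow> q \<in> pwx_algebra \<Longrightarrow> p + q \<in> pwx_algebra"
  "p \<in> pwx_algebra \<Longrightarrow> - p \<in> pwx_algebra"
  "p \<in> pwx_algebra \<Longrightarrow> q \<in> pwx_algebra \<Longrightarrow> p - q \<in> pwx_algebra"
  "p \<in> pwx_algebra \<Longrightarrow> q \<in> pwx_algebra \<Longrightarrow> p * q \<in> pwx_algebra"
  "fun_x f \<in> pwx_algebra" "heavi_x h \<in> pwx_algebra" "pw2_const c \<in> pwx_algebra"
  "0 \<in> pwx_algebra" "1 \<in> pwx_algebra"
proof -
  show add: "p + q \<in> pwx_algebra" if "p \<in> pwx_algebra" "q \<in> pwx_algebra" for p q :: "('a, 'b) pw2"
    using that Poly_Mapping.keys_add[of p q] by (auto simp: pwx_algebra_def)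
  show minus: "- p \<in> pwx_algebra" if "p \<in> pwx_algebra" for p :: "('a, 'b) pw2"
    using that by (simp add: pwx_algebra_def in_keys_iff)
  show "p - q \<in> pwx_algebra" if "p \<in> pwx_algebra" "q \<in> pwx_algebra" for p q :: "('a, 'b) pw2"
    using add[OF that(1) minus[OF that(2)]] by simp
  show "p * q \<in> pwx_algebra" if pq: "p \<in> pwx_algebra" "q \<in> pwx_algebra" for p q :: "('a, 'b) pw2"
    unfolding pwx_algebra_def
  proof (intro CollectI ballI)
    fix m assume "m \<in> keys (p * q)"
    then obtain a b where m: "m = a + b" "a \<in> keys p" "b \<in> keys q"
      using keys_mult[of p q] by blast
    then have "\<exists>f g h. a = Mono f g h 0 False" "\<exists>f g h. b = Mono f g h 0 False"
      using pq by (simp_all add: pwx_algebra_def)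
    then obtain f g h f' g' h' where "a = Mono f g h 0 False" "b = Mono f' g' h' 0 False"
      by (elim exE)
    then show "\<exists>f g h. m = Mono f g h 0 False" by (simp add: m)
  qed
qed (auto simp: pwx_algebra_def pw2_gens mono2_zero zero_heavi_def split: if_splits)

lemma pw2_module: "module ((*) :: ('k::linordered_field, 'f::comm_ring_1) pw2 \<Rightarrow> _)"
  by standard (auto simp: algebra_simps)

context shifted_ida
begin

definition vanishing :: "'k \<Rightarrow> 'k \<Rightarrow> ('k, 'f) pw2 set" where
  "vanishing \<alpha> \<beta> = {p. equal_on A \<alpha> \<beta> p 0}"

lemma vanishing_iff: "p \<in> vanishing \<alpha> \<beta> \<longleftrightarrow> (\<exists>r\<in>pwx_algebra. \<exists>s\<in>pwx_algebra.
    p - (r * (1 - Hx \<alpha>) + s * Hx \<beta>) \<in> module.span (*) (pw2_relations A))"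
  by (simp add: vanishing_def equal_on_def pw2_eq_def)

lemma equal_on_iff: "equal_on A \<alpha> \<beta> p q \<longleftrightarrow> p - q \<in> vanishing \<alpha> \<beta>"
  by (simp add: vanishing_def equal_on_def)

lemma vanishing_add: "p \<in> vanishing \<alpha> \<beta> \<Longrightarrow> q \<in> vanishing \<alpha> \<beta> \<Longrightarrow> p + q \<in> vanishing \<alpha> \<beta>"
proof -
  assume "p \<in> vanishing \<alpha> \<beta>" "q \<in> vanishing \<alpha> \<beta>"
  then obtain r s r' s' where rs: "r \<in> pwx_algebra" "s \<in> pwx_algebra" "r' \<in> pwx_algebra" "s' \<in> pwx_algebra"
    and *: "p - (r * (1 - Hx \<alpha>) + s * Hx \<beta>) \<in> module.span (*) (pw2_relations A)"
      "q - (r' * (1 - Hx \<alpha>) + s' * Hx \<beta>) \<in> module.span (*) (pw2_relations A)"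
    unfolding vanishing_iff by blast
  have "p + q - ((r + r') * (1 - Hx \<alpha>) + (s + s') * Hx \<beta>)
      = (p - (r * (1 - Hx \<alpha>) + s * Hx \<beta>)) + (q - (r' * (1 - Hx \<alpha>) + s' * Hx \<beta>))"
    by (simp add: distrib_right)
  also have "\<dots> \<in> module.span (*) (pw2_relations A)" by (rule module.span_add[OF pw2_module *])
  finally show ?thesis unfolding vanishing_iff using rs pwx_closed(1) by blast
qed

lemma vanishing_mult: "p \<in> vanishing \<alpha> \<beta> \<Longrightarrow> c \<in> pwx_algebra \<Longrightarrow> c * p \<in> vanishing \<alpha> \<beta>"
proof -
  assume "p \<in> vanishing \<alpha> \<beta>" and c: "c \<in> pwx_algebra"
  then obtain r s where rs: "r \<in> pwx_algebra" "s \<in> pwx_algebra"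
    and *: "p - (r * (1 - Hx \<alpha>) + s * Hx \<beta>) \<in> module.span (*) (pw2_relations A)"
    unfolding vanishing_iff by blast
  have "c * p - ((c * r) * (1 - Hx \<alpha>) + (c * s) * Hx \<beta>) = c * (p - (r * (1 - Hx \<alpha>) + s * Hx \<beta>))"
    by (simp add: right_diff_distrib distrib_left mult.assoc)
  also have "\<dots> \<in> module.span (*) (pw2_relations A)" by (rule module.span_scale[OF pw2_module *])
  finally show ?thesis unfolding vanishing_iff using rs c pwx_closed(4) by blast
qed

lemma vanishing_relation:
  assumes "p \<in> pw2_relations A"
  shows "c * p \<in> vanishing \<alpha> \<beta>"
proof -
  have "c * p - (0 * (1 - Hx \<alpha>) + 0 * Hx \<beta>) \<in> module.span (*) (pw2_relations A)"
    using module.span_scale[OF pw2_module module.span_base[OF pw2_module assms]] by simp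
  then show ?thesis unfolding vanishing_iff using pwx_closed(8) by blast
qed

lemma vanishing_0: "0 \<in> vanishing \<alpha> \<beta>"
  unfolding vanishing_iff using pwx_closed(8)
  by (auto intro!: bexI[of _ 0] simp: module.span_zero[OF pw2_module])

lemma vanishing_uminus: "p \<in> vanishing \<alpha> \<beta> \<Longrightarrow> - p \<in> vanishing \<alpha> \<beta>"
  using vanishing_mult[of p \<alpha> \<beta> "- 1"] pwx_closed(2)[OF pwx_closed(9)] by simp

lemma vanishing_diff: "p \<in> vanishing \<alpha> \<beta> \<Longrightarrow> q \<in> vanishing \<alpha> \<beta> \<Longrightarrow> p - q \<in> vanishing \<alpha> \<beta>"
  using vanishing_add[OF _ vanishing_uminus, of p \<alpha> \<beta> q] by simp

lemma vanishing_sum: "(\<And>i. i \<in> I \<Longrightarrow> p i \<in> vanishing \<alpha> \<beta>) \<Longrightarrow> (\<Sum>i\<in>I. p i) \<in> vanishing \<alpha> \<beta>"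
  by (induction I rule: infinite_finite_induct) (simp_all add: vanishing_0 vanishing_add)

lemma vanishing_sum_list:
  "(\<And>x. x \<in> set xs \<Longrightarrow> p x \<in> vanishing \<alpha> \<beta>) \<Longrightarrow> (\<Sum>x\<leftarrow>xs. p x) \<in> vanishing \<alpha> \<beta>"
  by (induction xs) (simp_all add: vanishing_0 vanishing_add)

lemma vanishing_left:
  assumes "a \<le> \<alpha>"
  shows "1 - Hx a \<in> vanishing \<alpha> \<beta>"
proof -
  have "Hx a * Hx \<alpha> = (Hx \<alpha> :: ('k, 'f) pw2)" using assms by (simp add: pw2_mult max_def)
  then have "1 - Hx a - ((1 - Hx a) * (1 - Hx \<alpha>) + 0 * Hx \<beta>) = (0 :: ('k, 'f) pw2)"
    by (simp add: algebra_simps)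
  then show ?thesis unfolding vanishing_iff
    using pwx_closed(3)[OF pwx_closed(9) pwx_closed(6)[of "Hv a"]] pwx_closed(8)
      module.span_zero[OF pw2_module] by metis
qed

lemma vanishing_right:
  assumes "\<beta> \<le> a"
  shows "Hx a \<in> vanishing \<alpha> \<beta>"
proof -
  have "Hx a * Hx \<beta> = (Hx a :: ('k, 'f) pw2)" using assms by (simp add: pw2_mult max_def)
  then have "Hx a - (0 * (1 - Hx \<alpha>) + Hx a * Hx \<beta>) = (0 :: ('k, 'f) pw2)" by simp
  then show ?thesis unfolding vanishing_iff
    using pwx_closed(6)[of "Hv a"] pwx_closed(8) module.span_zero[OF pw2_module] by metis
qed

lemma vanishing_fun_x:
  "fun_x (f + g) - (fun_x f + fun_x g) \<in> vanishing \<alpha> \<beta>"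
  "fun_x (\<kappa> c * f) - pw2_const c * fun_x f \<in> vanishing \<alpha> \<beta>"
  "fun_x (\<kappa> c) - pw2_const c \<in> vanishing \<alpha> \<beta>"
  "fun_x 0 \<in> vanishing \<alpha> \<beta>"
  "fun_x (f - \<kappa> c) - (fun_x f - pw2_const c) \<in> vanishing \<alpha> \<beta>"
proof -
  have "fun_x (f + g) - (fun_x f + fun_x g) \<in> pw2_relations A" for f g
    unfolding pw2_relations_def by blast
  from vanishing_relation[OF this, of 1]
  show add: "fun_x (f + g) - (fun_x f + fun_x g) \<in> vanishing \<alpha> \<beta>" for f g by simp
  have "fun_x (scl A c f) - pw2_const c * fun_x f \<in> pw2_relations A" for c f
    unfolding pw2_relations_def by blast
  from vanishing_relation[OF this, of 1]
  show scale: "fun_x (\<kappa> c * f) - pw2_const c * fun_x f \<in> vanishing \<alpha> \<beta>" for c f by (simp add: scl_eq)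
  from this[of _ 1] show const: "fun_x (\<kappa> c) - pw2_const c \<in> vanishing \<alpha> \<beta>" for c
    by (simp add: pw2_one)
  from this[of 0] show "fun_x 0 \<in> vanishing \<alpha> \<beta>" by (simp add: pw2_const_simps)
  show "fun_x (f - \<kappa> c) - (fun_x f - pw2_const c) \<in> vanishing \<alpha> \<beta>"
  proof -
    have "fun_x (f - \<kappa> c) - (fun_x f - pw2_const c)
      = - (fun_x (f - \<kappa> c + \<kappa> c) - (fun_x (f - \<kappa> c) + fun_x (\<kappa> c))) - (fun_x (\<kappa> c) - pw2_const c)"
      by (simp add: algebra_simps)
    then show ?thesis using vanishing_diff[OF vanishing_uminus[OF add] const] by metis
  qed
qed

lemma vanishing_pw_x_single: "pw_x (single h f) - fun_x f * heavi_x h \<in> vanishing \<alpha> \<beta>"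
proof (cases "f = 0")
  case True
  then show ?thesis
    using vanishing_uminus[OF vanishing_mult[OF vanishing_fun_x(4) pwx_closed(6)]]
    by (simp add: pw_x_def pm_sum_def mult.commute)
next
  case False
  then show ?thesis by (simp add: pw_x_def pm_sum_def vanishing_0)
qed

lemma vanishing_pw_x_add: "pw_x (p + r) - (pw_x p + pw_x r) \<in> vanishing \<alpha> \<beta>"
proof -
  define S where "S = keys p \<union> keys r"
  define X where "X p = (\<Sum>h\<in>S. fun_x (lookup p h) * heavi_x h)" for p :: "('k, 'f) pw"
  have X: "X p' - pw_x p' \<in> vanishing \<alpha> \<beta>" if "p' \<in> {p, r, p + r}" for p'
  proof -
    have sub: "keys p' \<subseteq> S" using that Poly_Mapping.keys_add[of p r] by (auto simp: S_def)
    have "X p' = (\<Sum>h\<in>S - keys p'. fun_x (lookup p' h) * heavi_x h) + pw_x p'"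
      unfolding X_def pw_x_def pm_sum_def by (rule sum.subset_diff[OF sub]) (simp add: S_def)
    moreover have "fun_x (lookup p' h) * heavi_x h \<in> vanishing \<alpha> \<beta>"
      if "h \<in> S - keys p'" for h
      using that vanishing_mult[OF vanishing_fun_x(4)[of \<alpha> \<beta>] pwx_closed(6)[of h]]
      by (simp add: in_keys_iff mult.commute)
    ultimately show ?thesis using vanishing_sum by (metis (no_types, lifting) add_diff_cancel_right')
  qed
  have "X (p + r) - (X p + X r) \<in> vanishing \<alpha> \<beta>"
  proof -
    have "X (p + r) - (X p + X r) = (\<Sum>h\<in>S. heavi_x h * (fun_x (lookup p h + lookup r h)
        - (fun_x (lookup p h) + fun_x (lookup r h))))"
      by (simp add: X_def lookup_add sum_subtractf sum.distrib algebra_simps)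
    then show ?thesis using vanishing_sum[OF vanishing_mult[OF vanishing_fun_x(1) pwx_closed(6)]] by simp
  qed
  from vanishing_add[OF vanishing_diff[OF this X[of "p + r"]] vanishing_add[OF X[of p] X[of r]]]
  show ?thesis by (simp add: algebra_simps)
qed

lemma vanishing_pw_x_sum:
  "pw_x (\<Sum>i\<in>I. p i) - (\<Sum>i\<in>I. pw_x (p i)) \<in> vanishing \<alpha> \<beta>"
proof (induction I rule: infinite_finite_induct)
  case (insert i I)
  then show ?case
    using vanishing_add[OF insert.IH vanishing_pw_x_add[of "p i" "\<Sum>i\<in>I. p i"]] by (simp add: algebra_simps)
qed (simp_all add: pw_x_def pm_sum_def vanishing_0)

lemma vanishing_pw_x_sum_list:
  "pw_x (\<Sum>x\<leftarrow>xs. p x) - (\<Sum>x\<leftarrow>xs. pw_x (p x)) \<in> vanishing \<alpha> \<beta>"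
proof (induction xs)
  case (Cons x xs)
  then show ?case
    using vanishing_add[OF Cons.IH vanishing_pw_x_add[of "p x" "\<Sum>x\<leftarrow>xs. p x"]] by (simp add: algebra_simps)
qed (simp add: pw_x_def pm_sum_def vanishing_0)

lemma vanishing_fun_x_sum_list:
  "fun_x (\<Sum>x\<leftarrow>xs. f x) - (\<Sum>x\<leftarrow>xs. fun_x (f x)) \<in> vanishing \<alpha> \<beta>"
proof (induction xs)
  case (Cons x xs)
  then show ?case
    using vanishing_add[OF Cons.IH vanishing_fun_x(1)[of "f x" "\<Sum>x\<leftarrow>xs. f x"]] by (simp add: algebra_simps)
qed (simp add: vanishing_fun_x)

lemma ev_heavi_add: "ev_heavi c (h + k) = ev_heavi c h * ev_heavi c k"
  by (cases h; cases k) (auto simp: ev_heavi_def Hbar_def max_def)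

lemma xi_ev_mono_add: "xi_ev_mono A c (m + m') = xi_ev_mono A c m * xi_ev_mono A c m'"
proof (cases m; cases m')
  fix f g h k b f' g' h' k' b'
  assume m: "m = Mono f g h k b" "m' = Mono f' g' h' k' b'"
  have HH: "Hx c * Hx c = (Hx c :: ('k, 'f) pw2)" by (simp add: pw2_mult)
  then have HH': "Hx c * (Hx c * y) = Hx c * (y :: ('k, 'f) pw2)" for y
    by (simp flip: mult.assoc)
  show ?thesis
    by (cases b; cases b')
      (simp_all add: m e_mult ev_heavi_add pw2_const_simps HH HH' ac_simps flip: pw2_mult(1,3))
qed

lemma xi_ev_additive: "additive (xi_ev A c)"
  unfolding xi_ev_def by (rule pm_sum_additive) (simp add: additive_def pw2_const_simps distrib_right)

lemmas xi_ev_simps = additive.add[OF xi_ev_additive] additive.zero[OF xi_ev_additive]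
  additive.diff[OF xi_ev_additive] additive.sum[OF xi_ev_additive]

lemma xi_ev_single: "xi_ev A c (single m r) = pw2_const r * xi_ev_mono A c m"
  unfolding xi_ev_def by (rule pm_sum_single) (simp add: pw2_const_simps)

text \<open>Evaluation at \<open>\<xi> = c\<close> is multiplicative already on representatives, because \<open>H\<^sub>c(x)\<close> is
  idempotent like \<open>H(x - \<xi>)\<close>.\<close>

lemma xi_ev_mult: "xi_ev A c (p * r) = xi_ev A c p * xi_ev A c r"
proof (induction p rule: pm_induct)
  case (add m s p)
  have "xi_ev A c (single m s * r) = xi_ev A c (single m s) * xi_ev A c r"
  proof (induction r rule: pm_induct)
    case (add m' s' r)
    then show ?case
      by (simp add: distrib_left xi_ev_simps mult_single xi_ev_single xi_ev_mono_add pw2_const_simps ac_simps)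
  qed (simp add: xi_ev_simps)
  with add show ?case by (simp add: distrib_right xi_ev_simps)
qed (simp add: xi_ev_simps)

lemma xi_ev_gens:
  "xi_ev A c (fun_x f) = fun_x f" "xi_ev A c (fun_xi g) = pw2_const (e c g)"
  "xi_ev A c (heavi_x h) = heavi_x h" "xi_ev A c (heavi_xi h) = pw2_const (ev_heavi c h)"
  "xi_ev A c (pw2_const r) = pw2_const r" "xi_ev A c Hhat = Hx c"
proof -
  note [simp] = xi_ev_single zero_heavi_def pw2_one
  show "xi_ev A c (fun_x f) = fun_x f" by (subst fun_x_def) simp
  show "xi_ev A c (fun_xi g) = pw2_const (e c g)" by (subst fun_xi_def) simp
  show "xi_ev A c (heavi_x h) = heavi_x h" by (subst heavi_x_def) simp
  show "xi_ev A c (heavi_xi h) = pw2_const (ev_heavi c h)" by (subst heavi_xi_def) simp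
  show "xi_ev A c (pw2_const r) = pw2_const r" by (subst pw2_const_def) (simp add: mono2_zero)
  show "xi_ev A c Hhat = Hx c" by (subst Hhat_def) simp
qed

lemma xi_itg_additive: "additive (xi_itg A)"
  unfolding xi_itg_def by (rule pm_sum_additive) (simp add: additive_def pw2_const_simps distrib_right)

lemmas xi_itg_simps = additive.add[OF xi_itg_additive] additive.zero[OF xi_itg_additive]
  additive.diff[OF xi_itg_additive] additive.sum[OF xi_itg_additive]

lemma xi_itg_single: "xi_itg A (single m 1) = xi_itg_mono A m"
  unfolding xi_itg_def by (subst pm_sum_single) (simp_all add: pw2_const_simps pw2_one)

lemma xi_between_additive: "additive (xi_itg_between A \<alpha> \<beta>)"
  by (simp add: additive_def xi_itg_between_def xi_itg_simps xi_ev_simps)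

lemmas xi_between_simps = additive.add[OF xi_between_additive] additive.zero[OF xi_between_additive]
  additive.diff[OF xi_between_additive] additive.sum[OF xi_between_additive]

text \<open>The value at \<open>c\<close> of \<open>\<integral> g h\<close>.\<close>

definition primitive :: "'k \<Rightarrow> 'k heavi \<Rightarrow> 'f \<Rightarrow> 'k" where
  "primitive c h g = e c (hv_int h g) * ev_heavi c h + hv_const h g"

lemma primitive_eq: "primitive c h g = pw_ev A c (pw_itg A (single h g))"
  by (simp add: primitive_def pw_itg_single pw_ev_simps pw_ev_single)

lemma primitive_HOne: "primitive c HOne g = e c (J g)"
  by (simp add: primitive_def hv_int_def hv_const_def)

lemma primitive_Hv: "primitive c (Hv a) g = (if a \<le> c then e c (J g) - e a (J g) else 0) + hv_const (Hv a) g"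
  by (simp add: primitive_def hv_int_def itg_from_def e_simps ev_heavi_def Hbar_def)

lemma primitive_0: "primitive 0 h g = 0"
  by (cases h) (simp_all add: primitive_HOne primitive_Hv hv_const_def Hbar_def)

lemma primitive_additive: "additive (primitive c h)"
  by (simp add: primitive_def additive_def additive.add[OF hv_int_additive] additive.add[OF hv_const_additive]
      e_simps distrib_right)

lemma primitive_cmult: "primitive c h (\<kappa> d * g) = d * primitive c h g"
  by (simp add: primitive_def hv_int_cmult hv_const_cmult e_cmult distrib_left mult.assoc)

text \<open>\<open>\<integral>\<^sub>\<alpha>\<^sup>\<beta> g h H\<^sub>c = \<integral>\<^sub>c\<^sup>\<beta> g h\<close>.\<close>

lemma primitive_restrict:
  assumes "\<alpha> \<le> c" "c \<le> \<beta>"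
  shows "primitive \<beta> (Hv c + h) g - primitive \<alpha> (Hv c + h) g = primitive \<beta> h g - primitive c h g"
  using assms by (cases h) (auto simp: primitive_HOne primitive_Hv max_def)

lemma xi_itg_basis_eq:
  "xi_itg_basis A g h = fun_xi (hv_int h g) * heavi_xi h + pw2_const (hv_const h g)"
  by (cases h) (simp_all add: hv_int_def hv_const_def itg_between_0 pw2_one pw2_const_simps)

lemma xi_ev_basis: "xi_ev A c (xi_itg_basis A g h) = pw2_const (primitive c h g)"
  by (simp add: xi_itg_basis_eq xi_ev_simps xi_ev_mult xi_ev_gens primitive_def pw2_const_simps)

lemma xi_between_False:
  "xi_itg_between A \<alpha> \<beta> (fun_x u * fun_xi g * heavi_xi h)
    = fun_x u * pw2_const (primitive \<beta> h g - primitive \<alpha> h g)"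
proof -
  have "fun_x u * fun_xi g * heavi_xi h = single (Mono u g HOne h False) (1 :: 'k)"
    by (simp add: single_Mono pw2_one)
  then show ?thesis
    by (simp add: xi_itg_between_def xi_itg_single xi_ev_mult xi_ev_gens xi_ev_basis pw2_one
        pw2_const_simps right_diff_distrib)
qed

lemma xi_ev_hat:
  "xi_ev A c (xi_itg_hat A g) = (pw2_const (e c (J g)) - fun_x (J g)) * Hx c + fun_x (J g) * Hx 0"
  by (simp add: xi_itg_hat_def xi_ev_simps xi_ev_mult xi_ev_gens)

text \<open>For \<open>x\<close> in \<open>[\<alpha>, \<beta>]\<close> the factor \<open>H(x - \<xi>)\<close> cuts \<open>\<integral>\<^sub>\<alpha>\<^sup>\<beta>\<close> down to the integral from \<open>\<alpha>\<close> to \<open>x\<close>.\<close>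

lemma xi_between_True:
  assumes "\<alpha> \<le> \<beta>"
  shows "xi_itg_between A \<alpha> \<beta> (fun_x u * fun_xi g * heavi_xi h * Hhat)
      - fun_x u * (fun_x (hv_int h g) * heavi_x h + pw2_const (hv_const h g) - pw2_const (primitive \<alpha> h g))
    \<in> vanishing \<alpha> \<beta>"
proof -
  let ?X = "fun_x (J g) :: ('k, 'f) pw2" and ?c = "pw2_const :: _ \<Rightarrow> ('k, 'f) pw2"
  let ?G = "\<lambda>c. e c (J g)"
  have m: "fun_x u * fun_xi g * heavi_xi h * Hhat = single (Mono u g HOne h True) (1 :: 'k)"
    by (simp add: single_Mono pw2_one)
  note vl = vanishing_left[OF order_refl, of \<alpha> \<beta>] and vr = vanishing_right[OF order_refl, of \<beta> \<alpha>]
  have hat: "(?c (?G \<beta>) - ?X) * Hx \<beta> - (?c (?G \<alpha>) - ?X) * (Hx \<alpha> - 1) \<in> vanishing \<alpha> \<beta>"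
  proof -
    have "(?c (?G \<beta>) - ?X) * Hx \<beta> + (?c (?G \<alpha>) - ?X) * (1 - Hx \<alpha>) \<in> vanishing \<alpha> \<beta>"
      by (intro vanishing_add vanishing_mult vl vr pwx_closed)
    then show ?thesis by (simp add: algebra_simps)
  qed
  show ?thesis
  proof (cases h)
    case HOne
    have "xi_itg_between A \<alpha> \<beta> (fun_x u * fun_xi g * heavi_xi h * Hhat)
        - fun_x u * (fun_x (hv_int h g) * heavi_x h + ?c (hv_const h g) - ?c (primitive \<alpha> h g))
      = fun_x u * ((?c (?G \<beta>) - ?X) * Hx \<beta> - (?c (?G \<alpha>) - ?X) * (Hx \<alpha> - 1))"
      unfolding m unfolding HOne
      by (simp add: xi_itg_between_def xi_itg_single xi_ev_mult xi_ev_gens xi_ev_hat pw2_one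
          hv_int_def hv_const_def primitive_HOne pw2_const_simps algebra_simps)
    then show ?thesis using vanishing_mult[OF hat pwx_closed(5)] by simp
  next
    case (Hv a)
    let ?S = "\<lambda>c. primitive c (Hv a) g" and ?k = "hv_const (Hv a) g"
    define Z where "Z = (?c (?G \<beta>) - ?X) * Hx \<beta> - (?c (?G \<alpha>) - ?X) * (Hx \<alpha> - 1)"
    define Y where "Y = fun_x (J g - \<kappa> (?G a)) - (?X - ?c (?G a))"
    define R where "R = Hx a * (?X - ?c (?G \<beta>) + ?c (?S \<beta>) - ?c (?S \<alpha>))
        - ((?X - ?c (?G a)) * Hx a + ?c ?k - ?c (?S \<alpha>))"
    have expand: "xi_itg_between A \<alpha> \<beta> (fun_x u * fun_xi g * heavi_xi h * Hhat)
        - fun_x u * (fun_x (hv_int h g) * heavi_x h + ?c (hv_const h g) - ?c (primitive \<alpha> h g))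
      = fun_x u * (Hx a * Z + R - Hx a * Y)"
      unfolding m unfolding Hv
      by (simp add: xi_itg_between_def xi_itg_single xi_ev_mult xi_ev_gens xi_ev_simps xi_ev_hat xi_ev_basis
          pw2_one hv_int_def itg_from_def primitive_HOne Z_def Y_def R_def algebra_simps
          del: xi_itg_basis.simps)
    \<comment> \<open>The cases are a jump before, inside and after \<open>[\<alpha>, \<beta>]\<close>, where \<open>H\<^sub>a(x)\<close> is \<open>1\<close>, itself and \<open>0\<close>.\<close>
    have R: "R \<in> vanishing \<alpha> \<beta>"
    proof (cases "a \<le> \<alpha>")
      case True
      then have "a \<le> \<beta>" using assms by simp
      then have "R = - ((?X - ?c (?G \<beta>) + ?c (?S \<beta>) - ?c (?S \<alpha>) - (?X - ?c (?G a))) * (1 - Hx a))"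
        using True by (simp add: R_def primitive_Hv pw2_const_simps algebra_simps)
      then show ?thesis
        using vanishing_uminus[OF vanishing_mult[OF vanishing_left[OF True], of _ \<beta>]] pwx_closed
        by (metis (no_types, lifting))
    next
      case False
      show ?thesis
      proof (cases "a \<le> \<beta>")
        case True
        then have "R = 0"
          using False by (simp add: R_def primitive_Hv pw2_const_simps algebra_simps)
        then show ?thesis by (simp add: vanishing_0)
      next
        case False
        have "R = (?X - ?c (?G \<beta>) + ?c (?S \<beta>) - ?c (?S \<alpha>) - (?X - ?c (?G a))) * Hx a"
          using False \<open>\<not> a \<le> \<alpha>\<close> by (simp add: R_def primitive_Hv pw2_const_simps algebra_simps)
        moreover have "\<dots> \<in> vanishing \<alpha> \<beta>"
          using False by (intro vanishing_mult vanishing_right pwx_closed) simp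
        ultimately show ?thesis by simp
      qed
    qed
    have "Y \<in> vanishing \<alpha> \<beta>" unfolding Y_def by (rule vanishing_fun_x)
    moreover have "Z \<in> vanishing \<alpha> \<beta>" unfolding Z_def by (rule hat)
    ultimately show ?thesis
      unfolding expand using R by (intro vanishing_mult vanishing_add vanishing_diff pwx_closed)
  qed
qed

end

section \<open>The Green's function\<close>

context shifted_ida
begin

text \<open>Coefficient of \<open>u(x)\<close> by which \<open>I\<^sub>\<alpha>\<^sup>\<beta>\<close> of the Green's function of one term, applied to \<open>g h\<close>, exceeds
  the operator itself on \<open>[\<alpha>, \<beta>]\<close>.  The first two summands come from \<open>H\<^sub>0(\<xi>)\<close>, which both kinds of
  terms contain.\<close>

definition defect :: "'k \<Rightarrow> 'k \<Rightarrow> 'k option \<Rightarrow> 'k heavi \<Rightarrow> 'f \<Rightarrow> 'k" where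
  "defect \<alpha> \<beta> s h g = primitive \<beta> (Hv 0 + h) g - primitive \<alpha> (Hv 0 + h) g
     - (case s of None \<Rightarrow> primitive \<beta> h g
        | Some a \<Rightarrow> primitive \<beta> (Hv a + h) g - primitive \<alpha> (Hv a + h) g + primitive a h g)"

lemma defect_additive: "additive (defect \<alpha> \<beta> s h)"
  by (simp add: defect_def additive_def additive.add[OF primitive_additive] split: option.split)

lemma defect_cmult: "defect \<alpha> \<beta> s h (\<kappa> c * g) = c * defect \<alpha> \<beta> s h g"
  by (simp add: defect_def primitive_cmult right_diff_distrib distrib_left split: option.split)

definition piece :: "'f \<Rightarrow> 'k option \<Rightarrow> 'k heavi \<Rightarrow> 'f \<Rightarrow> ('k, 'f) pw" where
  "piece u s h g = of_F u * (case s of None \<Rightarrow> pw_itg A (single h g)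
     | Some a \<Rightarrow> of_F (\<kappa> (primitive a h g)))"

lemma vanishing_pw_x_of_F:
  "pw_x (of_F (u * \<kappa> c)) - fun_x u * pw2_const c \<in> vanishing \<alpha> \<beta>"
proof -
  have "pw_x (of_F (u * \<kappa> c)) - fun_x (u * \<kappa> c) * heavi_x HOne \<in> vanishing \<alpha> \<beta>"
    by (rule vanishing_pw_x_single)
  moreover have "fun_x u * (fun_x (\<kappa> c) - pw2_const c) \<in> vanishing \<alpha> \<beta>"
    by (intro vanishing_mult vanishing_fun_x pwx_closed)
  ultimately have "(pw_x (of_F (u * \<kappa> c)) - fun_x (u * \<kappa> c) * heavi_x HOne)
      + fun_x u * (fun_x (\<kappa> c) - pw2_const c) \<in> vanishing \<alpha> \<beta>"
    by (rule vanishing_add)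
  then show ?thesis by (simp add: pw2_one right_diff_distrib pw2_mult)
qed

lemma vanishing_pw_x_piece_None:
  "pw_x (piece u None h g) - fun_x u * (fun_x (hv_int h g) * heavi_x h + pw2_const (hv_const h g))
    \<in> vanishing \<alpha> \<beta>"
proof -
  let ?p = "single h (u * hv_int h g)" and ?r = "of_F (u * \<kappa> (hv_const h g))"
  have "pw_x (?p + ?r) - (pw_x ?p + pw_x ?r) \<in> vanishing \<alpha> \<beta>"
    by (rule vanishing_pw_x_add)
  from vanishing_add[OF this vanishing_add[OF vanishing_pw_x_single[of h "u * hv_int h g"]
      vanishing_pw_x_of_F[of u "hv_const h g"]]]
  show ?thesis
    by (simp add: piece_def pw_itg_single of_F_mult_single distrib_left pw2_mult(1)[symmetric] mult.assoc
        algebra_simps)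
qed

lemma vanishing_green_term:
  assumes "\<alpha> \<le> \<beta>"
  shows "xi_itg_between A \<alpha> \<beta> (fun_x u * fun_xi v *
        (case s of None \<Rightarrow> Hhat + Hxi 0 - 1 | Some a \<Rightarrow> Hxi 0 - Hxi a) * (fun_xi \<phi> * heavi_xi h))
      - (pw_x (piece u s h (v * \<phi>)) + fun_x u * pw2_const (defect \<alpha> \<beta> s h (v * \<phi>)))
    \<in> vanishing \<alpha> \<beta>"
proof -
  let ?g = "v * \<phi>"
  have gens: "fun_x u * fun_xi v * Hxi c * (fun_xi \<phi> * heavi_xi h) = fun_x u * fun_xi ?g * heavi_xi (Hv c + h)"
    "fun_x u * fun_xi v * Hhat * (fun_xi \<phi> * heavi_xi h) = fun_x u * fun_xi ?g * heavi_xi h * Hhat"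
    "fun_x u * fun_xi v * (fun_xi \<phi> * heavi_xi h) = fun_x u * fun_xi ?g * heavi_xi h" for c
    by (simp_all add: ac_simps flip: pw2_mult(2,4))
  show ?thesis
  proof (cases s)
    case None
    have "xi_itg_between A \<alpha> \<beta> (fun_x u * fun_xi v * (Hhat + Hxi 0 - 1) * (fun_xi \<phi> * heavi_xi h))
      = xi_itg_between A \<alpha> \<beta> (fun_x u * fun_xi ?g * heavi_xi h * Hhat)
        + fun_x u * pw2_const (primitive \<beta> (Hv 0 + h) ?g - primitive \<alpha> (Hv 0 + h) ?g)
        - fun_x u * pw2_const (primitive \<beta> h ?g - primitive \<alpha> h ?g)"
      by (simp only: distrib_left distrib_right right_diff_distrib left_diff_distrib mult_1_right
          gens xi_between_simps xi_between_False)
    then have eq: "xi_itg_between A \<alpha> \<beta> (fun_x u * fun_xi v * (Hhat + Hxi 0 - 1) * (fun_xi \<phi> * heavi_xi h))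
        - (pw_x (piece u None h ?g) + fun_x u * pw2_const (defect \<alpha> \<beta> None h ?g))
      = (xi_itg_between A \<alpha> \<beta> (fun_x u * fun_xi ?g * heavi_xi h * Hhat)
          - fun_x u * (fun_x (hv_int h ?g) * heavi_x h + pw2_const (hv_const h ?g) - pw2_const (primitive \<alpha> h ?g)))
        - (pw_x (piece u None h ?g) - fun_x u * (fun_x (hv_int h ?g) * heavi_x h + pw2_const (hv_const h ?g)))"
      by (simp add: defect_def pw2_const_simps algebra_simps)
    show ?thesis
      unfolding None option.case eq
      by (rule vanishing_diff[OF xi_between_True[OF assms] vanishing_pw_x_piece_None])
  next
    case (Some a)
    have "xi_itg_between A \<alpha> \<beta> (fun_x u * fun_xi v * (Hxi 0 - Hxi a) * (fun_xi \<phi> * heavi_xi h))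
      = fun_x u * pw2_const (primitive \<beta> (Hv 0 + h) ?g - primitive \<alpha> (Hv 0 + h) ?g)
        - fun_x u * pw2_const (primitive \<beta> (Hv a + h) ?g - primitive \<alpha> (Hv a + h) ?g)"
      by (simp only: right_diff_distrib left_diff_distrib gens xi_between_simps xi_between_False)
    then have eq: "xi_itg_between A \<alpha> \<beta> (fun_x u * fun_xi v * (Hxi 0 - Hxi a) * (fun_xi \<phi> * heavi_xi h))
        - (pw_x (piece u (Some a) h ?g) + fun_x u * pw2_const (defect \<alpha> \<beta> (Some a) h ?g))
      = - (pw_x (of_F (u * \<kappa> (primitive a h ?g))) - fun_x u * pw2_const (primitive a h ?g))"
      by (simp add: defect_def piece_def of_F_mult_single pw2_const_simps algebra_simps)
    show ?thesis
      unfolding Some option.case eq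
      by (rule vanishing_uminus[OF vanishing_pw_x_of_F])
  qed
qed

definition total_defect :: "'k \<Rightarrow> 'k \<Rightarrow> ('k, 'f) pw \<Rightarrow> 'k option \<Rightarrow> 'f \<Rightarrow> 'k" where
  "total_defect \<alpha> \<beta> f s v = (\<Sum>h\<in>keys f. defect \<alpha> \<beta> s h (v * lookup f h))"

lemma integral_op_pw_pieces:
  "integral_op_pw A gs f
    = (\<Sum>(u, s, v)\<leftarrow>gs. \<Sum>h\<in>keys f. piece u s h (v * lookup f h))"
proof -
  have vf: "of_F v * f = (\<Sum>h\<in>keys f. single h (v * lookup f h))" for v
    using arg_cong[OF pm_eq_sum_single[of f], of "\<lambda>p. of_F v * p"]
    by (simp add: sum_distrib_left of_F_mult_single)
  have "of_F u * (let w = pw_itg A (of_F v * f) in case s of None \<Rightarrow> w | Some a \<Rightarrow> pw_const A (pw_ev A a w))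
      = (\<Sum>h\<in>keys f. piece u s h (v * lookup f h))" for u s v
    by (cases s) (simp_all add: vf piece_def pw_itg_simps pw_ev_simps pw_const_def primitive_eq const_sum
        additive.sum[OF additive_single] sum_distrib_left)
  then show ?thesis by (simp add: integral_op_pw_def)
qed

text \<open>All terms and all pieces of \<open>f\<close> are collected; the defects add up to an element of \<open>F\<close>, so that
  it can be shown to vanish in \<open>F\<close> itself.\<close>

lemma vanishing_greens_function:
  assumes "\<alpha> \<le> \<beta>"
  shows "xi_itg_between A \<alpha> \<beta> (greens_function gs * pw_xi f)
      - (pw_x (integral_op_pw A gs f) + fun_x (\<Sum>(u, s, v)\<leftarrow>gs. \<kappa> (total_defect \<alpha> \<beta> f s v) * u))
    \<in> vanishing \<alpha> \<beta>"
proof -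
  let ?K = "keys f" and ?f = "lookup f"
  define g where "g u s v = fun_x u * fun_xi v *
      (case s of None \<Rightarrow> Hhat + Hxi 0 - 1 | Some a \<Rightarrow> Hxi 0 - Hxi a)" for u v :: 'f and s :: "'k option"
  define X where "X x = (case x of (u, s, v) \<Rightarrow>
      \<Sum>h\<in>?K. xi_itg_between A \<alpha> \<beta> (g u s v * (fun_xi (?f h) * heavi_xi h)))" for x
  define P where "P x = (case x of (u, s, v) \<Rightarrow> \<Sum>h\<in>?K. piece u s h (v * ?f h))" for x
  define P' where "P' x = (case x of (u, s, v) \<Rightarrow> \<Sum>h\<in>?K. pw_x (piece u s h (v * ?f h)))" for x
  define E where "E x = (case x of (u, s, v) \<Rightarrow> \<kappa> (total_defect \<alpha> \<beta> f s v) * u)" for x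
  define E' :: "'f \<times> 'k option \<times> 'f \<Rightarrow> ('k, 'f) pw2"
    where "E' x = (case x of (u, s, v) \<Rightarrow> fun_x u * pw2_const (total_defect \<alpha> \<beta> f s v))" for x
  have "greens_function gs * pw_xi f = (\<Sum>x\<leftarrow>gs. case x of (u, s, v) \<Rightarrow> g u s v * pw_xi f)"
    unfolding greens_function_def by (simp add: g_def sum_list_mult_const[symmetric] case_prod_unfold)
  also have "xi_itg_between A \<alpha> \<beta> \<dots> = (\<Sum>x\<leftarrow>gs. X x)"
    unfolding additive_sum_list[OF xi_between_additive]
    by (simp add: X_def case_prod_unfold pw_xi_def pm_sum_def sum_distrib_left xi_between_simps)
  finally have lhs: "xi_itg_between A \<alpha> \<beta> (greens_function gs * pw_xi f) = (\<Sum>x\<leftarrow>gs. X x)" .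
  have rhs: "integral_op_pw A gs f = (\<Sum>x\<leftarrow>gs. P x)"
    "(\<Sum>(u, s, v)\<leftarrow>gs. \<kappa> (total_defect \<alpha> \<beta> f s v) * u) = (\<Sum>x\<leftarrow>gs. E x)"
    by (simp_all add: integral_op_pw_pieces P_def E_def)
  have const_sum2: "pw2_const (\<Sum>h\<in>K. c h) = (\<Sum>h\<in>K. pw2_const (c h) :: ('k, 'f) pw2)"
    for c and K :: "'k heavi set"
    by (induction K rule: infinite_finite_induct) (simp_all add: pw2_const_simps)
  have XPE: "X x - (P' x + E' x) \<in> vanishing \<alpha> \<beta>" for x
  proof -
    obtain u s v where x: "x = (u, s, v)" by (cases x)
    have "X x - (P' x + E' x) = (\<Sum>h\<in>?K. xi_itg_between A \<alpha> \<beta> (g u s v * (fun_xi (?f h) * heavi_xi h))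
        - (pw_x (piece u s h (v * ?f h)) + fun_x u * pw2_const (defect \<alpha> \<beta> s h (v * ?f h))))"
      by (simp add: x X_def P'_def E'_def total_defect_def const_sum2 sum_subtractf sum.distrib sum_distrib_left)
    then show ?thesis
      using vanishing_sum[OF vanishing_green_term[OF assms]] by (simp add: g_def)
  qed
  have PP: "pw_x (P x) - P' x \<in> vanishing \<alpha> \<beta>" for x
    using vanishing_pw_x_sum by (cases x) (simp add: P_def P'_def)
  have EE: "fun_x (E x) - E' x \<in> vanishing \<alpha> \<beta>" for x
    using vanishing_fun_x(2) by (cases x) (simp add: E_def E'_def mult.commute[of "fun_x _"])
  have "(\<Sum>x\<leftarrow>gs. (X x - (P' x + E' x)) - (pw_x (P x) - P' x) - (fun_x (E x) - E' x)) \<in> vanishing \<alpha> \<beta>"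
    by (intro vanishing_sum_list vanishing_diff XPE PP EE)
  moreover have "(\<Sum>x\<leftarrow>gs. (X x - (P' x + E' x)) - (pw_x (P x) - P' x) - (fun_x (E x) - E' x))
      = (\<Sum>x\<leftarrow>gs. X x) - (\<Sum>x\<leftarrow>gs. pw_x (P x)) - (\<Sum>x\<leftarrow>gs. fun_x (E x))"
    by (induction gs) (simp_all add: algebra_simps)
  ultimately have "(\<Sum>x\<leftarrow>gs. X x) - (\<Sum>x\<leftarrow>gs. pw_x (P x)) - (\<Sum>x\<leftarrow>gs. fun_x (E x)) \<in> vanishing \<alpha> \<beta>"
    by simp
  from vanishing_diff[OF this vanishing_add[OF vanishing_pw_x_sum_list[of P gs]
      vanishing_fun_x_sum_list[of E gs]]]
  show ?thesis
    unfolding lhs rhs by (simp add: algebra_simps)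
qed

lemma total_defect_additive: "additive (total_defect \<alpha> \<beta> f s)"
  by (simp add: additive_def total_defect_def distrib_right additive.add[OF defect_additive] sum.distrib)

lemma total_defect_cmult: "total_defect \<alpha> \<beta> f s (\<kappa> c * v) = c * total_defect \<alpha> \<beta> f s v"
  by (simp add: total_defect_def mult.assoc defect_cmult sum_distrib_left)

text \<open>For \<open>a\<close> in \<open>[\<alpha>, \<beta>]\<close> the summand from \<open>H\<^sub>a(\<xi>)\<close> is \<open>\<integral>\<^sub>a\<^sup>\<beta>\<close>, and together with \<open>\<integral>\<^sub>0\<^sup>a\<close> it is
  \<open>\<integral>\<^sub>0\<^sup>\<beta>\<close> for every \<open>a\<close>.\<close>

lemma total_defect_inside:
  assumes "\<alpha> \<le> a" "a \<le> \<beta>"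
  shows "total_defect \<alpha> \<beta> f (Some a) v = total_defect \<alpha> \<beta> f None v"
  unfolding total_defect_def defect_def by (simp add: primitive_restrict[OF assms])

lemma total_defect_0: "total_defect \<alpha> \<beta> f (Some 0) v = 0"
  by (simp add: total_defect_def defect_def primitive_0)

end

context well_posed_system
begin

lemma points_subset_eval_points: "i < n \<Longrightarrow> points (bs ! i) \<subseteq> eval_points bs"
  unfolding eval_points_def points_def
  by (rule order_trans[OF _ UN_upper[of "bs ! i" "set bs"]]) (auto simp: length_bs)

lemma eval_points_nonempty: "eval_points bs \<noteq> {}"
proof
  assume "eval_points bs = {}"
  then have "points (bs ! 0) = {}" using points_subset_eval_points pos by blast
  then have "\<beta> 0 (z 0) = 0" by (simp add: cond_eq[OF order_less_bs[OF pos]])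
  then show False using \<beta>z[of 0 0] pos by simp
qed

text \<open>If the global coefficients of \<open>\<beta>\<^sub>i\<close> add up to \<open>0\<close>, the integrals in the densities cancel and
  \<open>\<Sum>j. \<beta>\<^sub>i(z\<^sub>j) v\<^sub>j\<close> is left.\<close>

lemma sum_density:
  assumes "i < n" and zero: "pm_sum (\<lambda>a v. v) (snd (bs ! i)) = 0"
  shows "(\<Sum>a\<in>points (bs ! i). density (bs ! i) a) = v i"
proof -
  let ?b = "bs ! i"
  let ?w = "lookup (snd ?b)"
  have w: "(\<Sum>a\<in>points ?b. ?w a) = 0"
    using zero pm_sum_superset[of "points ?b" "snd ?b" "\<lambda>a v. v"] finite_points
    by (simp add: points_def)
  have "(\<Sum>a\<in>points ?b. density ?b a) = (\<Sum>j<n. \<kappa> (\<beta> i (z j)) * v j - v j * J ((\<Sum>a\<in>points ?b. ?w a) * z j))"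
    unfolding density_def Let_def
    by (subst sum.swap)
      (simp add: cond_eq[OF order_less_bs[OF assms(1)]] sum_subtractf const_sum sum_distrib_right
        sum_distrib_left J_simps)
  also have "\<dots> = (\<Sum>j<n. if j = i then v i else 0)"
    by (rule sum.cong) (auto simp: w J_simps \<beta>z assms(1))
  finally show ?thesis using assms(1) by simp
qed

text \<open>By \<open>total_defect_inside\<close> one functional applies to all terms.  It is \<open>0\<close> if \<open>0\<close> is an evaluation
  point; otherwise the terms \<open>z\<^sub>i \<integral> v\<^sub>i\<close> are cancelled by those with \<open>e\<^sub>a\<close> through \<open>sum_density\<close>.\<close>

lemma total_defect_greens_list:
  assumes inside: "\<And>a. a \<in> eval_points bs \<Longrightarrow> \<alpha> \<le> a \<and> a \<le> \<gamma>"
  shows "(\<Sum>(u, s, w)\<leftarrow>greens_list. \<kappa> (total_defect \<alpha> \<gamma> f s w) * u) = 0"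
proof -
  let ?d = "total_defect \<alpha> \<gamma> f None"
  note d_lin = additive.sum[OF total_defect_additive] additive.diff[OF total_defect_additive]
  have "(\<Sum>(u, s, w)\<leftarrow>greens_list. \<kappa> (total_defect \<alpha> \<gamma> f s w) * u)
      = (\<Sum>i<n. \<kappa> (?d (v i)) * z i) + (\<Sum>i<n. \<Sum>a\<in>points (bs ! i). \<kappa> (?d (density (bs ! i) a)) * (- z i))"
    unfolding sum_greens_list
    using inside points_subset_eval_points
    by (intro arg_cong2[where f = "(+)"] sum.cong refl) (auto simp: subset_iff total_defect_inside)
  also have "\<dots> = (\<Sum>i<n. \<kappa> (?d (v i - (\<Sum>a\<in>points (bs ! i). density (bs ! i) a))) * z i)"
    by (simp add: d_lin const_diff const_sum left_diff_distrib sum_subtractf sum_distrib_right sum_negf)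
  also have "\<dots> = 0"
  proof (cases "\<forall>b\<in>set bs. pm_sum (\<lambda>a v. v) (snd b) = 0")
    case True
    then have "v i - (\<Sum>a\<in>points (bs ! i). density (bs ! i) a) = 0" if "i < n" for i
      using that length_bs nth_mem[of i bs] by (simp add: sum_density)
    then show ?thesis by (simp add: additive.zero[OF total_defect_additive])
  next
    case False
    then have "0 \<in> eval_points bs" unfolding eval_points_def by force
    then have "?d w = 0" for w
      using total_defect_inside[of \<alpha> 0 \<gamma> f w] inside[of 0] total_defect_0[of \<alpha> \<gamma> f w] by simp
    then show ?thesis by simp
  qed
  finally show ?thesis .
qed

lemma greens_function_solution:
  assumes eq: "op_eq A (op_of_integral_op gs) (op_of_integral_op greens_list)"
    and inside: "\<And>a. a \<in> eval_points bs \<Longrightarrow> \<alpha> \<le> a \<and> a \<le> \<gamma>"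
  shows "equal_on A \<alpha> \<gamma> (pw_x (integral_op_pw A gs f))
    (xi_itg_between A \<alpha> \<gamma> (greens_function gs * pw_xi f))"
proof -
  have "\<alpha> \<le> \<gamma>" using eval_points_nonempty inside by (meson ex_in_conv order_trans)
  have bal: "balanced (\<lambda>u w. \<kappa> (total_defect \<alpha> \<gamma> f s w) * u)" for s
    by (simp add: balanced_def additive_def additive.add[OF total_defect_additive] total_defect_cmult
        const_add const_mult distrib_left distrib_right mult.assoc mult.left_commute)
  have "(\<Sum>(u, s, w)\<leftarrow>gs. \<kappa> (total_defect \<alpha> \<gamma> f s w) * u)
      = (\<Sum>(u, s, w)\<leftarrow>greens_list. \<kappa> (total_defect \<alpha> \<gamma> f s w) * u)"
    by (rule balanced_sums_cong[OF eq bal]) (simp add: total_defect_0)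
  also have "\<dots> = 0" by (rule total_defect_greens_list[OF inside])
  finally have "xi_itg_between A \<alpha> \<gamma> (greens_function gs * pw_xi f)
      - (pw_x (integral_op_pw A gs f) + fun_x 0) \<in> vanishing \<alpha> \<gamma>"
    using vanishing_greens_function[OF \<open>\<alpha> \<le> \<gamma>\<close>, of gs f] by simp
  from vanishing_uminus[OF vanishing_add[OF this vanishing_fun_x(4)]]
  show ?thesis unfolding equal_on_iff by (simp add: algebra_simps)
qed

end


section \<open>Boundary problems with piecewise forcing function\<close>

text \<open>An operator of order \<open>0\<close> with leading coefficient \<open>1\<close> is \<open>1\<close>, and the Green's operator is \<open>1\<close>
  as well.\<close>

lemma order_zero_problem:
  assumes "shifted_ida A" and st: "stieltjes_problem A T bs" and deg: "degree T = 0"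
    and G: "greens_equations A T bs G"
  shows "solves A T bs f u \<longleftrightarrow> u = f" and "\<not> op_eq A G (op_of_integral_op gs)"
proof -
  interpret shifted_ida A by fact
  have c: "coeff T (degree T) = 1" and bs: "bs = []"
    using st deg by (simp_all add: stieltjes_problem_def)
  then have T: "diffop A T x = x" for x by (simp add: diffop_def deg)
  show "solves A T bs f u \<longleftrightarrow> u = f"
    unfolding solves_def diffop_dist_eq_iff[OF c]
    by (auto simp: bs T deg intro: poly_mapping_eqI)
  have "op_eq A G (op_of_diffop T * G)"
    using op_eq_sym[OF op_eq_mult_right[OF op_fun_1, of G]] c by (simp add: op_of_diffop_def deg)
  also have "op_eq A \<dots> 1" using G by (simp add: greens_equations_def)
  finally have "op_eq A G 1" .
  then show "\<not> op_eq A G (op_of_integral_op gs)"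
    using integral_op_not_1 op_eq_trans op_eq_sym by blast
qed

theorem proposition30:
  fixes A :: "('k::linordered_field, 'f::comm_ring_1) ida"
    and T :: "'f poly"
    and bs :: "('k, 'f) stieltjes list"
  assumes "integro_differential_algebra A" and "strongly_ordinary A" and "shifted A"
    and "stieltjes_problem A T bs" and "regular A T bs" and "well_posed T bs"
    and "\<exists>G. greens_equations A T bs G"
  shows "(\<forall>f. \<exists>!u. solves A T bs f u) \<and>
    (\<forall>G. greens_operator A T bs G \<longrightarrow>
      (degree T > 0 \<longrightarrow> (\<exists>gs. op_eq A G (op_of_integral_op gs))) \<and>
      (\<forall>gs f u. op_eq A G (op_of_integral_op gs) \<and> solves A T bs f u \<longrightarrow>
        u = integral_op_pw A gs f \<and>
        (\<forall>\<alpha> \<beta>. (\<forall>a\<in>eval_points bs. \<alpha> \<le> a \<and> a \<le> \<beta>) \<longrightarrow>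
          equal_on A \<alpha> \<beta> (pw_x u) (xi_itg_between A \<alpha> \<beta> (greens_function gs * pw_xi f)))))"
proof (cases "degree T = 0")
  have ctx: "shifted_ida A"
    using assms(1-3) by (simp add: shifted_ida_def strongly_ordinary_def)
  case True
  note zero = order_zero_problem[OF ctx assms(4) True]
  obtain G0 where "greens_equations A T bs G0" using assms(7) by blast
  from zero(1)[OF this] have "\<exists>!u. solves A T bs f u" for f by auto
  moreover have "\<not> op_eq A G (op_of_integral_op gs)" if "greens_operator A T bs G" for G gs
    using zero(2) that unfolding greens_operator_def by blast
  ultimately show ?thesis using True by (intro conjI allI impI) simp_all
next
  have ctx: "shifted_ida A"
    using assms(1-3) by (simp add: shifted_ida_def strongly_ordinary_def)
  case False
  obtain G0 where "greens_equations A T bs G0" using assms(7) by blast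
  then interpret regular_problem A T bs G0
    using ctx assms(4,5) False
    by (simp add: regular_problem_def regular_problem_axioms_def greens_equations_def)
  obtain z where z: "\<And>j. j < degree T \<Longrightarrow> diffop A T (z j) = 0"
    "\<And>i j. i < degree T \<Longrightarrow> j < degree T \<Longrightarrow> cond A (bs ! i) (z j) = (if i = j then 1 else 0)"
    using ex_dual_kernel by blast
  interpret dual_kernel A T bs G0 z by unfold_locales (use z in auto)
  obtain v where v: "\<And>k. k < degree T \<Longrightarrow>
      (\<Sum>j<degree T. (der A ^^ k) (z j) * v j) = (if k = degree T - 1 then 1 else 0)"
    using ex_impulse_response by blast
  interpret well_posed_system A T bs G0 z v by unfold_locales (use v assms(6) in auto)
  have ex1: "\<exists>!u. solves A T bs f u" for f
    using solves_solution solution_unique by blast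
  have repr: "op_eq A G (op_of_integral_op greens_list)" if "greens_operator A T bs G" for G
    using that greens_equations_greens_list op_eq_sym unfolding greens_operator_def by blast
  have eq: "op_eq A (op_of_integral_op gs) (op_of_integral_op greens_list)"
    if "greens_operator A T bs G" "op_eq A G (op_of_integral_op gs)" for G gs
    using op_eq_trans[OF op_eq_sym[OF that(2)] repr[OF that(1)]] .
  have u: "u = integral_op_pw A gs f"
    if "greens_operator A T bs G" "op_eq A G (op_of_integral_op gs)" "solves A T bs f u" for G gs f u
    unfolding integral_op_pw_cong[OF eq[OF that(1,2)]] integral_op_pw_greens_list
    by (rule solution_unique[OF that(3) solves_solution])
  show ?thesis
  proof (intro conjI allI impI)
    show "\<exists>gs. op_eq A G (op_of_integral_op gs)" if "greens_operator A T bs G" for G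
      using repr[OF that] by (rule exI)
    show "u = integral_op_pw A gs f"
      if "greens_operator A T bs G" "op_eq A G (op_of_integral_op gs) \<and> solves A T bs f u" for G gs f u
      using u that by blast
    show "equal_on A \<alpha> \<beta> (pw_x u) (xi_itg_between A \<alpha> \<beta> (greens_function gs * pw_xi f))"
      if "greens_operator A T bs G" "op_eq A G (op_of_integral_op gs) \<and> solves A T bs f u"
        "\<forall>a\<in>eval_points bs. \<alpha> \<le> a \<and> a \<le> \<beta>" for G gs f u \<alpha> \<beta>
    proof -
      have "u = integral_op_pw A gs f" using u that(1,2) by blast
      then show ?thesis
        using greens_function_solution[OF eq[OF that(1)]] that(2,3) by simp
    qed
  qed (rule ex1)
qed

end
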